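(* Let $d \geq 4$ be an integer. Then each of the following four statements about zonoids in $\mathbb{R}^d$ is false (that is, for each of them there exist objects satisfying its hypotheses for which the stated inequality fails): (1) (Local mixed-volume inequality) For all zonoids $A, B, C \subseteq \mathbb{R}^d$, $$|A|\,V(A[d-2],B,C) \leq \frac{d}{d-1}\, V(A[d-1],B)\,V(A[d-1],C).$$ (2) (Local Loomis-Whitney inequality) For every zonoid $A \subseteq \mathbb{R}^d$ and all linearly independent $u,v \in S^{d-1}$, $$|A|\,\bigl|P_{\operatorname{span}\{u,v\}^{\perp}}A\bigr|_{d-2}\,\sqrt{1-\langle u,v\rangle^2} \leq \bigl|P_{u^\perp}A\bigr|_{d-1}\,\bigl|P_{v^\perp}A\bigr|_{d-1}.$$ (3) (Monotonicity of the projection-volume ratio) For all zonoids $A, B \subseteq \mathbb{R}^d$ with $A$ full-dimensional, and every $u \in S^{d-1}$, $$\frac{|A+B|}{\bigl|P_{u^\perp}(A+B)\bigr|_{d-1}} \geq \frac{|A|}{\bigl|P_{u^\perp}A\bigr|_{d-1}}.$$ (4) (Monotonicity of the volume-to-surface-area ratio) For all zonoids $A, B \subseteq \mathbb{R}^d$ with $A$ full-dimensional, $$\frac{|A+B|}{|\partial(A+B)|_{d-1}} \geq \frac{|A|}{|\partial A|_{d-1}}.$$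
   Context: A zonotope in $\mathbb{R}^d$ is a Minkowski sum of finitely many line segments $[0,v_i] = \mathrm{conv}(0,v_i)$, $v_i \in \mathbb{R}^d$; a zonoid is a limit of zonotopes in the Hausdorff metric. The sign $+$ between sets is Minkowski addition. $|\cdot|_k$ denotes $k$-dimensional volume and $|\cdot| = |\cdot|_d$; $P_L A$ is the orthogonal projection of $A$ onto the linear subspace $L$; $\partial A$ is the boundary of $A$ (so $|\partial A|_{d-1}$ is its surface area); $S^{d-1}$ is the Euclidean unit sphere in $\mathbb{R}^d$. $V(K_1,\dots,K_d)$ is the mixed volume of convex bodies in $\mathbb{R}^d$ with the standard normalization, i.e. the symmetric functional determined by $|t_1K_1+\dots+t_mK_m| = \sum_{i_1,\dots,i_d=1}^m V(K_{i_1},\dots,K_{i_d})\,t_{i_1}\cdots t_{i_d}$ for all $m \ge 1$, convex bodies $K_1,\dots,K_m \subseteq \mathbb{R}^d$ and $t_i \geq 0$ (so $V(K,\dots,K)=|K|$). $A[j]$ denotes $j$ repeated copies of $A$ among the arguments. *)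

theory Defs
  imports "HOL-Analysis.Analysis"
begin

text \<open>
  Minkowski addition is the operation \<open>+\<close> on sets from \<^theory>\<open>HOL-Library.Set_Algebras\<close>, under which
  sets form a commutative monoid with neutral element \<open>{0}\<close>; \<open>\<Sum>\<close> below is Minkowski summation
  whenever its summands are sets.
\<close>

definition zonotope :: "'a::euclidean_space set \<Rightarrow> bool" where
  "zonotope Z \<longleftrightarrow> (\<exists>(m::nat) v. Z = (\<Sum>i<m. closed_segment 0 (v i)))"

text \<open>Only meaningful for bounded nonempty sets (a metric on the nonempty compact ones).\<close>

definition hausdorff_dist :: "'a::metric_space set \<Rightarrow> 'a set \<Rightarrow> real" where
  "hausdorff_dist S T = max (SUP x\<in>S. infdist x T) (SUP y\<in>T. infdist y S)"

definition zonoid :: "'a::euclidean_space set \<Rightarrow> bool" where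
  "zonoid A \<longleftrightarrow> compact A \<and> A \<noteq> {} \<and>
    (\<exists>Z :: nat \<Rightarrow> 'a set. (\<forall>n. zonotope (Z n)) \<and> (\<lambda>n. hausdorff_dist (Z n) A) \<longlonglongrightarrow> 0)"

text \<open>
  For a list \<open>Ks\<close> of \<open>d\<close> convex bodies in a \<open>d\<close>-dimensional space, \<open>mixed_volume Ks\<close> is the value at
  \<open>Ks\<close> of the symmetric functional given by the polynomial expansion of the volume of Minkowski
  combinations. The expansion is only required for bodies taken (with repetitions) from \<open>Ks\<close>.
  This gives the same number as requiring it for all convex bodies: by polarization such a
  functional is unique on whichever family \<open>\<K>\<close> it is required for, see \<open>mixed_volume_eq\<close>.
\<close>

definition mixed_volume_functional ::
    "'a::euclidean_space set set \<Rightarrow> ('a set list \<Rightarrow> real) \<Rightarrow> bool" where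
  "mixed_volume_functional \<K> V \<longleftrightarrow>
    (\<forall>Ks Ls. length Ks = DIM('a) \<and> set Ks \<subseteq> \<K> \<and> mset Ks = mset Ls \<longrightarrow> V Ks = V Ls) \<and>
    (\<forall>(m::nat) K (t :: nat \<Rightarrow> real). m \<ge> 1 \<and> (\<forall>i<m. K i \<in> \<K> \<and> t i \<ge> 0) \<longrightarrow>
      measure lebesgue (\<Sum>i<m. (*\<^sub>R) (t i) ` K i) =
      (\<Sum>js | length js = DIM('a) \<and> set js \<subseteq> {..<m}. V (map K js) * prod_list (map t js)))"

definition mixed_volume :: "'a::euclidean_space set list \<Rightarrow> real" where
  "mixed_volume Ks = (THE r. \<exists>V. mixed_volume_functional (set Ks) V \<and> r = V Ks)"

lemma mixed_volume_functional_mono: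
  assumes "mixed_volume_functional \<K> V" "\<L> \<subseteq> \<K>"
  shows "mixed_volume_functional \<L> V"
  using assms unfolding mixed_volume_functional_def by (meson subset_eq)

lemma mixed_volume_functional_polarization:
  fixes Ks :: "'a::euclidean_space set list"
  defines "d \<equiv> DIM('a)"
  assumes V: "mixed_volume_functional \<K> V" and Ks: "set Ks \<subseteq> \<K>" "length Ks = d"
  shows "real (card {js. length js = d \<and> set js = {..<d}}) * V Ks =
    (\<Sum>J\<in>Pow {..<d}. (-1) ^ card J *
       measure lebesgue (\<Sum>i<d. (*\<^sub>R) (if i \<in> J then 0 else 1) ` (Ks ! i)))"
proof -
  define L where "L = {js. length js = d \<and> set js \<subseteq> {..<d}}"
  define P where "P = {js. length js = d \<and> set js = {..<d}}"
  have finL: "finite L"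
    using finite_lists_length_eq[of "{..<d}" d] unfolding L_def by (simp add: conj_commute)
  have PL: "P \<subseteq> L" by (auto simp: P_def L_def)
  have d: "d \<ge> 1" unfolding d_def by (simp add: DIM_positive Suc_leI)
  have vol: "measure lebesgue (\<Sum>i<d. (*\<^sub>R) (t i) ` (Ks ! i)) =
      (\<Sum>js\<in>L. V (map ((!) Ks) js) * prod_list (map t js))"
    if "\<And>i. t i \<ge> 0" for t :: "nat \<Rightarrow> real"
  proof -
    have "\<forall>i<d. Ks ! i \<in> \<K> \<and> t i \<ge> 0"
      using that Ks nth_mem by blast
    with V d show ?thesis
      unfolding mixed_volume_functional_def L_def d_def by simp
  qed
  have prod: "prod_list (map (\<lambda>i. if i \<in> J then 0 else 1) js) =
      (if set js \<inter> J = {} then 1 else (0::real))" for J :: "nat set" and js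
    by (induction js) auto
  have alt: "(\<Sum>J\<in>Pow S. (-1) ^ card J) = (if S = {} then 1 else (0::real))"
    if "finite S" for S :: "nat set"
    using that
  proof (induction S)
    case (insert x S)
    have "(\<Sum>J\<in>Pow (insert x S). (-1) ^ card J) =
        (\<Sum>J\<in>Pow S. (-1) ^ card J) + (\<Sum>J\<in>insert x ` Pow S. (-1) ^ card J :: real)"
      unfolding Pow_insert using insert.hyps by (intro sum.union_disjoint) auto
    also have "(\<Sum>J\<in>insert x ` Pow S. (-1) ^ card J :: real) =
        (\<Sum>J\<in>Pow S. (-1) ^ card (insert x J))"
      using insert.hyps by (subst sum.reindex) (auto simp: inj_on_def insert_eq_iff subset_iff)
    also have "\<dots> = (\<Sum>J\<in>Pow S. - ((-1) ^ card J))"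
    proof (rule sum.cong[OF refl])
      fix J assume "J \<in> Pow S"
      then have "finite J" "x \<notin> J" using insert.hyps by (auto intro: finite_subset)
      then show "(-1) ^ card (insert x J) = - ((-1) ^ card J :: real)" by simp
    qed
    finally show ?case by (simp add: sum_negf)
  qed simp
  have inner: "(\<Sum>J\<in>Pow {..<d}. (-1) ^ card J * (if set js \<inter> J = {} then 1 else 0)) =
      (if set js = {..<d} then 1 else (0::real))" if "js \<in> L" for js
  proof -
    have "(\<Sum>J\<in>Pow {..<d}. (-1) ^ card J * (if set js \<inter> J = {} then 1 else 0)) =
        (\<Sum>J\<in>Pow ({..<d} - set js). (-1) ^ card J :: real)"
      by (rule sum.mono_neutral_cong_right) auto
    also have "\<dots> = (if {..<d} - set js = {} then 1 else 0)"
      by (rule alt) simp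
    also have "{..<d} - set js = {} \<longleftrightarrow> set js = {..<d}"
      using that by (auto simp: L_def)
    finally show ?thesis .
  qed
  have "(\<Sum>J\<in>Pow {..<d}. (-1) ^ card J *
       measure lebesgue (\<Sum>i<d. (*\<^sub>R) (if i \<in> J then 0 else 1) ` (Ks ! i))) =
      (\<Sum>J\<in>Pow {..<d}. (-1) ^ card J *
        (\<Sum>js\<in>L. V (map ((!) Ks) js) * (if set js \<inter> J = {} then 1 else 0)))"
    by (subst vol) (auto simp: prod)
  also have "\<dots> = (\<Sum>js\<in>L. \<Sum>J\<in>Pow {..<d}.
        V (map ((!) Ks) js) * ((-1) ^ card J * (if set js \<inter> J = {} then 1 else 0)))"
    by (subst sum.swap) (simp add: sum_distrib_left mult.left_commute)
  also have "\<dots> = (\<Sum>js\<in>L. V (map ((!) Ks) js) * (if set js = {..<d} then 1 else 0))"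
    by (rule sum.cong[OF refl]) (simp only: sum_distrib_left[symmetric] inner)
  also have "\<dots> = (\<Sum>js\<in>P. V (map ((!) Ks) js))"
    by (rule sum.mono_neutral_cong_right[OF finL PL]) (auto simp: P_def L_def)
  also have "\<dots> = (\<Sum>js\<in>P. V Ks)"
  proof (rule sum.cong[OF refl])
    fix js assume js: "js \<in> P"
    then have "distinct js" by (simp add: P_def card_distinct)
    with js have "mset js = mset [0..<d]"
      using set_eq_iff_mset_eq_distinct[of js "[0..<d]"] by (simp add: P_def atLeast0LessThan)
    then have "mset (map ((!) Ks) js) = mset (map ((!) Ks) [0..<d])"
      by simp
    also have "map ((!) Ks) [0..<d] = Ks"
      using Ks map_nth[of Ks] by simp
    finally have eq: "mset Ks = mset (map ((!) Ks) js)" by simp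
    have "\<forall>Ks Ls. length Ks = d \<and> set Ks \<subseteq> \<K> \<and> mset Ks = mset Ls \<longrightarrow> V Ks = V Ls"
      using V unfolding mixed_volume_functional_def d_def by (rule conjunct1)
    with Ks eq show "V (map ((!) Ks) js) = V Ks" by metis
  qed
  finally show ?thesis unfolding P_def by simp
qed

lemma mixed_volume_eq:
  fixes Ks :: "'a::euclidean_space set list"
  assumes "mixed_volume_functional \<K> V" "set Ks \<subseteq> \<K>" "length Ks = DIM('a)"
  shows "mixed_volume Ks = V Ks"
proof -
  let ?P = "{js. length js = DIM('a) \<and> set js = {..<DIM('a)}}"
  have "finite ?P"
    by (rule finite_subset[OF _ finite_lists_length_eq[of "{..<DIM('a)}" "DIM('a)"]]) auto
  moreover have "[0..<DIM('a)] \<in> ?P" by auto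
  ultimately have "card ?P \<noteq> 0" by (metis card_0_eq empty_iff)
  have V: "mixed_volume_functional (set Ks) V"
    using assms mixed_volume_functional_mono by blast
  show ?thesis
    unfolding mixed_volume_def
  proof (rule the_equality)
    show "\<exists>W. mixed_volume_functional (set Ks) W \<and> V Ks = W Ks" using V by blast
    fix r assume "\<exists>W. mixed_volume_functional (set Ks) W \<and> r = W Ks"
    then obtain W where W: "mixed_volume_functional (set Ks) W" "r = W Ks" by blast
    have "real (card ?P) * W Ks = real (card ?P) * V Ks"
      using mixed_volume_functional_polarization[OF W(1) order_refl assms(3)]
        mixed_volume_functional_polarization[OF V order_refl assms(3)] by simp
    then show "r = V Ks" using W(2) \<open>card ?P \<noteq> 0\<close> by simp
  qed
qed

definition orth_proj :: "'a::euclidean_space set \<Rightarrow> 'a \<Rightarrow> 'a" where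
  "orth_proj L x = (THE y. y \<in> L \<and> x - y \<in> orthogonal_comp L)"

text \<open>
  Lebesgue measure of a linear subspace \<open>L\<close>, as a Borel measure on the ambient space: the
  construction of \<^const>\<open>lborel\<close> with an orthonormal basis of \<open>L\<close> in place of \<^const>\<open>Basis\<close>. By
  rotation invariance it does not depend on the basis chosen.
\<close>

definition lborel_subspace :: "'a::euclidean_space set \<Rightarrow> 'a measure" where
  "lborel_subspace L =
    (let B = (SOME B. pairwise orthogonal B \<and> (\<forall>b\<in>B. norm b = 1) \<and> span B = L)
     in distr (\<Pi>\<^sub>M b\<in>B. lborel) borel (\<lambda>f. \<Sum>b\<in>B. f b *\<^sub>R b))"

definition proj_volume :: "'a::euclidean_space set \<Rightarrow> 'a set \<Rightarrow> real" where
  "proj_volume L A = measure (lborel_subspace L) (orth_proj L ` A)"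

text \<open>
  \<open>k\<close>-dimensional Hausdorff measure for \<open>k \<ge> 1\<close> (for \<open>k = 0\<close> the convention \<open>0 ^ 0 = 1\<close> spoils
  it), normalized so as to agree with Lebesgue measure on \<open>k\<close>-dimensional subspaces.
  Boundedness is imposed because \<^const>\<open>diameter\<close> is unspecified on unbounded sets.
\<close>

definition hausdorff_measure :: "nat \<Rightarrow> 'a::euclidean_space set \<Rightarrow> ennreal" where
  "hausdorff_measure k S =
    (SUP \<delta>\<in>{0<..}. INF C\<in>{C :: nat \<Rightarrow> 'a set.
        S \<subseteq> (\<Union>i. C i) \<and> (\<forall>i. bounded (C i) \<and> diameter (C i) \<le> \<delta>)}.
      \<Sum>i. ennreal (unit_ball_vol (real k) * (diameter (C i) / 2) ^ k))"

definition surface_area :: "'a::euclidean_space set \<Rightarrow> real" where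
  "surface_area A = enn2real (hausdorff_measure (DIM('a) - 1) (frontier A))"

end

theory Submission
  imports Defs
begin

text \<open>
  Let \<open>f\<close> be the volume of a zonotope \<open>A\<close>, let \<open>f\<^sub>u\<close>, \<open>f\<^sub>v\<close> be the volumes of its projections along
  orthonormal vectors \<open>u\<close>, \<open>v\<close>, and \<open>f\<^sub>u\<^sub>v\<close> that of its projection along their span. If the
  other zonoids are \<open>[0,u]\<close> or \<open>[0,v]\<close>, the first three inequalities all reduce to
  \<open>f f\<^sub>u\<^sub>v \<le> f\<^sub>u f\<^sub>v\<close>, a negative correlation property of the matroid of generators that
  holds for unimodular generators but fails in general: in \<open>\<real>\<^sup>4\<close> take the unit cube plus the
  segments to \<open>(1,0,1,-1)\<close>, \<open>(1,0,-1,1)\<close>, \<open>(1,-1,1,1)\<close>, \<open>(1,1,-1,-1)\<close>, and the first two coordinate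
  vectors for \<open>u\<close>, \<open>v\<close>; then \<open>85 \<cdot> 17 > 27 \<cdot> 53\<close>. Higher dimensions follow by taking the product
  with a cube. For the surface area, \<open>A\<close> is flattened along \<open>u\<close>, so that its boundary approaches
  twice its shadow along \<open>u\<close> and the fourth inequality approaches the third one. Only ratios of
  surface areas matter, so it suffices that Hausdorff measure on a hyperplane is some
  constant multiple of Lebesgue measure, which avoids the isodiametric inequality.
\<close>

section \<open>Linear images of Lebesgue measure\<close>

text \<open>Volumes of projections are represented as \<open>d\<close>-dimensional volumes of
  cylinders: project, then add unit segments in the lost directions. One formula, |K + [0,u]| = f +
  f_u for the volume f of K, then does the work. Applied twice it gives V(A[d-1],[0,u]) = f_u / d
  and V(A[d-2],[0,u],[0,v]) = f_uv / (d (d-1)), so that the factor d/(d-1) of the first inequality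
  cancels exactly. It also gives |A + [0,v]| = f + f_v with shadow f_u + f_uv along u, and (f + f_v)
  / (f_u + f_uv) >= f / f_u becomes f f_uv <= f_u f_v after cross-multiplication. Flattening along u
  multiplies the volumes of A and A + [0,v] by the same factor and fixes v and both shadows. For the
  fourth inequality two one-sided estimates suffice: the boundary of a convex body always measures
  at least twice its shadow, which serves for A + [0,v], and the boundary of a sufficiently
  flattened A measures at most slightly more than twice its shadow. Mixed volumes are given by a
  definite description, so their values are found by exhibiting one functional on the three bodies
  involved.\<close>

abbreviation (input) "vol \<equiv> measure lebesgue"

text \<open>
  The change of variables formula of the library for linear maps is restricted to well-ordered
  index types. An arbitrary finite index type is replaced by a copy with an arbitrary order.
\<close>

typedef 'n ordered_copy = "UNIV :: 'n set" ..

instantiation ordered_copy :: (finite) "{finite, wellorder}"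
begin

definition rank_ordered_copy :: "'a ordered_copy \<Rightarrow> nat" where
  "rank_ordered_copy = (SOME f. inj f)"

definition less_eq_ordered_copy :: "'a ordered_copy \<Rightarrow> 'a ordered_copy \<Rightarrow> bool" where
  "x \<le> y \<longleftrightarrow> rank_ordered_copy x \<le> rank_ordered_copy y"

definition less_ordered_copy :: "'a ordered_copy \<Rightarrow> 'a ordered_copy \<Rightarrow> bool" where
  "x < y \<longleftrightarrow> rank_ordered_copy x < rank_ordered_copy y"

instance
proof
  have fin: "finite (UNIV :: 'a ordered_copy set)"
    unfolding type_definition.univ[OF type_definition_ordered_copy] by simp
  then show "finite (UNIV :: 'a ordered_copy set)" .
  have "\<exists>f :: 'a ordered_copy \<Rightarrow> nat. inj f"
    using finite_imp_inj_to_nat_seg[OF fin] by blast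
  then have inj: "inj (rank_ordered_copy :: 'a ordered_copy \<Rightarrow> nat)"
    unfolding rank_ordered_copy_def by (rule someI_ex)
  fix x y z :: "'a ordered_copy"
  show "x \<le> y \<Longrightarrow> y \<le> x \<Longrightarrow> x = y"
    using inj by (auto simp: less_eq_ordered_copy_def inj_def)
  fix P :: "'a ordered_copy \<Rightarrow> bool" and a
  assume IH: "\<And>x. (\<And>y. y < x \<Longrightarrow> P y) \<Longrightarrow> P x"
  show "P a"
    by (induction a rule: measure_induct_rule[of rank_ordered_copy])
      (use IH in \<open>auto simp: less_ordered_copy_def\<close>)
qed (auto simp: less_eq_ordered_copy_def less_ordered_copy_def)

end

section \<open>Transport of volumes to the ordered index type\<close>

definition to_copy :: "real^'n \<Rightarrow> real^'n ordered_copy" where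
  "to_copy x = (\<chi> i. x $ Rep_ordered_copy i)"

definition from_copy :: "real^'n ordered_copy \<Rightarrow> real^'n" where
  "from_copy x = (\<chi> i. x $ Abs_ordered_copy i)"

lemma from_to_copy [simp]: "from_copy (to_copy x) = x"
  by (simp add: from_copy_def to_copy_def Abs_ordered_copy_inverse)

lemma to_from_copy [simp]: "to_copy (from_copy x) = x"
  by (simp add: from_copy_def to_copy_def Rep_ordered_copy_inverse)

lemma linear_to_copy: "linear (to_copy :: real^'n \<Rightarrow> _)"
  by (auto intro!: linearI simp: to_copy_def vec_eq_iff)

lemma linear_from_copy: "linear (from_copy :: _ \<Rightarrow> real^'n)"
  by (auto intro!: linearI simp: from_copy_def vec_eq_iff)

lemma bij_Rep_ordered_copy: "bij Rep_ordered_copy"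
  by (metis Abs_ordered_copy_inverse Rep_ordered_copy_inject UNIV_I bijI injI surj_def)

lemma prod_Rep_ordered_copy: "(\<Prod>i\<in>UNIV. f (Rep_ordered_copy i)) = (\<Prod>i\<in>UNIV. f i)"
  by (intro prod.reindex_bij_betw bij_Rep_ordered_copy)

lemma sum_Rep_ordered_copy: "(\<Sum>i\<in>UNIV. f (Rep_ordered_copy i)) = (\<Sum>i\<in>UNIV. f i)"
  by (intro sum.reindex_bij_betw bij_Rep_ordered_copy)

lemma inner_to_copy: "to_copy x \<bullet> to_copy y = (x::real^'n) \<bullet> y"
  by (simp add: inner_vec_def to_copy_def sum_Rep_ordered_copy[of "\<lambda>i. x$i * y$i"])

lemma inner_from_copy: "from_copy x \<bullet> from_copy y = x \<bullet> y"
  by (metis inner_to_copy to_from_copy)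

lemma borel_measurable_linear: "linear f \<Longrightarrow> f \<in> borel_measurable borel"
  for f :: "'a::euclidean_space \<Rightarrow> 'b::euclidean_space"
  by (intro borel_measurable_continuous_onI linear_continuous_on linear_conv_bounded_linear[THEN iffD1])

text \<open>Renaming coordinates carries boxes to boxes with the same side lengths, and Lebesgue
  measure is determined by its values on boxes.\<close>

lemma lborel_distr_to_copy: "lborel = distr lborel borel (to_copy :: real^'n \<Rightarrow> _)"
proof (rule lborel_eqI)
  fix l u :: "real^'n ordered_copy"
  assume le: "\<And>b. b \<in> Basis \<Longrightarrow> l \<bullet> b \<le> u \<bullet> b"
  have "l $ i \<le> u $ i" for i
    using le[of "axis i 1"] by (simp add: inner_axis)
  moreover have "to_copy -` box l u = box (from_copy l) (from_copy u)"
  proof -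
    have "x \<in> box (from_copy l) (from_copy u) \<longleftrightarrow> to_copy x \<in> box l u" for x
    proof
      assume a: "x \<in> box (from_copy l) (from_copy u)"
      show "to_copy x \<in> box l u"
        unfolding mem_box_cart
      proof
        fix i :: "'n ordered_copy"
        show "l $ i < to_copy x $ i \<and> to_copy x $ i < u $ i"
          using a[unfolded mem_box_cart, rule_format, of "Rep_ordered_copy i"]
          by (simp add: to_copy_def from_copy_def Rep_ordered_copy_inverse)
      qed
    next
      assume a: "to_copy x \<in> box l u"
      show "x \<in> box (from_copy l) (from_copy u)"
        unfolding mem_box_cart
      proof
        fix i :: 'n
        show "from_copy l $ i < x $ i \<and> x $ i < from_copy u $ i"
          using a[unfolded mem_box_cart, rule_format, of "Abs_ordered_copy i"]
          by (simp add: to_copy_def from_copy_def Abs_ordered_copy_inverse)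
      qed
    qed
    then show ?thesis by auto
  qed
  moreover have "(\<Prod>b\<in>Basis. (u - l) \<bullet> b) = (\<Prod>i\<in>UNIV. u $ i - l $ i)"
    by (simp add: Basis_vec_def inner_axis UNION_singleton_eq_range prod.reindex inj_on_def axis_eq_axis)
  moreover have "(\<Prod>b\<in>Basis. (from_copy u - from_copy l) \<bullet> b) = (\<Prod>i\<in>UNIV. from_copy u $ i - from_copy l $ i)"
    by (simp add: Basis_vec_def inner_axis UNION_singleton_eq_range prod.reindex inj_on_def axis_eq_axis)
  moreover have "(\<Prod>i\<in>UNIV. from_copy u $ i - from_copy l $ i) = (\<Prod>i\<in>UNIV. u $ i - l $ i)"
    using prod_Rep_ordered_copy[of "\<lambda>i. from_copy u $ i - from_copy l $ i"]
    by (simp add: from_copy_def Rep_ordered_copy_inverse)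
  moreover have "from_copy l \<bullet> b \<le> from_copy u \<bullet> b" if "b \<in> Basis" for b
    using that \<open>\<And>i. l $ i \<le> u $ i\<close>
    by (auto simp: Basis_vec_def inner_axis from_copy_def)
  ultimately show "emeasure (distr lborel borel to_copy) (box l u) = (\<Prod>b\<in>Basis. (u - l) \<bullet> b)"
    by (simp add: emeasure_distr borel_measurable_linear linear_to_copy emeasure_lborel_box)
qed simp

lemma borel_image_to_copy:
  fixes S :: "(real^'n) set"
  assumes "S \<in> sets borel"
  shows "to_copy ` S \<in> sets borel"
proof -
  have "to_copy ` S = from_copy -` S"
    by (auto simp: image_iff) (metis to_from_copy)
  then show ?thesis
    using measurable_sets[OF borel_measurable_linear[OF linear_from_copy] assms] by simp
qed

lemma measure_to_copy:
  fixes S :: "(real^'n) set"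
  assumes "S \<in> sets borel"
  shows "vol (to_copy ` S) = vol S"
proof -
  have "emeasure lborel (to_copy ` S) = emeasure (distr lborel borel to_copy) (to_copy ` S)"
    using lborel_distr_to_copy by metis
  also have "\<dots> = emeasure lborel (to_copy -` to_copy ` S)"
    using borel_image_to_copy[OF assms]
    by (simp add: emeasure_distr borel_measurable_linear linear_to_copy)
  also have "to_copy -` to_copy ` S = S"
    by (metis from_to_copy inj_on_def inj_vimage_image_eq)
  finally have "emeasure lborel (to_copy ` S) = emeasure lborel S" .
  then show ?thesis
    using assms borel_image_to_copy[OF assms] by (simp add: measure_def)
qed

text \<open>The determinant stays on the copied index type, where both uses evaluate it: conjugating
  an orthogonal map keeps it orthogonal, and conjugating the replacement of one axis vector replaces
  one column.\<close>

lemma measure_linear_image_copy: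
  fixes f :: "real^'n \<Rightarrow> real^'n"
  assumes "linear f" and S: "bounded S" "S \<in> sets borel" and fS: "f ` S \<in> sets borel"
  shows "vol (f ` S) =
    \<bar>det (matrix (to_copy \<circ> f \<circ> from_copy))\<bar> * vol S"
proof -
  have lin: "linear (to_copy \<circ> f \<circ> from_copy)"
    using assms(1) linear_to_copy linear_from_copy by (intro linear_compose) auto
  have bd: "bounded (to_copy ` S)"
    using S(1) linear_to_copy bounded_linear_image linear_conv_bounded_linear by blast
  have "vol (f ` S) = vol (to_copy ` f ` S)"
    using measure_to_copy[OF fS] by simp
  also have "to_copy ` f ` S = (to_copy \<circ> f \<circ> from_copy) ` to_copy ` S"
    by (simp add: image_comp comp_def)
  also have "vol \<dots> =
      \<bar>det (matrix (to_copy \<circ> f \<circ> from_copy))\<bar> * vol (to_copy ` S)"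
    using lin bd borel_image_to_copy[OF S(2)]
    by (intro measure_linear_image bounded_set_imp_lmeasurable) auto
  finally show ?thesis using measure_to_copy[OF S(2)] by simp
qed

lemma measure_orthogonal_image_borel:
  fixes f :: "real^'n \<Rightarrow> real^'n"
  assumes f: "orthogonal_transformation f" and S: "bounded S" "S \<in> sets borel" "f ` S \<in> sets borel"
  shows "vol (f ` S) = vol S"
proof -
  have "orthogonal_transformation (to_copy \<circ> f \<circ> from_copy)"
    using f linear_to_copy linear_from_copy
    by (auto simp: orthogonal_transformation_def inner_to_copy inner_from_copy intro!: linear_compose)
  then have "\<bar>det (matrix (to_copy \<circ> f \<circ> from_copy))\<bar> = 1"
    by (metis orthogonal_transformation_det)
  then show ?thesis
    using measure_linear_image_copy[OF orthogonal_transformation_linear[OF f] S] by simp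
qed

text \<open>The map sends the \<open>k\<close>-th axis vector to \<open>w\<close> and fixes the
  other ones, so its determinant is \<open>w $ k\<close>.\<close>

lemma measure_replace_axis_image:
  fixes w :: "real^'n"
  assumes S: "compact S"
  shows "vol ((\<lambda>x. x + x $ k *\<^sub>R (w - axis k 1)) ` S) = \<bar>w $ k\<bar> * vol S"
proof -
  let ?f = "\<lambda>x. x + x $ k *\<^sub>R (w - axis k 1)"
  let ?k = "Abs_ordered_copy k"
  have lin: "linear ?f"
    by (rule linearI) (auto simp: algebra_simps)
  have "continuous_on S ?f"
    using lin linear_continuous_on linear_conv_bounded_linear by blast
  then have c: "compact (?f ` S)" using S by (rule compact_continuous_image)
  have fa: "from_copy (axis j 1) = (axis (Rep_ordered_copy j) 1 :: real^'n)" for j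
    by (auto simp: from_copy_def axis_def vec_eq_iff Rep_ordered_copy_inverse Abs_ordered_copy_inverse)
  have ta: "to_copy (axis (Rep_ordered_copy j) 1 :: real^'n) = axis j 1" for j
    by (auto simp: to_copy_def axis_def vec_eq_iff Rep_ordered_copy_inject)
  \<comment> \<open>The new column is written as \<open>mat 1 *v to_copy w\<close> to fit
    \<open>cramer_lemma\<close> with the identity as coefficient matrix; the determinant is then
    coordinate \<open>?k\<close> of \<open>to_copy w\<close>.\<close>
  have "matrix (to_copy \<circ> ?f \<circ> from_copy) =
      (\<chi> i j. if j = ?k then (mat 1 *v to_copy w) $ i else mat 1 $ i $ j)"
  proof -
    have "matrix (to_copy \<circ> ?f \<circ> from_copy) $ i $ j =
        (if j = ?k then to_copy w $ i else mat 1 $ i $ j)" for i j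
    proof (cases "j = ?k")
      case True
      then have "Rep_ordered_copy j = k" by (simp add: Abs_ordered_copy_inverse)
      with True show ?thesis by (simp add: matrix_def fa)
    next
      case False
      then have "Rep_ordered_copy j \<noteq> k" by (metis Rep_ordered_copy_inverse)
      then have "axis (Rep_ordered_copy j) (1::real) $ k = 0" by (simp add: axis_def)
      with False show ?thesis
        by (simp add: matrix_def fa ta) (simp add: axis_def mat_def)
    qed
    then show ?thesis by (simp add: vec_eq_iff)
  qed
  then have "det (matrix (to_copy \<circ> ?f \<circ> from_copy)) = to_copy w $ ?k"
    by (simp add: cramer_lemma)
  also have "\<dots> = w $ k"
    by (simp add: to_copy_def Abs_ordered_copy_inverse)
  finally show ?thesis
    using measure_linear_image_copy[OF lin, of S] S c
    by (simp add: compact_imp_bounded borel_compact)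
qed

section \<open>Minkowski sums with a segment\<close>

abbreviation (input) "seg \<equiv> closed_segment 0"

lemma compact_set_plus:
  fixes S T :: "'a::real_normed_vector set"
  assumes "compact S" "compact T" shows "compact (S + T)"
proof -
  have "S + T = {x + y | x y. x \<in> S \<and> y \<in> T}" by (auto simp: set_plus_def)
  then show ?thesis using compact_sums[OF assms] by simp
qed

lemma linear_image_set_plus: "linear f \<Longrightarrow> f ` (S + T) = f ` S + f ` T"
  by (force simp: set_plus_def linear_add image_iff)

lemma linear_image_set_sum:
  assumes "linear f" shows "f ` (\<Sum>i\<in>I. S i) = (\<Sum>i\<in>I. f ` S i)"
proof (cases "finite I")
  case True
  then show ?thesis
    by induction (simp_all add: linear_image_set_plus assms linear_0)
qed (simp add: assms linear_0)

lemma linear_image_set_sum_list: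
  assumes "linear f" shows "f ` (\<Sum>x\<leftarrow>xs. S x) = (\<Sum>x\<leftarrow>xs. f ` S x)"
  by (induction xs) (simp_all add: linear_image_set_plus assms linear_0)

lemma compact_set_sum:
  fixes S :: "'i \<Rightarrow> 'a::real_normed_vector set"
  shows "(\<And>i. i \<in> I \<Longrightarrow> compact (S i)) \<Longrightarrow> compact (\<Sum>i\<in>I. S i)"
  by (induction I rule: infinite_finite_induct) (auto intro!: compact_set_plus)

lemma convex_set_sum:
  fixes S :: "'i \<Rightarrow> 'a::real_vector set"
  shows "(\<And>i. i \<in> I \<Longrightarrow> convex (S i)) \<Longrightarrow> convex (\<Sum>i\<in>I. S i)"
  by (induction I rule: infinite_finite_induct) (auto intro!: convex_set_plus)

lemma
  fixes ws :: "'a::euclidean_space list"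
  shows compact_sum_list_segments: "compact (\<Sum>w\<leftarrow>ws. seg w)"
    and convex_sum_list_segments: "convex (\<Sum>w\<leftarrow>ws. seg w)"
    and zero_in_sum_list_segments: "0 \<in> (\<Sum>w\<leftarrow>ws. seg w)"
proof (induction ws)
  case (Cons w ws)
  { case 1 with Cons show ?case by (simp add: compact_set_plus) }
  { case 2 with Cons show ?case by (simp add: convex_set_plus) }
  { case 3 with Cons show ?case using set_plus_intro[of 0 "seg w" 0] by fastforce }
qed auto

lemma linear_image_segment: "linear f \<Longrightarrow> f ` seg x = seg (f x)"
  using closed_segment_linear_image[of f 0 x] by (simp add: linear_0)

lemma scaleR_in_closed_segment_0:
  assumes "0 \<le> r" "r \<le> t" shows "r *\<^sub>R e \<in> seg (t *\<^sub>R e)"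
proof (cases "t = 0")
  case False
  then show ?thesis using assms
    by (auto simp: in_segment intro!: exI[of _ "r / t"])
qed (use assms in auto)

lemma closed_segment_0_scaleR_iff:
  assumes "0 \<le> t"
  shows "x \<in> seg (t *\<^sub>R e) \<longleftrightarrow> (\<exists>r. 0 \<le> r \<and> r \<le> t \<and> x = r *\<^sub>R e)"
proof
  assume "x \<in> seg (t *\<^sub>R e)"
  then obtain u where "0 \<le> u" "u \<le> 1" "x = (u * t) *\<^sub>R e"
    by (auto simp: in_segment)
  then show "\<exists>r. 0 \<le> r \<and> r \<le> t \<and> x = r *\<^sub>R e"
    using assms mult_left_le_one_le[of t u] by (intro exI[of _ "u * t"]) simp
next
  assume "\<exists>r. 0 \<le> r \<and> r \<le> t \<and> x = r *\<^sub>R e"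
  then obtain r where "0 \<le> r" "r \<le> t" "x = r *\<^sub>R e" by auto
  then show "x \<in> seg (t *\<^sub>R e)"
    by (simp add: scaleR_in_closed_segment_0)
qed

lemma set_plus_segment_iff:
  assumes "0 \<le> t"
  shows "x \<in> K + seg (t *\<^sub>R e) \<longleftrightarrow> (\<exists>r. 0 \<le> r \<and> r \<le> t \<and> x - r *\<^sub>R e \<in> K)"
proof -
  have "x \<in> K + seg (t *\<^sub>R e) \<longleftrightarrow>
      (\<exists>p\<in>K. \<exists>r. 0 \<le> r \<and> r \<le> t \<and> x = p + r *\<^sub>R e)"
    unfolding set_plus_def by (simp add: closed_segment_0_scaleR_iff[OF assms] Bex_def) metis
  also have "\<dots> \<longleftrightarrow> (\<exists>r. 0 \<le> r \<and> r \<le> t \<and> x - r *\<^sub>R e \<in> K)"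
  proof
    assume "\<exists>r. 0 \<le> r \<and> r \<le> t \<and> x - r *\<^sub>R e \<in> K"
    then obtain r where "0 \<le> r" "r \<le> t" "x - r *\<^sub>R e \<in> K" by auto
    then show "\<exists>p\<in>K. \<exists>r. 0 \<le> r \<and> r \<le> t \<and> x = p + r *\<^sub>R e"
      by (intro bexI[of _ "x - r *\<^sub>R e"] exI[of _ r]) auto
  qed auto
  finally show ?thesis .
qed

text \<open>By convexity a line in direction \<open>e\<close> meets \<open>K\<close> in an interval.
  Lengthening the segment therefore only adds a layer at the far end, and this layer is a translate
  of the one that \<open>t *\<^sub>R e\<close> adds to \<open>K\<close> itself.\<close>

lemma set_plus_increment:
  fixes e :: "'a::real_vector"
  assumes K: "convex K" and s: "0 \<le> s" and t: "0 \<le> t"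
  defines "L \<equiv> \<lambda>t. K + seg (t *\<^sub>R e)"
  shows "L (s + t) - L s = (+) (s *\<^sub>R e) ` (L t - K)"
proof (rule set_eqI)
  fix x
  have L: "x \<in> L t \<longleftrightarrow> (\<exists>r. 0 \<le> r \<and> r \<le> t \<and> x - r *\<^sub>R e \<in> K)" if "0 \<le> t" for x t
    unfolding L_def by (rule set_plus_segment_iff[OF that])
  have "x \<in> L (s + t) - L s \<longleftrightarrow> x - s *\<^sub>R e \<in> L t - K"
  proof
    assume "x \<in> L (s + t) - L s"
    then obtain r where r: "0 \<le> r" "r \<le> s + t" "x - r *\<^sub>R e \<in> K" and n: "x \<notin> L s"
      using L[of "s + t"] s t by auto
    from n have "r > s" using r L[of s x] s by (meson not_le)
    then have "x - s *\<^sub>R e \<in> L t"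
      using r t by (subst L) (auto intro!: exI[of _ "r - s"] simp: algebra_simps)
    moreover have "x - s *\<^sub>R e \<notin> K" using n L[of s x] s by auto
    ultimately show "x - s *\<^sub>R e \<in> L t - K" by simp
  next
    assume *: "x - s *\<^sub>R e \<in> L t - K"
    then obtain r where r: "0 \<le> r" "r \<le> t" "x - s *\<^sub>R e - r *\<^sub>R e \<in> K"
      using L[of t] t by auto
    then have "x \<in> L (s + t)"
      using s t by (subst L) (auto intro!: exI[of _ "s + r"] simp: algebra_simps)
    moreover have "x \<notin> L s"
    proof
      assume "x \<in> L s"
      then obtain q where q: "0 \<le> q" "q \<le> s" "x - q *\<^sub>R e \<in> K"
        using L[of s] s by auto
      have "x - s *\<^sub>R e \<in> K"
      proof (cases "q = s + r")
        case True
        then show ?thesis using q r by auto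
      next
        case False
        \<comment> \<open>Weights chosen so that the points of \<open>K\<close> reached by going
          back \<open>s + r\<close> and \<open>q\<close> from \<open>x\<close> combine to the one
          reached by going back \<open>s\<close>.\<close>
        define u where "u = (s - q) / (s + r - q)"
        have d: "s + r - q > 0" using False q r by linarith
        have u: "0 \<le> u" "u \<le> 1" using d q r by (auto simp: u_def divide_simps)
        have "u * (s + r) + (1 - u) * q = u * (s + r - q) + q" by (simp add: algebra_simps)
        also have "\<dots> = s" using d by (simp add: u_def)
        finally have eq: "u * (s + r) + (1 - u) * q = s" .
        have "u *\<^sub>R (x - s *\<^sub>R e - r *\<^sub>R e) + (1 - u) *\<^sub>R (x - q *\<^sub>R e) \<in> K"
          using convexD_alt[OF K q(3) r(3) u] by (simp add: add.commute)
        also have "u *\<^sub>R (x - s *\<^sub>R e - r *\<^sub>R e) + (1 - u) *\<^sub>R (x - q *\<^sub>R e) =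
            x - (u * (s + r) + (1 - u) * q) *\<^sub>R e"
          by (simp add: algebra_simps)
        finally show ?thesis using eq by simp
      qed
      with * show False by simp
    qed
    ultimately show "x \<in> L (s + t) - L s" by simp
  qed
  also have "\<dots> \<longleftrightarrow> x \<in> (+) (s *\<^sub>R e) ` (L t - K)"
    by (metis (no_types, lifting) add_diff_cancel_left' diff_add_cancel image_iff add.commute)
  finally show "x \<in> L (s + t) - L s \<longleftrightarrow> x \<in> (+) (s *\<^sub>R e) ` (L t - K)" .
qed

text \<open>The image stays in the ambient space; its lower-dimensional volume is measured after
  adding the unit segment on axis \<open>k\<close>.\<close>

definition drop_coord :: "'n \<Rightarrow> real^'n \<Rightarrow> real^'n" where
  "drop_coord k x = (\<chi> i. if i = k then 0 else x $ i)"

definition scale_coord :: "'n \<Rightarrow> real \<Rightarrow> real^'n \<Rightarrow> real^'n" where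
  "scale_coord k t x = (\<chi> i. if i = k then t * x $ i else x $ i)"

lemma drop_coord_nth [simp]: "drop_coord k x $ i = (if i = k then 0 else x $ i)"
  by (simp add: drop_coord_def)

lemma scale_coord_nth [simp]: "scale_coord k t x $ i = (if i = k then t * x $ i else x $ i)"
  by (simp add: scale_coord_def)

lemma linear_drop_coord: "linear (drop_coord k)"
  by (rule linearI) (simp_all add: vec_eq_iff)

lemma linear_scale_coord: "linear (scale_coord k t)"
  by (rule linearI) (simp_all add: vec_eq_iff algebra_simps)

lemma drop_coord_eq: "drop_coord k x = x - x $ k *\<^sub>R axis k 1"
  by (simp add: vec_eq_iff axis_def)

lemma drop_coord_idem [simp]: "drop_coord k (drop_coord k x) = drop_coord k x"
  by (simp add: vec_eq_iff)

lemma compact_linear_image: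
  fixes f :: "'a::euclidean_space \<Rightarrow> 'b::euclidean_space"
  shows "linear f \<Longrightarrow> compact S \<Longrightarrow> compact (f ` S)"
  by (meson compact_continuous_image linear_continuous_on linear_conv_bounded_linear)

lemma measure_scale_coord:
  fixes S :: "(real^'n) set"
  assumes "S \<in> lmeasurable"
  shows "vol (scale_coord k t ` S) = \<bar>t\<bar> * vol S"
proof -
  have "scale_coord k t = (\<lambda>x. \<chi> i. (if i = k then t else 1) * x $ i)"
    by (auto simp: fun_eq_iff vec_eq_iff)
  then show ?thesis
    using measure_stretch[OF assms, of "\<lambda>i. if i = k then t else 1"] by simp
qed

lemma measure_scaleR:
  fixes S :: "(real^'n) set"
  assumes "S \<in> lmeasurable"
  shows "vol ((*\<^sub>R) t ` S) = \<bar>t\<bar> ^ CARD('n) * vol S"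
proof -
  have "(*\<^sub>R) t = (\<lambda>x::real^'n. \<chi> i. t * x $ i)"
    by (auto simp: fun_eq_iff vec_eq_iff)
  then show ?thesis
    using measure_stretch[OF assms, of "\<lambda>i. t"] by (simp add: power_abs)
qed

text \<open>Scaling coordinate \<open>k\<close> by \<open>t\<close> fixes the flat set
  \<open>P\<close> and stretches the unit segment to length \<open>t\<close>.\<close>

lemma measure_cylinder:
  fixes P :: "(real^'n) set"
  assumes P: "compact P" "\<And>x. x \<in> P \<Longrightarrow> x $ k = 0" and t: "0 \<le> t"
  shows "vol (P + seg (t *\<^sub>R axis k 1)) =
    t * vol (P + seg (axis k 1))"
proof -
  have id: "scale_coord k t ` P = P"
  proof -
    have "scale_coord k t x = x" if "x \<in> P" for x
      using P(2)[OF that] by (auto simp: vec_eq_iff)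
    then show ?thesis by simp
  qed
  have "scale_coord k t (axis k 1) = t *\<^sub>R axis k 1"
    by (simp add: vec_eq_iff axis_def)
  then have "scale_coord k t ` seg (axis k 1) = seg (t *\<^sub>R axis k 1)"
    by (simp add: linear_image_segment linear_scale_coord)
  then have "scale_coord k t ` (P + seg (axis k 1)) = P + seg (t *\<^sub>R axis k 1)"
    by (simp add: linear_image_set_plus linear_scale_coord id)
  then show ?thesis
    using measure_scale_coord[of "P + seg (axis k 1)" k t] t P
    by (simp add: lmeasurable_compact compact_set_plus)
qed

text \<open>
  The volume \<open>g t\<close> of \<open>K + t [0,e]\<close> satisfies \<open>g (s + t) - g s = g t - g 0\<close>, so \<open>g n\<close> grows
  linearly in \<open>n\<close>. Its slope is found by flattening along \<open>e\<close>: as \<open>n \<rightarrow> \<infinity>\<close>, the body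
  \<open>K + n [0,e]\<close> scaled by \<open>1/n\<close> along \<open>e\<close> approaches the cylinder over the shadow of \<open>K\<close>.
\<close>

theorem measure_plus_axis_segment:
  fixes K :: "(real^'n) set" and k :: 'n
  assumes K: "compact K" "convex K"
  defines "e \<equiv> axis k 1 :: real^'n"
  shows "vol (K + seg e) =
    vol K + vol (drop_coord k ` K + seg e)"
proof (cases "K = {}")
  case False
  define L where "L t = K + seg (t *\<^sub>R e)" for t
  define g where "g t = vol (L t)" for t
  define P where "P = drop_coord k ` K"
  define V where "V = vol (P + seg e)"
  have [simp]: "e $ k = 1" "drop_coord k e = 0" by (simp_all add: e_def vec_eq_iff axis_def)
  have L0: "L 0 = K" by (simp add: L_def)
  have cL: "compact (L t)" for t unfolding L_def using K by (simp add: compact_set_plus)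
  have mono: "L s \<subseteq> L t" if "0 \<le> s" "s \<le> t" for s t
    unfolding L_def using that by (force simp: set_plus_segment_iff subset_iff)
  have inc: "g (s + t) - g s = g t - g 0" if "0 \<le> s" "0 \<le> t" for s t
  proof -
    have "g (s + t) - g s = vol (L (s + t) - L s)"
      unfolding g_def using cL mono[of s "s + t"] that
      by (subst measurable_measure_Diff) (auto intro: lmeasurable_compact fmeasurableD)
    also have "\<dots> = vol (L t - K)"
      using set_plus_increment[OF K(2) that, of e, folded L_def] by (simp add: measure_translation)
    also have "\<dots> = g t - g 0"
      unfolding g_def L0[symmetric] using cL mono[of 0 t] that
      by (subst measurable_measure_Diff) (auto intro: lmeasurable_compact fmeasurableD)
    finally show ?thesis .
  qed
  have gn: "g (real n) = g 0 + n * (g 1 - g 0)" for n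
  proof (induction n)
    case (Suc n)
    then show ?case using inc[of "real n" 1] by (simp add: algebra_simps)
  qed simp
  have cP: "compact P" unfolding P_def using K by (simp add: compact_linear_image linear_drop_coord)
  have P0: "x $ k = 0" if "x \<in> P" for x using that by (auto simp: P_def)
  have cyl: "vol (P + seg (t *\<^sub>R e)) = t * V" if "0 \<le> t" for t
    unfolding V_def e_def by (rule measure_cylinder[OF cP P0 that])
  obtain h where h: "h > 0" "\<And>x. x \<in> K \<Longrightarrow> norm x \<le> h"
    using K(1) compact_imp_bounded bounded_pos by metis
  have hk: "\<bar>x $ k\<bar> \<le> h" if "x \<in> K" for x
    using h(2)[OF that] component_le_norm_cart[of x k] by linarith
  have bnd: "\<bar>g (real n) / n - V\<bar> \<le> 2 * h / n * V" if n: "real n \<ge> 2 * h" "n > 0" for n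
  proof -
    define F where "F = scale_coord k (1 / n) ` L n"
    have mF: "vol F = g n / n"
      unfolding F_def g_def using cL by (simp add: measure_scale_coord lmeasurable_compact)
    have cF: "compact F" unfolding F_def using cL by (simp add: compact_linear_image linear_scale_coord)
    have F: "x \<in> F \<longleftrightarrow> (\<exists>p\<in>K. \<exists>r. 0 \<le> r \<and> r \<le> 1 \<and> x = drop_coord k p + (p $ k / n + r) *\<^sub>R e)" for x
    proof
      assume "x \<in> F"
      then obtain y where y: "y \<in> L n" "x = scale_coord k (1 / n) y" unfolding F_def by blast
      then obtain r where r: "0 \<le> r" "r \<le> real n" "y - r *\<^sub>R e \<in> K"
        unfolding L_def by (auto simp: set_plus_segment_iff)
      have "x = drop_coord k (y - r *\<^sub>R e) + ((y - r *\<^sub>R e) $ k / n + r / n) *\<^sub>R e"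
        using y(2) n(2) by (auto simp: vec_eq_iff e_def axis_def field_simps)
      then show "\<exists>p\<in>K. \<exists>r. 0 \<le> r \<and> r \<le> 1 \<and> x = drop_coord k p + (p $ k / n + r) *\<^sub>R e"
        using r n(2) by (intro bexI[OF _ r(3)] exI[of _ "r / n"]) auto
    next
      assume "\<exists>p\<in>K. \<exists>r. 0 \<le> r \<and> r \<le> 1 \<and> x = drop_coord k p + (p $ k / n + r) *\<^sub>R e"
      then obtain p r where p: "p \<in> K" "0 \<le> r" "r \<le> 1" "x = drop_coord k p + (p $ k / n + r) *\<^sub>R e"
        by blast
      have "x = scale_coord k (1 / n) (p + (n * r) *\<^sub>R e)"
        using n(2) by (auto simp: p(4) vec_eq_iff e_def axis_def field_simps)
      moreover have "p + (n * r) *\<^sub>R e \<in> L n"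
        unfolding L_def using p n(2) by (auto intro!: scaleR_in_closed_segment_0 simp: mult_left_le)
      ultimately show "x \<in> F" unfolding F_def by blast
    qed
    \<comment> \<open>Points of \<open>F\<close> have height \<open>p $ k / n + r\<close> with first
      term between \<open>- h / n\<close> and \<open>h / n\<close>. So \<open>F\<close> fits into a
      cylinder of height \<open>1 + 2 * h / n\<close> starting at \<open>- h / n\<close>, and
      contains one of height \<open>1 - 2 * h / n\<close> starting at \<open>h / n\<close>.\<close>
    have "F \<subseteq> (+) (- (h / n) *\<^sub>R e) ` (P + seg ((1 + 2 * h / n) *\<^sub>R e))" (is "_ \<subseteq> ?U")
    proof
      fix x assume "x \<in> F"
      then obtain p r where p: "p \<in> K" "0 \<le> r" "r \<le> 1" "x = drop_coord k p + (p $ k / n + r) *\<^sub>R e"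
        using F by blast
      define q where "q = h / n + p $ k / n + r"
      have "\<bar>p $ k / n\<bar> \<le> h / n" using hk[OF p(1)] n by (simp add: divide_right_mono)
      then have q: "0 \<le> q" "q \<le> 1 + 2 * h / n"
        using p(2,3) unfolding q_def by linarith+
      have "x = - (h / n) *\<^sub>R e + (drop_coord k p + q *\<^sub>R e)"
        using p(4) by (simp add: q_def algebra_simps)
      moreover have "drop_coord k p + q *\<^sub>R e \<in> P + seg ((1 + 2 * h / n) *\<^sub>R e)"
        using p(1) q unfolding P_def by (auto intro!: scaleR_in_closed_segment_0)
      ultimately show "x \<in> ?U" by blast
    qed
    then have "vol F \<le> vol ?U"
      by (intro measure_mono_fmeasurable fmeasurableD lmeasurable_compact compact_translation
          compact_set_plus cF cP compact_segment)
    also have "\<dots> = (1 + 2 * h / n) * V"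
      using cyl[of "1 + 2 * h / n"] h(1) by (subst measure_translation) simp
    finally have up: "g n / n \<le> (1 + 2 * h / n) * V" using mF by simp
    have "(+) ((h / n) *\<^sub>R e) ` (P + seg ((1 - 2 * h / n) *\<^sub>R e)) \<subseteq> F" (is "?U \<subseteq> _")
    proof
      fix x assume "x \<in> ?U"
      moreover have "0 \<le> 1 - 2 * h / n" using n by simp
      ultimately obtain p r where p: "p \<in> K" "0 \<le> r" "r \<le> 1 - 2 * h / n"
        "x = (h / n) *\<^sub>R e + (drop_coord k p + r *\<^sub>R e)"
        unfolding P_def by (auto simp: set_plus_def closed_segment_0_scaleR_iff)
      have "\<bar>p $ k / n\<bar> \<le> h / n" using hk[OF p(1)] n by (simp add: divide_right_mono)
      then have "0 \<le> h / n + r - p $ k / n" "h / n + r - p $ k / n \<le> 1"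
        using p(2,3) by linarith+
      then show "x \<in> F"
        unfolding F using p(4) by (intro bexI[OF _ p(1)] exI[of _ "h / n + r - p $ k / n"])
          (auto simp: algebra_simps)
    qed
    then have "vol ?U \<le> vol F"
      by (intro measure_mono_fmeasurable fmeasurableD lmeasurable_compact compact_translation
          compact_set_plus cF cP compact_segment)
    moreover have "vol ?U = (1 - 2 * h / n) * V"
      using cyl[of "1 - 2 * h / n"] n by (simp add: measure_translation)
    ultimately have lo: "(1 - 2 * h / n) * V \<le> g n / n" using mF by simp
    show ?thesis using up lo by (simp add: algebra_simps abs_le_iff)
  qed
  have "(\<lambda>n. g (real n) / n - V) \<longlonglongrightarrow> 0"
  proof (rule Lim_null_comparison)
    show "\<forall>\<^sub>F n in sequentially. norm (g (real n) / n - V) \<le> 2 * h / n * V"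
      using eventually_ge_at_top[of "max 1 (nat \<lceil>2 * h\<rceil>)"]
      by eventually_elim (use bnd in \<open>auto simp: nat_le_iff ceiling_le_iff\<close>)
    show "(\<lambda>n. 2 * h / real n * V) \<longlonglongrightarrow> 0"
      using tendsto_mult_left_zero[OF lim_const_over_n[of "2 * h"]] by simp
  qed
  \<comment> \<open>The linear growth of \<open>g\<close> computes the same limit exactly, which
    forces the slope \<open>g 1 - g 0\<close> to be \<open>V\<close>.\<close>
  moreover have "(\<lambda>n. g (real n) / n - V) \<longlonglongrightarrow> 0 + (g 1 - g 0) - V"
  proof -
    have "(\<lambda>n. g 0 / real n + (g 1 - g 0) - V) \<longlonglongrightarrow> 0 + (g 1 - g 0) - V"
      by (intro tendsto_intros lim_const_over_n)
    moreover have "\<forall>\<^sub>F n in sequentially. g 0 / real n + (g 1 - g 0) - V = g (real n) / n - V"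
      using eventually_gt_at_top[of 0] by eventually_elim (simp add: gn field_simps)
    ultimately show ?thesis using tendsto_cong by fast
  qed
  ultimately have "0 + (g 1 - g 0) - V = 0" using LIMSEQ_unique by blast
  then show ?thesis by (simp add: g_def L_def V_def P_def)
qed simp

section \<open>Zonotopes containing the unit cube\<close>

text \<open>\<open>T\<close> sends the axis vector to \<open>w\<close> and \<open>R\<close> is its
  inverse, so pulling back along \<open>T\<close> reduces to an axis segment. Projecting the
  pulled-back body along axis \<open>k\<close> amounts to projecting \<open>K\<close> obliquely
  along \<open>w\<close> onto the coordinate hyperplane.\<close>

lemma measure_plus_segment:
  fixes K :: "(real^'n) set"
  assumes K: "compact K" "convex K" and w: "w $ k \<noteq> 0"
  shows "vol (K + seg w) = vol K +
    \<bar>w $ k\<bar> * vol ((\<lambda>x. x - (x $ k / w $ k) *\<^sub>R w) ` K + seg (axis k 1))"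
proof -
  define T where "T x = x + x $ k *\<^sub>R (w - axis k 1)" for x
  define R where "R x = x + (x $ k / w $ k) *\<^sub>R (axis k 1 - w)" for x
  have linT: "linear T" and linR: "linear R"
    unfolding T_def R_def by (rule linearI; simp add: algebra_simps add_divide_distrib)+
  have TR: "T (R x) = x" for x
    using w by (simp add: T_def R_def algebra_simps)
  have dR: "drop_coord k (R x) = x - (x $ k / w $ k) *\<^sub>R w" for x
    using w by (simp add: R_def vec_eq_iff axis_def)
  have mT: "vol (T ` S) = \<bar>w $ k\<bar> * vol S" if "compact S" for S
    unfolding T_def using measure_replace_axis_image[OF that] .
  have cR: "compact (R ` K)" using K linR by (simp add: compact_linear_image)
  have TRK: "T ` R ` K = K" using TR by (simp add: image_comp comp_def)
  have "T (axis k 1) = w" by (simp add: T_def)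
  then have Te: "T ` seg (axis k 1) = seg w"
    by (simp add: linear_image_segment linT)
  have "K + seg w = T ` (R ` K + seg (axis k 1))"
    by (simp only: linear_image_set_plus[OF linT] TRK Te)
  also have "vol \<dots> = \<bar>w $ k\<bar> * vol (R ` K + seg (axis k 1))"
    by (intro mT compact_set_plus cR compact_segment)
  also have "vol (R ` K + seg (axis k 1)) = vol (R ` K) +
      vol (drop_coord k ` R ` K + seg (axis k 1))"
    by (rule measure_plus_axis_segment[OF cR convex_linear_image[OF linR K(2)]])
  also have "drop_coord k ` R ` K = (\<lambda>x. x - (x $ k / w $ k) *\<^sub>R w) ` K"
    by (simp add: image_comp comp_def dR)
  also have "\<bar>w $ k\<bar> * (vol (R ` K) + m) = vol K + \<bar>w $ k\<bar> * m" for m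
    using mT[OF cR] TRK by (simp add: distrib_left)
  finally show ?thesis .
qed

text \<open>The cube edges are built in to make the family closed under cylinders over projections:
  a projection destroys one edge of the cube, the cylinder restores it. In coordinates where all
  \<open>ws\<close> vanish the body is a product with a unit cube.\<close>

definition cube_zonotope :: "(real^'n) list \<Rightarrow> (real^'n) set" where
  "cube_zonotope ws = (\<Sum>i\<in>UNIV. seg (axis i 1)) + (\<Sum>w\<leftarrow>ws. seg w)"

lemma cube_zonotope_Cons:
  "cube_zonotope (w # ws) = cube_zonotope ws + seg w"
  by (simp add: cube_zonotope_def ac_simps)

lemma compact_cube_zonotope: "compact (cube_zonotope ws)"
  unfolding cube_zonotope_def
  by (intro compact_set_plus compact_set_sum compact_sum_list_segments compact_segment)

lemma convex_cube_zonotope: "convex (cube_zonotope ws)"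
  unfolding cube_zonotope_def
  by (intro convex_set_plus convex_set_sum convex_sum_list_segments convex_closed_segment)

lemma sum_axis_segments_eq_cbox:
  "(\<Sum>i\<in>UNIV. seg (axis i 1)) = {x :: real^'n. \<forall>i. 0 \<le> x $ i \<and> x $ i \<le> 1}"
proof -
  have "(\<Sum>i\<in>I. seg (axis i 1)) =
      {x :: real^'n. \<forall>i. if i \<in> I then 0 \<le> x $ i \<and> x $ i \<le> 1 else x $ i = 0}" if "finite I" for I
    using that
  proof induction
    case empty
    show ?case by (auto simp: vec_eq_iff)
  next
    case (insert j I)
    show ?case
    proof (rule set_eqI)
      fix x :: "real^'n"
      have "x \<in> (\<Sum>i\<in>insert j I. seg (axis i 1)) \<longleftrightarrow>
          x \<in> (\<Sum>i\<in>I. seg (axis i 1)) + seg (1 *\<^sub>R axis j 1)"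
        using insert by (simp add: add.commute)
      also have "\<dots> \<longleftrightarrow> (\<exists>r. 0 \<le> r \<and> r \<le> 1 \<and>
          (\<forall>i. if i \<in> I then 0 \<le> (x - r *\<^sub>R axis j 1) $ i \<and> (x - r *\<^sub>R axis j 1) $ i \<le> 1
            else (x - r *\<^sub>R axis j 1) $ i = 0))"
        by (subst set_plus_segment_iff) (auto simp: insert.IH)
      also have "\<dots> \<longleftrightarrow> (\<forall>i. if i \<in> insert j I then 0 \<le> x $ i \<and> x $ i \<le> 1 else x $ i = 0)"
        (is "?L \<longleftrightarrow> ?R")
      proof
        assume ?L
        then obtain r where r: "0 \<le> r" "r \<le> 1" and
          x: "\<And>i. if i \<in> I then 0 \<le> (x - r *\<^sub>R axis j 1) $ i \<and> (x - r *\<^sub>R axis j 1) $ i \<le> 1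
            else (x - r *\<^sub>R axis j 1) $ i = 0" by blast
        show ?R
        proof
          fix i show "if i \<in> insert j I then 0 \<le> x $ i \<and> x $ i \<le> 1 else x $ i = 0"
            using x[of i] r insert.hyps by (auto simp: axis_def split: if_splits)
        qed
      next
        assume R: ?R
        show ?L
        proof (intro exI[of _ "x $ j"] conjI allI)
          show "0 \<le> x $ j" "x $ j \<le> 1" using R by (metis insertI1)+
          fix i show "if i \<in> I then 0 \<le> (x - x $ j *\<^sub>R axis j 1) $ i \<and> (x - x $ j *\<^sub>R axis j 1) $ i \<le> 1
            else (x - x $ j *\<^sub>R axis j 1) $ i = 0"
            using R[rule_format, of i] insert.hyps by (auto simp: axis_def)
        qed
      qed
      finally show "x \<in> (\<Sum>i\<in>insert j I. seg (axis i 1)) \<longleftrightarrow>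
          x \<in> {x. \<forall>i. if i \<in> insert j I then 0 \<le> x $ i \<and> x $ i \<le> 1 else x $ i = 0}"
        by simp
    qed
  qed
  from this[of UNIV] show ?thesis by simp
qed

definition zvol :: "(real^'n) list \<Rightarrow> real" where
  "zvol ws = vol (cube_zonotope ws)"

lemma zvol_Nil: "zvol ([] :: (real^'n) list) = 1"
proof -
  have "cube_zonotope [] = cbox 0 (\<chi> i. 1 :: real^'n)"
    by (auto simp: cube_zonotope_def sum_axis_segments_eq_cbox mem_box_cart)
  then have "zvol ([] :: (real^'n) list) = vol (cbox (0::real^'n) (\<chi> i. 1))"
    by (simp add: zvol_def)
  also have "\<dots> = 1"
    by (simp add: content_cbox_cart interval_eq_empty_cart)
  finally show ?thesis .
qed

lemma zvol_zero_Cons: "zvol (0 # ws) = zvol ws"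
  by (simp add: zvol_def cube_zonotope_Cons)

text \<open>The segment to \<open>- w\<close> is a translate of the segment to \<open>w\<close>;
  this absorbs the sign that a projected axis vector acquires.\<close>

lemma measure_plus_segment_uminus:
  "vol (K + seg (- w)) = vol (K + seg w)"
proof -
  have "seg (- w) = (+) (- w) ` seg w"
    using closed_segment_translation[of "- w" 0 w] closed_segment_commute[of 0 "- w"] by simp
  then have "K + seg (- w) = (+) (- w) ` (K + seg w)"
    by (force simp: set_plus_def image_iff algebra_simps)
  then show ?thesis by (simp only: measure_translation)
qed

text \<open>One pivoting step. The oblique projection along \<open>w\<close> kills \<open>w\<close>,
  fixes the axes other than \<open>k\<close> and sends axis \<open>k\<close> to \<open>- w'\<close>;
  the cylinder restores the cube, leaving one extra segment. The first term has one generator fewer,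
  and in the second all generators vanish at coordinate \<open>k\<close>, so the recursion
  ends.\<close>

lemma zvol_Cons:
  fixes w :: "real^'n"
  assumes w: "w $ k \<noteq> 0"
  shows "zvol (w # ws) = zvol ws +
    \<bar>w $ k\<bar> * zvol ((1 / w $ k) *\<^sub>R drop_coord k w # map (\<lambda>x. x - (x $ k / w $ k) *\<^sub>R w) ws)"
proof -
  define S where "S x = x - (x $ k / w $ k) *\<^sub>R w" for x
  define w' where "w' = (1 / w $ k) *\<^sub>R drop_coord k w"
  have lin: "linear S" unfolding S_def by (rule linearI) (simp_all add: algebra_simps add_divide_distrib)
  note seg = linear_image_segment[OF lin]
  have Sk: "S (axis k 1) = - w'"
    using w by (simp add: S_def w'_def vec_eq_iff axis_def)
  have Si: "S (axis i 1) = axis i 1" if "i \<noteq> k" for i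
    using that by (simp add: S_def axis_def)
  have "S ` (\<Sum>i\<in>UNIV. seg (axis i 1)) = (\<Sum>i\<in>UNIV. seg (S (axis i 1)))"
    by (simp add: linear_image_set_sum[OF lin] seg)
  also have "\<dots> = seg (- w') + (\<Sum>i\<in>UNIV-{k}. seg (axis i 1))"
    by (subst sum.remove[of _ k]) (auto simp: Sk Si intro!: sum.cong)
  finally have cube: "S ` (\<Sum>i\<in>UNIV. seg (axis i 1)) + seg (axis k 1) =
      (\<Sum>i\<in>UNIV. seg (axis i 1)) + seg (- w')"
    by (subst sum.remove[of UNIV k]) (auto simp: ac_simps)
  have "S ` cube_zonotope ws + seg (axis k 1) =
      S ` (\<Sum>i\<in>UNIV. seg (axis i 1)) + seg (axis k 1)
        + (\<Sum>w\<leftarrow>map S ws. seg w)"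
    by (simp add: cube_zonotope_def linear_image_set_plus[OF lin] linear_image_set_sum_list[OF lin] seg
        comp_def ac_simps)
  also have "\<dots> = cube_zonotope (map S ws) + seg (- w')"
    unfolding cube by (simp add: cube_zonotope_def ac_simps)
  finally have "vol (S ` cube_zonotope ws + seg (axis k 1)) = zvol (w' # map S ws)"
    by (simp only: measure_plus_segment_uminus zvol_def cube_zonotope_Cons)
  then show ?thesis
    using measure_plus_segment[of "cube_zonotope ws" w k] w
    by (simp add: compact_cube_zonotope convex_cube_zonotope zvol_def cube_zonotope_Cons S_def[abs_def] w'_def)
qed

text \<open>Makes the volumes of coordinate shadows accessible to the same recursion as the volume
  itself.\<close>

lemma drop_coord_cube_zonotope:
  fixes ws :: "(real^'n) list"
  shows "drop_coord k ` cube_zonotope ws + seg (axis k 1) = cube_zonotope (map (drop_coord k) ws)"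
proof -
  note lin = linear_drop_coord[of k]
  note seg = linear_image_segment[OF lin]
  have "drop_coord k (axis i (1::real)) = (if i = k then 0 else axis i 1)" for i
    by (simp add: vec_eq_iff axis_def)
  then have "drop_coord k ` (\<Sum>i\<in>UNIV. seg (axis i 1)) =
      (\<Sum>i\<in>UNIV. seg (if i = k then 0 else axis i (1::real)))"
    by (simp add: linear_image_set_sum[OF lin] seg)
  also have "\<dots> = (\<Sum>i\<in>UNIV-{k}. seg (axis i 1))"
    by (subst sum.remove[of _ k]) (auto intro!: sum.cong)
  finally have cube: "drop_coord k ` (\<Sum>i\<in>UNIV. seg (axis i 1)) + seg (axis k 1) =
      (\<Sum>i\<in>UNIV. seg (axis i (1::real)))"
    by (subst sum.remove[of UNIV k]) (auto simp: ac_simps)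
  have "drop_coord k ` cube_zonotope ws + seg (axis k 1) =
      (drop_coord k ` (\<Sum>i\<in>UNIV. seg (axis i 1)) + seg (axis k 1))
        + (\<Sum>w\<leftarrow>map (drop_coord k) ws. seg w)"
    by (simp add: cube_zonotope_def linear_image_set_plus[OF lin] linear_image_set_sum_list[OF lin] seg
        comp_def ac_simps)
  then show ?thesis by (simp only: cube cube_zonotope_def)
qed

section \<open>Exact volumes for generators supported on four coordinates\<close>

definition vec4 :: "'n \<Rightarrow> 'n \<Rightarrow> 'n \<Rightarrow> 'n \<Rightarrow> real \<times> real \<times> real \<times> real \<Rightarrow> real^'n" where
  "vec4 i j k l = (\<lambda>(a, b, c, d). \<chi> m. if m = i then a else if m = j then b
     else if m = k then c else if m = l then d else 0)"

definition zvol4 :: "'n \<Rightarrow> 'n \<Rightarrow> 'n \<Rightarrow> 'n::finite \<Rightarrow> (real \<times> real \<times> real \<times> real) list \<Rightarrow> real" where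
  "zvol4 i j k l ts = zvol (map (vec4 i j k l) ts)"

text \<open>The volume of a cube zonotope is the sum of the absolute values of all square minors of
  the matrix with columns \<open>ws\<close>, the empty minor counting 1; dropping a coordinate
  deletes a row. Here rows \<open>k\<close>, \<open>l\<close> have minors of absolute value 2, so
  the matrix is not totally unimodular. Without row \<open>i\<close> the columns form two opposite
  pairs, which keeps the shadow along axis \<open>i\<close> small. Indices other than
  \<open>i\<close>, \<open>j\<close>, \<open>k\<close>, \<open>l\<close> only carry cube
  edges.\<close>

definition bad_generators :: "'n \<Rightarrow> 'n \<Rightarrow> 'n \<Rightarrow> 'n::finite \<Rightarrow> (real^'n) list" where
  "bad_generators i j k l = map (vec4 i j k l) [(1, 0, 1, -1), (1, 0, -1, 1), (1, -1, 1, 1), (1, 1, -1, -1)]"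

context
  fixes i j k l :: "'n::finite"
  assumes dist: "distinct [i, j, k, l]"
begin

lemma zvol4_Nil: "zvol4 i j k l [] = 1"
  by (simp add: zvol4_def zvol_Nil)

lemma zvol4_zero: "zvol4 i j k l ((0, 0, 0, 0) # ts) = zvol4 i j k l ts"
proof -
  have "vec4 i j k l (0, 0, 0, 0) = 0" by (simp add: vec4_def vec_eq_iff)
  then show ?thesis by (simp add: zvol4_def zvol_zero_Cons)
qed

lemma zvol4_pivot:
  assumes "vec4 i j k l t0 $ m = a" "a \<noteq> 0"
    and "(1 / a) *\<^sub>R drop_coord m (vec4 i j k l t0) = vec4 i j k l t1"
    and "\<And>t. vec4 i j k l t - (vec4 i j k l t $ m / a) *\<^sub>R vec4 i j k l t0 = vec4 i j k l (g t)"
  shows "zvol4 i j k l (t0 # ts) = zvol4 i j k l ts + \<bar>a\<bar> * zvol4 i j k l (t1 # map g ts)"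
  using zvol_Cons[of "vec4 i j k l t0" m "map (vec4 i j k l) ts"] assms
  by (simp add: zvol4_def comp_def)

text \<open>Gaussian elimination on quadruples. The pivot is always the first nonzero entry, so that
  together with the rules for zero and the empty list the simplifier can evaluate volumes.\<close>

lemma zvol4_Cons:
  shows "a \<noteq> 0 \<Longrightarrow> zvol4 i j k l ((a, b, c, d) # ts) = zvol4 i j k l ts + \<bar>a\<bar> * zvol4 i j k l ((0, b / a, c / a, d / a) #
      map (\<lambda>(p, q, r, s). (0, q - p / a * b, r - p / a * c, s - p / a * d)) ts)"
    and "b \<noteq> 0 \<Longrightarrow> zvol4 i j k l ((0, b, c, d) # ts) = zvol4 i j k l ts + \<bar>b\<bar> * zvol4 i j k l ((0, 0, c / b, d / b) #
      map (\<lambda>(p, q, r, s). (p, 0, r - q / b * c, s - q / b * d)) ts)"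
    and "c \<noteq> 0 \<Longrightarrow> zvol4 i j k l ((0, 0, c, d) # ts) = zvol4 i j k l ts + \<bar>c\<bar> * zvol4 i j k l ((0, 0, 0, d / c) #
      map (\<lambda>(p, q, r, s). (p, q, 0, s - r / c * d)) ts)"
    and "d \<noteq> 0 \<Longrightarrow> zvol4 i j k l ((0, 0, 0, d) # ts) = zvol4 i j k l ts + \<bar>d\<bar> * zvol4 i j k l ((0, 0, 0, 0) #
      map (\<lambda>(p, q, r, s). (p, q, r, 0)) ts)"
  using dist
  by - (rule zvol4_pivot[of _ i] zvol4_pivot[of _ j] zvol4_pivot[of _ k] zvol4_pivot[of _ l];
      auto simp: vec4_def vec_eq_iff split: prod.split)+

lemma zvol_bad_generators:
  shows "zvol (bad_generators i j k l) = 85"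
    and "zvol (map (drop_coord i) (bad_generators i j k l)) = 27"
    and "zvol (map (drop_coord j) (bad_generators i j k l)) = 53"
    and "zvol (map (drop_coord i) (map (drop_coord j) (bad_generators i j k l))) = 17"
proof -
  have di: "drop_coord i (vec4 i j k l (a, b, c, d)) = vec4 i j k l (0, b, c, d)"
    and dj: "drop_coord j (vec4 i j k l (a, b, c, d)) = vec4 i j k l (a, 0, c, d)" for a b c d
    using dist by (auto simp: vec4_def vec_eq_iff)
  have 1: "zvol (bad_generators i j k l) = zvol4 i j k l [(1, 0, 1, -1), (1, 0, -1, 1), (1, -1, 1, 1), (1, 1, -1, -1)]"
   and 2: "zvol (map (drop_coord i) (bad_generators i j k l)) =
      zvol4 i j k l [(0, 0, 1, -1), (0, 0, -1, 1), (0, -1, 1, 1), (0, 1, -1, -1)]"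
   and 3: "zvol (map (drop_coord j) (bad_generators i j k l)) =
      zvol4 i j k l [(1, 0, 1, -1), (1, 0, -1, 1), (1, 0, 1, 1), (1, 0, -1, -1)]"
   and 4: "zvol (map (drop_coord i) (map (drop_coord j) (bad_generators i j k l))) =
      zvol4 i j k l [(0, 0, 1, -1), (0, 0, -1, 1), (0, 0, 1, 1), (0, 0, -1, -1)]"
    by (simp_all add: bad_generators_def zvol4_def di dj)
  show "zvol (bad_generators i j k l) = 85"
    unfolding 1 by (simp add: zvol4_Cons zvol4_zero zvol4_Nil)
  show "zvol (map (drop_coord i) (bad_generators i j k l)) = 27"
    unfolding 2 by (simp add: zvol4_Cons zvol4_zero zvol4_Nil)
  show "zvol (map (drop_coord j) (bad_generators i j k l)) = 53"
    unfolding 3 by (simp add: zvol4_Cons zvol4_zero zvol4_Nil)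
  show "zvol (map (drop_coord i) (map (drop_coord j) (bad_generators i j k l))) = 17"
    unfolding 4 by (simp add: zvol4_Cons zvol4_zero zvol4_Nil)
qed

end

section \<open>Zonotopes as zonoids\<close>

lemma zonotope_zero: "zonotope {0}"
  unfolding zonotope_def by (intro exI[of _ 0]) simp

lemma zonotope_plus_segment:
  assumes "zonotope Z" shows "zonotope (Z + seg w)"
proof -
  obtain m :: nat and v where Z: "Z = (\<Sum>i<m. seg (v i))"
    using assms unfolding zonotope_def by blast
  have "(\<Sum>i<Suc m. seg ((v(m := w)) i)) = Z + seg w"
    by (simp add: Z)
  then show ?thesis unfolding zonotope_def by metis
qed

lemma zonotope_segment: "zonotope (seg w)"
  using zonotope_plus_segment[OF zonotope_zero] by simp

lemma zonotope_linear_image: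
  assumes "zonotope Z" "linear f" shows "zonotope (f ` Z)"
proof -
  obtain m :: nat and v where Z: "Z = (\<Sum>i<m. seg (v i))"
    using assms unfolding zonotope_def by blast
  have "f ` Z = (\<Sum>i<m. seg (f (v i)))"
    by (simp add: Z linear_image_set_sum[OF assms(2)] linear_image_segment[OF assms(2)])
  then show ?thesis unfolding zonotope_def by (intro exI[of _ m] exI[of _ "\<lambda>i. f (v i)"])
qed

lemma zonotope_cube_zonotope: "zonotope (cube_zonotope ws)"
proof (induction ws)
  case Nil
  have "zonotope (\<Sum>i\<in>I. seg (axis i 1) :: (real^'n) set)" if "finite I" for I
    using that
  proof induction
    case (insert i I)
    then show ?case
      using zonotope_plus_segment[OF insert.IH, of "axis i 1"] by (simp add: add.commute)
  qed (simp add: zonotope_zero)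
  then show ?case by (simp add: cube_zonotope_def)
qed (simp add: cube_zonotope_Cons zonotope_plus_segment)

lemma zonotope_imp_zonoid:
  fixes Z :: "'a::euclidean_space set"
  assumes "zonotope Z" shows "zonoid Z"
proof -
  obtain m :: nat and v where Z: "Z = (\<Sum>i<m. seg (v i))"
    using assms unfolding zonotope_def by blast
  have "compact Z" unfolding Z by (intro compact_set_sum) auto
  moreover have ne: "Z \<noteq> {}"
  proof -
    have "0 \<in> (\<Sum>i<n. seg (v i))" for n
    proof (induction n)
      case (Suc n)
      then show ?case
        using set_plus_intro[of 0 "\<Sum>i<n. seg (v i)" 0 "seg (v n)"] by simp
    qed simp
    then show ?thesis using Z by auto
  qed
  moreover have "hausdorff_dist Z Z = 0"
    using ne by (simp add: hausdorff_dist_def cSUP_const cong: SUP_cong)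
  ultimately show ?thesis
    unfolding zonoid_def using assms by (auto intro!: exI[of _ "\<lambda>_. Z"])
qed

section \<open>Mixed volumes with two segments\<close>

lemma measure_plus_scaled_axis_segment:
  fixes K :: "(real^'n) set"
  assumes K: "compact K" "convex K" and t: "0 \<le> t"
  shows "vol (K + seg (t *\<^sub>R axis k 1)) =
    vol K + t * vol (drop_coord k ` K + seg (axis k 1))"
proof (cases "t = 0")
  case False
  have "(\<lambda>x. x - x $ k *\<^sub>R axis k 1) ` K = drop_coord k ` K"
    by (simp add: drop_coord_eq)
  then show ?thesis
    using measure_plus_segment[OF K, of "t *\<^sub>R axis k 1" k] False t by simp
qed simp

lemma measure_scale_outside:
  fixes S :: "(real^'n) set"
  assumes "compact S" "0 \<le> a"
  shows "vol ((\<lambda>x. \<chi> k. (if k \<in> J then 1 else a) * x $ k) ` S) =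
    a ^ (CARD('n) - card J) * vol S"
proof -
  have "(\<Prod>k\<in>UNIV. if k \<in> J then 1 else a) = (\<Prod>k\<in>-J. a)"
    by (simp add: prod.If_cases)
  then have "(\<Prod>k\<in>UNIV. if k \<in> J then 1 else a) = a ^ (CARD('n) - card J)"
    by (simp add: Compl_eq_Diff_UNIV card_Diff_subset)
  then show ?thesis
    using measure_stretch[of S "\<lambda>k. if k \<in> J then 1 else a"] assms
    by (simp add: lmeasurable_compact)
qed

text \<open>Scaling by \<open>a\<close> only in the coordinates outside \<open>J\<close> scales
  \<open>P\<close>, which vanishes on \<open>J\<close>, and fixes the unit segments; its determinant
  has one factor \<open>a\<close> for each coordinate outside \<open>J\<close>.\<close>

lemma measure_scaled_base:
  fixes P :: "(real^'n) set"
  assumes P: "compact P" "\<And>x k. x \<in> P \<Longrightarrow> k \<in> J \<Longrightarrow> x $ k = 0" and a: "0 \<le> a"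
  shows "vol ((*\<^sub>R) a ` P + (\<Sum>k\<in>J. seg (axis k 1))) =
    a ^ (CARD('n) - card J) * vol (P + (\<Sum>k\<in>J. seg (axis k 1)))"
proof -
  define T :: "real^'n \<Rightarrow> real^'n" where "T x = (\<chi> k. (if k \<in> J then 1 else a) * x $ k)" for x
  have lin: "linear T"
    unfolding T_def by (rule linearI) (simp_all add: vec_eq_iff algebra_simps)
  have TP: "T ` P = (*\<^sub>R) a ` P"
    by (rule image_cong) (auto simp: T_def vec_eq_iff P(2))
  have "T ` seg (axis k 1) = seg (axis k 1)" if "k \<in> J" for k
  proof -
    have "T (axis k 1) = axis k 1" using that by (auto simp: T_def vec_eq_iff axis_def)
    then show ?thesis by (simp add: linear_image_segment lin)
  qed
  then have "T ` (P + (\<Sum>k\<in>J. seg (axis k 1))) =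
      (*\<^sub>R) a ` P + (\<Sum>k\<in>J. seg (axis k 1))"
    by (simp add: linear_image_set_plus[OF lin] linear_image_set_sum[OF lin] TP)
  then show ?thesis
    using measure_scale_outside[of "P + (\<Sum>k\<in>J. seg (axis k 1))" a J] P(1) a
    by (simp add: T_def[abs_def] compact_set_plus compact_set_sum)
qed

lemma image_scaleR_drop_coord: "drop_coord k ` (*\<^sub>R) a ` K = (*\<^sub>R) a ` drop_coord k ` K"
  by (simp add: image_comp comp_def linear_scale[OF linear_drop_coord])

lemma drop_coord_image_plus_segment:
  assumes "i \<noteq> j"
  shows "drop_coord j ` (K + seg (b *\<^sub>R axis i 1)) =
    drop_coord j ` K + seg (b *\<^sub>R axis i 1)"
proof -
  have "drop_coord j (b *\<^sub>R axis i (1::real)) = b *\<^sub>R axis i 1"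
    using assms by (auto simp: vec_eq_iff axis_def)
  then have "drop_coord j ` seg (b *\<^sub>R axis i 1) = seg (b *\<^sub>R axis i (1::real))"
    by (simp add: linear_image_segment linear_drop_coord)
  then show ?thesis by (simp add: linear_image_set_plus[OF linear_drop_coord])
qed

lemma convex_scaleR_image: "convex K \<Longrightarrow> convex ((*\<^sub>R) a ` K)"
  by (rule convex_scaling)

text \<open>Two applications of the segment formula, followed by homogeneity. Segments are
  one-dimensional, so \<open>b\<close> and \<open>c\<close> occur to degree at most one, and the
  coefficients are multiples of the mixed volumes sought.\<close>

lemma measure_combination:
  fixes K :: "(real^'n) set"
  assumes K: "compact K" "convex K" and ij: "i \<noteq> j" and nonneg: "0 \<le> a" "0 \<le> b" "0 \<le> c"
  shows "vol ((*\<^sub>R) a ` K + seg (b *\<^sub>R axis i 1) + seg (c *\<^sub>R axis j 1)) =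
    a ^ CARD('n) * vol K
    + a ^ (CARD('n) - 1) * b * vol (drop_coord i ` K + seg (axis i 1))
    + a ^ (CARD('n) - 1) * c * vol (drop_coord j ` K + seg (axis j 1))
    + a ^ (CARD('n) - 2) * b * c * vol (drop_coord i ` drop_coord j ` K
        + seg (axis i 1) + seg (axis j 1))"
proof -
  let ?D = "drop_coord :: 'n \<Rightarrow> _" and ?e = "\<lambda>k. seg (axis k 1 :: real^'n)"
  note cc = compact_set_plus convex_set_plus compact_scaling convex_scaleR_image
    compact_linear_image[OF linear_drop_coord] convex_linear_image[OF linear_drop_coord] K
    compact_segment convex_closed_segment
  have base: "vol ((*\<^sub>R) a ` ?D k ` K + ?e k) =
      a ^ (CARD('n) - 1) * vol (?D k ` K + ?e k)" for k
  proof -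
    have "vol ((*\<^sub>R) a ` ?D k ` K + (\<Sum>l\<in>{k}. ?e l)) =
      a ^ (CARD('n) - card {k}) * vol (?D k ` K + (\<Sum>l\<in>{k}. ?e l))"
      by (rule measure_scaled_base) (use nonneg in \<open>auto simp: cc\<close>)
    then show ?thesis by simp
  qed
  have base2: "vol ((*\<^sub>R) a ` ?D i ` ?D j ` K + ?e j + ?e i) =
      a ^ (CARD('n) - 2) * vol (?D i ` ?D j ` K + ?e i + ?e j)"
  proof -
    have "vol ((*\<^sub>R) a ` ?D i ` ?D j ` K + (\<Sum>k\<in>{i,j}. ?e k)) =
      a ^ (CARD('n) - card {i,j}) * vol (?D i ` ?D j ` K + (\<Sum>k\<in>{i,j}. ?e k))"
      by (rule measure_scaled_base) (use nonneg in \<open>auto simp: cc\<close>)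
    then show ?thesis using ij by (simp add: numeral_2_eq_2 ac_simps)
  qed
  have "vol ((*\<^sub>R) a ` K + seg (b *\<^sub>R axis i 1) + seg (c *\<^sub>R axis j 1)) =
      vol ((*\<^sub>R) a ` K + seg (b *\<^sub>R axis i 1)) +
      c * vol (?D j ` ((*\<^sub>R) a ` K + seg (b *\<^sub>R axis i 1)) + ?e j)"
    by (rule measure_plus_scaled_axis_segment) (simp_all add: cc nonneg)
  also have "vol ((*\<^sub>R) a ` K + seg (b *\<^sub>R axis i 1)) =
      vol ((*\<^sub>R) a ` K) + b * vol ((*\<^sub>R) a ` ?D i ` K + ?e i)"
    using measure_plus_scaled_axis_segment[of "(*\<^sub>R) a ` K" b i]
    by (simp add: cc nonneg image_scaleR_drop_coord)
  also have "vol ((*\<^sub>R) a ` K) = a ^ CARD('n) * vol K"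
    using nonneg by (simp add: measure_scaleR cc lmeasurable_compact)
  also have "vol (?D j ` ((*\<^sub>R) a ` K + seg (b *\<^sub>R axis i 1)) + ?e j) =
      vol (((*\<^sub>R) a ` ?D j ` K + ?e j) + seg (b *\<^sub>R axis i 1))"
    using ij by (simp add: drop_coord_image_plus_segment image_scaleR_drop_coord ac_simps)
  also have "\<dots> = vol ((*\<^sub>R) a ` ?D j ` K + ?e j) +
      b * vol (?D i ` ((*\<^sub>R) a ` ?D j ` K + ?e j) + ?e i)"
    by (rule measure_plus_scaled_axis_segment) (simp_all add: cc nonneg)
  also have "?D i ` ((*\<^sub>R) a ` ?D j ` K + ?e j) = (*\<^sub>R) a ` ?D i ` ?D j ` K + ?e j"
    using ij drop_coord_image_plus_segment[of j i "(*\<^sub>R) a ` ?D j ` K" 1]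
    by (simp add: image_scaleR_drop_coord)
  finally show ?thesis unfolding base base2
    by (simp add: distrib_left mult_ac add.assoc[where 'a=real])
qed

section \<open>Sums over index lists by multiplicity of the bodies\<close>

lemma sum_over_lists_Suc:
  "(\<Sum>js | length js = Suc n \<and> set js \<subseteq> {..<m::nat}. F js) =
    (\<Sum>i<m. \<Sum>js | length js = n \<and> set js \<subseteq> {..<m}. F (i # js))"
proof -
  have "{js. length js = Suc n \<and> set js \<subseteq> {..<m}} =
      (\<lambda>(i, js). i # js) ` ({..<m} \<times> {js. length js = n \<and> set js \<subseteq> {..<m}})"
    by (auto simp: length_Suc_conv image_iff)
  then have "(\<Sum>js | length js = Suc n \<and> set js \<subseteq> {..<m::nat}. F js) =
      (\<Sum>(i, js)\<in>{..<m} \<times> {js. length js = n \<and> set js \<subseteq> {..<m}}. F (i # js))"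
    by (simp add: sum.reindex inj_on_def case_prod_unfold)
  also have "\<dots> = (\<Sum>i<m. \<Sum>js | length js = n \<and> set js \<subseteq> {..<m}. F (i # js))"
    by (rule sum.cartesian_product[symmetric])
  finally show ?thesis .
qed

text \<open>If all values of \<open>K\<close> are among pairwise distinct \<open>A\<close>,
  \<open>B\<close>, \<open>C\<close>, this is the coefficient of x^p y^q in (w_A + x w_B + y w_C)^n,
  where w_X is \<open>weight K t m X\<close>. It isolates the terms of the mixed volume expansion
  with prescribed numbers of copies of \<open>B\<close> and \<open>C\<close>.\<close>

definition count_sum :: "'b \<Rightarrow> 'b \<Rightarrow> (nat \<Rightarrow> 'b) \<Rightarrow> (nat \<Rightarrow> real) \<Rightarrow> nat \<Rightarrow> nat \<Rightarrow> nat \<Rightarrow> nat \<Rightarrow> real" where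
  "count_sum B C K t m p q n = (\<Sum>js | length js = n \<and> set js \<subseteq> {..<m}.
     if count_list (map K js) B = p \<and> count_list (map K js) C = q then prod_list (map t js) else 0)"

definition weight :: "(nat \<Rightarrow> 'b) \<Rightarrow> (nat \<Rightarrow> real) \<Rightarrow> nat \<Rightarrow> 'b \<Rightarrow> real" where
  "weight K t m X = (\<Sum>i<m. if K i = X then t i else 0)"

context
  fixes A B C :: 'b and K :: "nat \<Rightarrow> 'b" and t :: "nat \<Rightarrow> real" and m :: nat
  assumes ABC: "A \<noteq> B" "A \<noteq> C" "B \<noteq> C" and K: "\<And>i. i < m \<Longrightarrow> K i \<in> {A, B, C}"
begin

lemma count_sum_0: "count_sum B C K t m p q 0 = (if p = 0 \<and> q = 0 then 1 else 0)"
proof -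
  have "{js. js = [] \<and> set js \<subseteq> {..<m}} = {[]}" by auto
  then show ?thesis by (simp add: count_sum_def)
qed

text \<open>Splitting off the first index multiplies the generating polynomial by one more linear
  factor.\<close>

lemma count_sum_Suc:
  "count_sum B C K t m p q (Suc n) = weight K t m A * count_sum B C K t m p q n
    + (if p = 0 then 0 else weight K t m B * count_sum B C K t m (p - 1) q n)
    + (if q = 0 then 0 else weight K t m C * count_sum B C K t m p (q - 1) n)"
proof -
  let ?L = "{js. length js = n \<and> set js \<subseteq> {..<m}}"
  let ?F = "\<lambda>p q js. if count_list (map K js) B = p \<and> count_list (map K js) C = q
      then prod_list (map t js) else 0"
  have "(\<Sum>js\<in>?L. ?F p q (i # js)) =
      (if K i = A then t i else 0) * count_sum B C K t m p q n
      + (if p = 0 then 0 else (if K i = B then t i else 0) * count_sum B C K t m (p - 1) q n)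
      + (if q = 0 then 0 else (if K i = C then t i else 0) * count_sum B C K t m p (q - 1) n)"
    if "i < m" for i
  proof -
    consider "K i = A" | "K i = B" | "K i = C" using K[OF \<open>i < m\<close>] by auto
    then show ?thesis
    proof cases
      case 1
      then show ?thesis using ABC
        by (auto simp: count_sum_def sum_distrib_left intro!: sum.cong)
    next
      case 2
      show ?thesis
      proof (cases p)
        case (Suc p')
        then show ?thesis using ABC 2
          by (auto simp: count_sum_def sum_distrib_left intro!: sum.cong)
      qed (use ABC 2 in simp)
    next
      case 3
      show ?thesis
      proof (cases q)
        case (Suc p')
        then show ?thesis using ABC 3
          by (auto simp: count_sum_def sum_distrib_left intro!: sum.cong)
      qed (use ABC 3 in simp)
    qed
  qed
  then have "count_sum B C K t m p q (Suc n) = (\<Sum>i<m.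
      (if K i = A then t i else 0) * count_sum B C K t m p q n
      + (if p = 0 then 0 else (if K i = B then t i else 0) * count_sum B C K t m (p - 1) q n)
      + (if q = 0 then 0 else (if K i = C then t i else 0) * count_sum B C K t m p (q - 1) n))"
    unfolding count_sum_def[of B C K t m p q "Suc n"] sum_over_lists_Suc by (intro sum.cong) auto
  then show ?thesis
    by (cases p; cases q) (simp_all add: sum.distrib weight_def sum_distrib_right)
qed

lemma count_sum_0_0: "count_sum B C K t m 0 0 n = weight K t m A ^ n"
  by (induction n) (simp_all add: count_sum_0 count_sum_Suc)

lemma count_sum_1_0: "count_sum B C K t m 1 0 n = n * weight K t m A ^ (n - 1) * weight K t m B"
proof (induction n)
  case (Suc n)
  then show ?case by (cases n) (simp_all add: count_sum_Suc count_sum_0_0 algebra_simps)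
qed (simp add: count_sum_0)

lemma count_sum_0_1: "count_sum B C K t m 0 1 n = n * weight K t m A ^ (n - 1) * weight K t m C"
proof (induction n)
  case (Suc n)
  then show ?case by (cases n) (simp_all add: count_sum_Suc count_sum_0_0 algebra_simps)
qed (simp add: count_sum_0)

lemma count_sum_1_1:
  "count_sum B C K t m 1 1 n = real n * (real n - 1) * weight K t m A ^ (n - 2) * weight K t m B * weight K t m C"
proof (induction n)
  case (Suc n)
  note * = count_sum_Suc[of 1 1 n] Suc count_sum_1_0[of n] count_sum_0_1[of n]
  show ?case
  proof (cases n)
    case n: (Suc n')
    show ?thesis by (cases n') (use * n in \<open>simp_all add: algebra_simps\<close>)
  qed (use * in \<open>simp add: count_sum_0\<close>)
qed (simp add: count_sum_0)

lemmas count_sum_values = count_sum_0_0 count_sum_1_0 count_sum_0_1 count_sum_1_1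

end

lemma scaleR_image_add:
  assumes "convex S" "0 \<le> s" "0 \<le> t"
  shows "(*\<^sub>R) s ` S + (*\<^sub>R) t ` S = (*\<^sub>R) (s + t) ` S"
proof
  show "(*\<^sub>R) (s + t) ` S \<subseteq> (*\<^sub>R) s ` S + (*\<^sub>R) t ` S"
    by (force simp: scaleR_add_left)
  show "(*\<^sub>R) s ` S + (*\<^sub>R) t ` S \<subseteq> (*\<^sub>R) (s + t) ` S"
  proof
    fix x assume "x \<in> (*\<^sub>R) s ` S + (*\<^sub>R) t ` S"
    then obtain y z where yz: "y \<in> S" "z \<in> S" "x = s *\<^sub>R y + t *\<^sub>R z"
      by (auto simp: set_plus_def)
    show "x \<in> (*\<^sub>R) (s + t) ` S"
    proof (cases "s + t = 0")
      case True
      then have "s = 0" "t = 0" using assms by auto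
      then show ?thesis using yz by auto
    next
      case False
      then have "(s / (s + t)) *\<^sub>R y + (t / (s + t)) *\<^sub>R z \<in> S"
        using assms yz by (intro convexD) (auto simp flip: add_divide_distrib)
      moreover have "x = (s + t) *\<^sub>R ((s / (s + t)) *\<^sub>R y + (t / (s + t)) *\<^sub>R z)"
        using False yz by (simp add: scaleR_add_right)
      ultimately show ?thesis by blast
    qed
  qed
qed

lemma scaleR_0_image: "S \<noteq> {} \<Longrightarrow> (*\<^sub>R) 0 ` S = {0 :: 'a::real_vector}"
  by auto

text \<open>Convexity allows repeated bodies to be merged, which reduces the expansion for arbitrary
  \<open>m\<close> to a combination of three bodies.\<close>

lemma sum_scaled_bodies:
  fixes A B C :: "'a::euclidean_space set"
  assumes ABC: "A \<noteq> B" "A \<noteq> C" "B \<noteq> C" and cv: "convex A" "convex B" "convex C"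
    and ne: "A \<noteq> {}" "B \<noteq> {}" "C \<noteq> {}"
    and K: "\<And>i. i < m \<Longrightarrow> K i \<in> {A, B, C}" "\<And>i. i < m \<Longrightarrow> 0 \<le> t i"
  shows "(\<Sum>i<m::nat. (*\<^sub>R) (t i) ` K i) =
    (*\<^sub>R) (weight K t m A) ` A + (*\<^sub>R) (weight K t m B) ` B + (*\<^sub>R) (weight K t m C) ` C"
proof -
  \<comment> \<open>A weight that is still 0 has to contribute the neutral element
    \<open>{0}\<close>, hence the nonemptiness.\<close>
  note [simp] = scaleR_0_image[OF ne(1)] scaleR_0_image[OF ne(2)] scaleR_0_image[OF ne(3)]
  have "n \<le> m \<Longrightarrow> (\<Sum>i<n. (*\<^sub>R) (t i) ` K i) =
    (*\<^sub>R) (weight K t n A) ` A + (*\<^sub>R) (weight K t n B) ` B + (*\<^sub>R) (weight K t n C) ` C" for n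
  proof (induction n)
    case 0
    then show ?case by (simp add: weight_def image_constant_conv ne)
  next
    case (Suc n)
    have nn: "0 \<le> weight K t n X" for X
      using Suc K(2) by (auto simp: weight_def intro!: sum_nonneg)
    have tn: "0 \<le> t n" using Suc K(2) by auto
    have w: "weight K t (Suc n) X = weight K t n X + (if K n = X then t n else 0)" for X
      by (simp add: weight_def)
    consider "K n = A" | "K n = B" | "K n = C" using K(1)[of n] Suc by auto
    then show ?case
    proof cases
      case 1
      then show ?thesis using Suc ABC cv nn[of A] tn
        by (simp add: w ac_simps flip: scaleR_image_add)
    next
      case 2
      then show ?thesis using Suc ABC cv nn[of B] tn
        by (simp add: w ac_simps flip: scaleR_image_add)
    next
      case 3
      then show ?thesis using Suc ABC cv nn[of C] tn
        by (simp add: w ac_simps flip: scaleR_image_add)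
    qed
  qed
  then show ?thesis by simp
qed

lemma axis_not_in_axis_segment:
  assumes "i \<noteq> j" shows "axis i (1::real) \<notin> seg (axis j 1)"
proof
  assume "axis i (1::real) \<in> seg (axis j 1)"
  then obtain u where "axis i 1 = u *\<^sub>R axis j (1::real)" by (auto simp: in_segment)
  then have "axis i 1 $ i = (u *\<^sub>R axis j (1::real)) $ i" by simp
  then show False using assms by (simp add: axis_def)
qed

text \<open>By uniqueness it is enough to exhibit one mixed volume functional on
  \<open>{A, B, C}\<close>. It reads off the coefficients of \<open>measure_combination\<close>,
  divided by the number d or d (d-1) of ways to place the segments in a list. As \<open>A\<close>
  differs from both segments, the numbers of copies of \<open>B\<close> and \<open>C\<close> in a
  list determine that of \<open>A\<close>.\<close>

theorem mixed_volume_segments: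
  fixes A :: "(real^'n) set"
  assumes A: "compact A" "convex A" "A \<noteq> {}" and ij: "i \<noteq> j" and d: "CARD('n) \<ge> 2"
    and AB: "A \<noteq> seg (axis i 1)" and AC: "A \<noteq> seg (axis j 1)"
  defines "B \<equiv> seg (axis i 1)" and "C \<equiv> seg (axis j 1)"
  shows "mixed_volume (replicate (CARD('n) - 1) A @ [B]) =
      vol (drop_coord i ` A + B) / CARD('n)"
    and "mixed_volume (replicate (CARD('n) - 1) A @ [C]) =
      vol (drop_coord j ` A + C) / CARD('n)"
    and "mixed_volume (replicate (CARD('n) - 2) A @ [B, C]) =
      vol (drop_coord i ` drop_coord j ` A + B + C) / (real CARD('n) * (real CARD('n) - 1))"
proof -
  define d where "d = CARD('n)"
  define fi where "fi = vol (drop_coord i ` A + B)"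
  define fj where "fj = vol (drop_coord j ` A + C)"
  define fij where "fij = vol (drop_coord i ` drop_coord j ` A + B + C)"
  \<comment> \<open>Dependence on multiplicities alone makes \<open>V\<close> symmetric. Lists with
    a repeated segment get 0, in accordance with the degrees in \<open>b\<close> and
    \<open>c\<close>.\<close>
  define V where "V Ks = (case (count_list Ks B, count_list Ks C) of
      (0, 0) \<Rightarrow> vol A | (Suc 0, 0) \<Rightarrow> fi / d | (0, Suc 0) \<Rightarrow> fj / d
    | (Suc 0, Suc 0) \<Rightarrow> fij / (real d * (real d - 1)) | _ \<Rightarrow> 0)" for Ks
  have BC: "B \<noteq> C"
    using axis_not_in_axis_segment[OF ij] unfolding B_def C_def by (metis ends_in_segment(2))
  note ABC = AB[folded B_def] AC[folded C_def] BC
  \<comment> \<open>As a sum of four indicators, \<open>V\<close> turns the expansion into a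
    combination of four \<open>count_sum\<close> terms.\<close>
  have V: "V Ks = (if count_list Ks B = 0 \<and> count_list Ks C = 0 then vol A else 0)
      + (if count_list Ks B = 1 \<and> count_list Ks C = 0 then fi / d else 0)
      + (if count_list Ks B = 0 \<and> count_list Ks C = 1 then fj / d else 0)
      + (if count_list Ks B = 1 \<and> count_list Ks C = 1 then fij / (real d * (real d - 1)) else 0)" for Ks
    unfolding V_def by (auto split: nat.split)
  have d2: "d \<ge> 2" using d by (simp add: d_def)
  have mvf: "mixed_volume_functional {A, B, C} V"
    unfolding mixed_volume_functional_def
  proof (intro conjI allI impI)
    fix Ks Ls :: "(real^'n) set list"
    assume "length Ks = DIM(real^'n) \<and> set Ks \<subseteq> {A, B, C} \<and> mset Ks = mset Ls"
    then have "count_list Ks X = count_list Ls X" for X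
      by (metis count_mset)
    then show "V Ks = V Ls" by (simp add: V_def)
  next
    fix m and K :: "nat \<Rightarrow> (real^'n) set" and t :: "nat \<Rightarrow> real"
    assume "1 \<le> m \<and> (\<forall>i<m. K i \<in> {A, B, C} \<and> 0 \<le> t i)"
    then have K: "\<And>i. i < m \<Longrightarrow> K i \<in> {A, B, C}" "\<And>i. i < m \<Longrightarrow> 0 \<le> t i" by auto
    let ?w = "weight K t m" and ?L = "{js. length js = DIM(real^'n) \<and> set js \<subseteq> {..<m}}"
    have wn: "0 \<le> ?w X" for X using K(2) by (auto simp: weight_def intro!: sum_nonneg)
    have seg: "(*\<^sub>R) s ` seg x = seg (s *\<^sub>R x)" for s and x :: "real^'n"
      by (simp add: linear_image_segment linear_scale_self)
    have "(\<Sum>i<m. (*\<^sub>R) (t i) ` K i) =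
        (*\<^sub>R) (?w A) ` A + seg (?w B *\<^sub>R axis i 1) + seg (?w C *\<^sub>R axis j 1)"
      using sum_scaled_bodies[OF ABC A(2) _ _ A(3) _ _ K] by (simp add: B_def C_def seg)
    then have "vol (\<Sum>i<m. (*\<^sub>R) (t i) ` K i) =
        ?w A ^ d * vol A + ?w A ^ (d - 1) * ?w B * fi
        + ?w A ^ (d - 1) * ?w C * fj + ?w A ^ (d - 2) * ?w B * ?w C * fij"
      using measure_combination[OF A(1,2) ij wn[of A] wn[of B] wn[of C]]
      by (simp add: d_def fi_def fj_def fij_def B_def C_def)
    also have "\<dots> = vol A * count_sum B C K t m 0 0 d + fi / d * count_sum B C K t m 1 0 d
        + fj / d * count_sum B C K t m 0 1 d + fij / (real d * (real d - 1)) * count_sum B C K t m 1 1 d"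
    proof -
      have "count_sum B C K t m 0 0 d = ?w A ^ d"
        and "count_sum B C K t m 1 0 d = d * ?w A ^ (d - 1) * ?w B"
        and "count_sum B C K t m 0 1 d = d * ?w A ^ (d - 1) * ?w C"
        and "count_sum B C K t m 1 1 d = real d * (real d - 1) * ?w A ^ (d - 2) * ?w B * ?w C"
        by (simp_all only: count_sum_values[OF ABC K(1)])
      with d2 show ?thesis by (simp add: of_nat_diff)
    qed
    also have "\<dots> = (\<Sum>js\<in>?L. V (map K js) * prod_list (map t js))"
      unfolding count_sum_def V sum_distrib_left sum.distrib[symmetric] d_def
      by (intro sum.cong) auto
    finally show "vol (\<Sum>i<m. (*\<^sub>R) (t i) ` K i) =
        (\<Sum>js\<in>?L. V (map K js) * prod_list (map t js))" .
  qed
  have rep: "count_list (replicate n A) B = 0" "count_list (replicate n A) C = 0" for n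
    using ABC by (induction n) auto
  have sub: "set (replicate n A @ Xs) \<subseteq> {A, B, C}" if "set Xs \<subseteq> {B, C}" for n Xs
    using that by auto
  have "mixed_volume (replicate (d - 1) A @ [B]) = V (replicate (d - 1) A @ [B])"
    by (rule mixed_volume_eq[OF mvf sub]) (use d2 d_def in auto)
  then show "mixed_volume (replicate (CARD('n) - 1) A @ [B]) = vol (drop_coord i ` A + B) / CARD('n)"
    by (simp add: V rep ABC ABC[symmetric] fi_def d_def)
  have "mixed_volume (replicate (d - 1) A @ [C]) = V (replicate (d - 1) A @ [C])"
    by (rule mixed_volume_eq[OF mvf sub]) (use d2 d_def in auto)
  then show "mixed_volume (replicate (CARD('n) - 1) A @ [C]) = vol (drop_coord j ` A + C) / CARD('n)"
    by (simp add: V rep ABC ABC[symmetric] fj_def d_def)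
  have "mixed_volume (replicate (d - 2) A @ [B, C]) = V (replicate (d - 2) A @ [B, C])"
    by (rule mixed_volume_eq[OF mvf sub]) (use d2 d_def in auto)
  then show "mixed_volume (replicate (CARD('n) - 2) A @ [B, C]) =
      vol (drop_coord i ` drop_coord j ` A + B + C) / (real CARD('n) * (real CARD('n) - 1))"
    by (simp add: V rep ABC ABC[symmetric] fij_def d_def)
qed

section \<open>Volumes of orthogonal projections\<close>

lemma lborel_distr_orthogonal:
  fixes T :: "real^'n \<Rightarrow> real^'n"
  assumes T: "orthogonal_transformation T"
  shows "distr lborel borel T = lborel"
proof (rule lborel_eqI[symmetric])
  fix l u :: "real^'n" assume le: "\<And>b. b \<in> Basis \<Longrightarrow> l \<bullet> b \<le> u \<bullet> b"
  have lin: "linear T" using T by (rule orthogonal_transformation_linear)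
  have meas: "T \<in> borel_measurable borel" using lin by (rule borel_measurable_linear)
  have iT: "orthogonal_transformation (inv T)" using T by (rule orthogonal_transformation_inv)
  have vim: "T -` box l u = inv T ` box l u"
    using bij_vimage_eq_inv_image[OF orthogonal_transformation_bij[OF T]] .
  have bor: "T -` box l u \<in> sets borel" using measurable_sets[OF meas, of "box l u"] by simp
  have bdd: "bounded (inv T ` box l u)"
    using iT by (intro bounded_linear_image) (auto simp: orthogonal_transformation_linear linear_linear)
  have "vol (T -` box l u) = vol (box l u)"
    unfolding vim using bor vim by (intro measure_orthogonal_image_borel iT) auto
  then have "emeasure lborel (T -` box l u) = emeasure lborel (box l u)"
    using bor bdd emeasure_bounded_finite[OF bdd] emeasure_bounded_finite[OF bounded_box, of l u]
    by (simp add: emeasure_eq_ennreal_measure vim less_top[symmetric])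
  then show "emeasure (distr lborel borel T) (box l u) = (\<Prod>b\<in>Basis. (u - l) \<bullet> b)"
    using meas le by (simp add: emeasure_distr emeasure_lborel_box)
qed simp

text \<open>\<open>\<psi>\<close> uses the given coordinates in the standard basis and yields
  Lebesgue measure, as boxes show. \<open>T\<close> matches the standard basis with \<open>C\<close>
  and is orthogonal, so composing with it changes nothing.\<close>

lemma lborel_eq_distr_orthonormal:
  fixes C :: "(real^'n) set"
  assumes C: "pairwise orthogonal C" "\<And>c. c \<in> C \<Longrightarrow> norm c = 1" "finite C" "card C = CARD('n)"
  shows "distr (\<Pi>\<^sub>M c\<in>C. lborel) borel (\<lambda>f. \<Sum>c\<in>C. f c *\<^sub>R c) = lborel"
proof -
  interpret product_sigma_finite "\<lambda>_::real^'n. lborel :: real measure" ..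
  interpret finite_product_sigma_finite "\<lambda>_::real^'n. lborel :: real measure" C
    by standard (rule C(3))
  obtain \<pi> where \<pi>: "bij_betw \<pi> (Basis :: (real^'n) set) C"
    using finite_same_card_bij[of "Basis :: (real^'n) set" C] C(3,4) by auto
  define T where "T x = (\<Sum>b\<in>Basis. (x \<bullet> b) *\<^sub>R \<pi> b)" for x :: "real^'n"
  define \<psi> where "\<psi> f = (\<Sum>b\<in>Basis. f (\<pi> b) *\<^sub>R b)" for f :: "real^'n \<Rightarrow> real"
  have lin: "linear T"
    unfolding T_def by (rule linearI) (simp_all add: inner_add_left scaleR_add_left sum.distrib scaleR_sum_right)
  have \<pi>\<pi>: "\<pi> a \<bullet> \<pi> b = (if a = b then 1 else 0)" if "a \<in> Basis" "b \<in> Basis" for a b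
  proof (cases "a = b")
    case True
    then show ?thesis using C(2)[of "\<pi> b"] bij_betwE[OF \<pi>] that by (auto simp: norm_eq_1)
  next
    case False
    then have "\<pi> a \<noteq> \<pi> b" using \<pi> that by (auto simp: bij_betw_def inj_on_eq_iff)
    then show ?thesis
      using False C(1) bij_betwE[OF \<pi>] that by (auto simp: pairwise_def orthogonal_def)
  qed
  have "T x \<bullet> T y = x \<bullet> y" for x y
  proof -
    have "T x \<bullet> T y = (\<Sum>a\<in>Basis. \<Sum>b\<in>Basis. (x \<bullet> a) * (y \<bullet> b) * (\<pi> a \<bullet> \<pi> b))"
      by (simp add: T_def inner_sum_left inner_sum_right sum_distrib_left mult_ac) (rule sum.swap)
    also have "\<dots> = (\<Sum>a\<in>Basis. \<Sum>b\<in>Basis. if a = b then (x \<bullet> a) * (y \<bullet> b) else 0)"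
      by (intro sum.cong) (auto simp: \<pi>\<pi>)
    also have "\<dots> = (\<Sum>a\<in>Basis. (x \<bullet> a) * (y \<bullet> a))"
      by (simp add: sum.delta)
    also have "\<dots> = x \<bullet> y" by (rule euclidean_inner[symmetric])
    finally show ?thesis .
  qed
  then have orth: "orthogonal_transformation T"
    using lin by (simp add: orthogonal_transformation_def)
  have m\<psi>: "\<psi> \<in> measurable (\<Pi>\<^sub>M c\<in>C. lborel) borel"
  proof -
    have "(\<lambda>f. f (\<pi> b)) \<in> measurable (\<Pi>\<^sub>M c\<in>C. lborel :: real measure) borel" if "b \<in> Basis" for b
      using measurable_component_singleton[of "\<pi> b" C "\<lambda>_. lborel"] bij_betwE[OF \<pi>] that by simp
    then show ?thesis unfolding \<psi>_def by (intro borel_measurable_sum borel_measurable_scaleR) auto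
  qed
  have "lborel = distr (\<Pi>\<^sub>M c\<in>C. lborel) borel \<psi>"
  proof (rule lborel_eqI)
    fix l u :: "real^'n" assume le: "\<And>b. b \<in> Basis \<Longrightarrow> l \<bullet> b \<le> u \<bullet> b"
    define \<rho> where "\<rho> = inv_into Basis \<pi>"
    have \<rho>: "bij_betw \<rho> C Basis" unfolding \<rho>_def by (rule bij_betw_inv_into[OF \<pi>])
    have \<rho>\<pi>: "\<rho> (\<pi> b) = b" if "b \<in> Basis" for b
      unfolding \<rho>_def using \<pi> that by (simp add: bij_betw_inv_into_left)
    have \<psi>b: "\<psi> f \<bullet> b = f (\<pi> b)" if "b \<in> Basis" for f b
      unfolding \<psi>_def using that by (simp add: inner_sum_left inner_Basis if_distrib sum.delta cong: if_cong)
    have "\<psi> -` box l u \<inter> space (\<Pi>\<^sub>M c\<in>C. lborel) = (\<Pi>\<^sub>E c\<in>C. {l \<bullet> \<rho> c <..< u \<bullet> \<rho> c})"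
    proof (rule set_eqI)
      fix f :: "real^'n \<Rightarrow> real"
      have "(\<forall>b\<in>Basis. l \<bullet> b < f (\<pi> b) \<and> f (\<pi> b) < u \<bullet> b) \<longleftrightarrow>
          (\<forall>c\<in>C. l \<bullet> \<rho> c < f c \<and> f c < u \<bullet> \<rho> c)"
      proof -
        have "C = \<pi> ` Basis" using \<pi> by (simp add: bij_betw_def)
        then show ?thesis by (simp add: \<rho>\<pi>)
      qed
      then show "f \<in> \<psi> -` box l u \<inter> space (\<Pi>\<^sub>M c\<in>C. lborel) \<longleftrightarrow> f \<in> (\<Pi>\<^sub>E c\<in>C. {l \<bullet> \<rho> c <..< u \<bullet> \<rho> c})"
        by (auto simp: mem_box \<psi>b space_PiM PiE_iff)
    qed
    then have "emeasure (distr (\<Pi>\<^sub>M c\<in>C. lborel) borel \<psi>) (box l u) =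
        emeasure (\<Pi>\<^sub>M c\<in>C. lborel) (\<Pi>\<^sub>E c\<in>C. {l \<bullet> \<rho> c <..< u \<bullet> \<rho> c})"
      using m\<psi> by (simp add: emeasure_distr)
    also have "\<dots> = (\<Prod>c\<in>C. emeasure lborel {l \<bullet> \<rho> c <..< u \<bullet> \<rho> c})"
      by (rule measure_times) auto
    also have "\<dots> = (\<Prod>c\<in>C. ennreal ((u - l) \<bullet> \<rho> c))"
      using le bij_betwE[OF \<rho>] by (intro prod.cong) (auto simp: inner_diff_left)
    also have "\<dots> = (\<Prod>b\<in>Basis. ennreal ((u - l) \<bullet> b))"
      by (rule prod.reindex_bij_betw[OF \<rho>])
    also have "\<dots> = ennreal (\<Prod>b\<in>Basis. (u - l) \<bullet> b)"
      using le by (intro prod_ennreal) (auto simp: inner_diff_left)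
    finally show "emeasure (distr (\<Pi>\<^sub>M c\<in>C. lborel) borel \<psi>) (box l u) = (\<Prod>b\<in>Basis. (u - l) \<bullet> b)" .
  qed simp
  then have "lborel = distr (distr (\<Pi>\<^sub>M c\<in>C. lborel) borel \<psi>) borel T"
    using lborel_distr_orthogonal[OF orth] by simp
  also have "\<dots> = distr (\<Pi>\<^sub>M c\<in>C. lborel) borel (T \<circ> \<psi>)"
    by (rule distr_distr) (use borel_measurable_linear[OF lin] m\<psi> in auto)
  also have "T \<circ> \<psi> = (\<lambda>f. \<Sum>c\<in>C. f c *\<^sub>R c)"
  proof
    fix f
    have "T (\<psi> f) = (\<Sum>b\<in>Basis. f (\<pi> b) *\<^sub>R T b)"
      unfolding \<psi>_def by (simp add: linear_sum[OF lin] linear_scale[OF lin])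
    also have "\<dots> = (\<Sum>b\<in>Basis. f (\<pi> b) *\<^sub>R \<pi> b)"
    proof (rule sum.cong[OF refl])
      fix b :: "real^'n" assume b: "b \<in> Basis"
      have "T b = (\<Sum>a\<in>Basis. (if b = a then 1 else 0) *\<^sub>R \<pi> a)"
        unfolding T_def using b by (intro sum.cong) (auto simp: inner_Basis)
      also have "\<dots> = (\<Sum>a\<in>Basis. if b = a then \<pi> a else 0)"
        by (intro sum.cong) auto
      finally show "f (\<pi> b) *\<^sub>R T b = f (\<pi> b) *\<^sub>R \<pi> b" using b by simp
    qed
    also have "\<dots> = (\<Sum>c\<in>C. f c *\<^sub>R c)"
      by (rule sum.reindex_bij_betw[OF \<pi>])
    finally show "(T \<circ> \<psi>) f = (\<Sum>c\<in>C. f c *\<^sub>R c)" by simp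
  qed
  finally show ?thesis by simp
qed

lemma in_orthogonal_comp_iff: "x \<in> orthogonal_comp W \<longleftrightarrow> (\<forall>y\<in>W. y \<bullet> x = 0)"
  by (simp add: orthogonal_comp_def orthogonal_def)

text \<open>Whatever orthonormal basis \<open>B\<close> of the complement is chosen,
  \<open>U\<close> extends it to an orthonormal basis of the whole space. In these coordinates the
  cylinder is the product of the projection with a unit cube, whose measure is 1.\<close>

theorem proj_volume_eq_measure_cylinder:
  fixes A :: "(real^'n) set"
  assumes U: "finite U" "pairwise orthogonal U" "\<And>u. u \<in> U \<Longrightarrow> norm u = 1"
    and E: "compact (orth_proj (orthogonal_comp U) ` A)"
      "orth_proj (orthogonal_comp U) ` A \<subseteq> orthogonal_comp U"
  shows "proj_volume (orthogonal_comp U) A =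
    vol (orth_proj (orthogonal_comp U) ` A + (\<Sum>u\<in>U. seg u))"
proof -
  define L where "L = orthogonal_comp U"
  define E where "E = orth_proj L ` A"
  define P where "P B \<longleftrightarrow> pairwise orthogonal B \<and> (\<forall>b\<in>B. norm b = 1) \<and> span B = L" for B
  define B where "B = (SOME B. P B)"
  have "\<exists>B. P B"
    using orthonormal_basis_subspace[OF subspace_orthogonal_comp[of U]] unfolding P_def L_def by metis
  then have "P B" unfolding B_def by (rule someI_ex)
  then have B: "pairwise orthogonal B" "\<And>b. b \<in> B \<Longrightarrow> norm b = 1" "span B = L"
    by (auto simp: P_def)
  have "0 \<notin> B" using B(2) by fastforce
  then have finB: "finite B"
    using pairwise_orthogonal_independent[OF B(1)] independent_bound by blast
  have BL: "b \<in> L" if "b \<in> B" for b using that B(3) span_base by blast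
  have BU: "b \<bullet> u = 0" if "b \<in> B" "u \<in> U" for b u
    using BL[OF that(1)] that(2) unfolding L_def in_orthogonal_comp_iff by (metis inner_commute)
  have disj: "B \<inter> U = {}"
  proof -
    have "False" if "x \<in> B" "x \<in> U" for x
      using BU[OF that] B(2)[OF that(1)] by simp
    then show ?thesis by auto
  qed
  define C where "C = B \<union> U"
  have C: "pairwise orthogonal C" "\<And>c. c \<in> C \<Longrightarrow> norm c = 1" "finite C"
  proof -
    have UB: "u \<bullet> b = 0" if "b \<in> B" "u \<in> U" for b u
      using BU[OF that] by (simp add: inner_commute)
    show "pairwise orthogonal C"
      using B(1) U(2) BU UB by (auto simp: C_def pairwise_def orthogonal_def)
  qed (use B(2) U finB in \<open>auto simp: C_def\<close>)
  \<comment> \<open>A vector orthogonal to \<open>C\<close> lies in the complement of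
    \<open>U\<close>, that is in the span of \<open>B\<close>, and is therefore orthogonal to
    itself.\<close>
  have spanC: "span C = UNIV"
  proof (rule ccontr)
    assume "span C \<noteq> UNIV"
    then obtain a where a: "a \<noteq> 0" "\<And>x. x \<in> span C \<Longrightarrow> a \<bullet> x = 0"
      using span_not_UNIV_orthogonal[OF \<open>span C \<noteq> UNIV\<close>] by auto
    have "y \<bullet> a = 0" if "y \<in> U" for y
      using a(2)[OF span_base, of y] that by (simp add: C_def inner_commute)
    then have "a \<in> span B" by (simp add: B(3) L_def in_orthogonal_comp_iff)
    moreover have "span B \<subseteq> span C" by (rule span_mono) (simp add: C_def)
    ultimately have "a \<in> span C" by blast
    then show False using a(2)[of a] a(1) by simp
  qed
  have "0 \<notin> C" using C(2)[of 0] by auto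
  then have "independent C" using pairwise_orthogonal_independent[OF C(1)] by blast
  then have cardC: "card C = CARD('n)"
    using dim_eq_card[of C UNIV] spanC by (simp add: dim_UNIV)
  interpret product_sigma_finite "\<lambda>_::real^'n. lborel :: real measure" ..
  interpret MB: finite_product_sigma_finite "\<lambda>_::real^'n. lborel :: real measure" B
    by standard (rule finB)
  interpret MU: finite_product_sigma_finite "\<lambda>_::real^'n. lborel :: real measure" U
    by standard (rule U(1))
  let ?MB = "\<Pi>\<^sub>M b\<in>B. lborel :: real measure" and ?MU = "\<Pi>\<^sub>M b\<in>U. lborel :: real measure"
    and ?MC = "\<Pi>\<^sub>M b\<in>C. lborel :: real measure"
  define \<phi> where "\<phi> S f = (\<Sum>b\<in>S. f b *\<^sub>R b)" for S and f :: "real^'n \<Rightarrow> real"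
  have m\<phi>: "\<phi> S \<in> measurable (\<Pi>\<^sub>M b\<in>S. lborel) borel" for S
  proof -
    have "(\<lambda>f. f b) \<in> measurable (\<Pi>\<^sub>M c\<in>S. lborel :: real measure) borel" if "b \<in> S" for b
      using measurable_component_singleton[of b S "\<lambda>_. lborel"] that by simp
    then show ?thesis unfolding \<phi>_def by (intro borel_measurable_sum borel_measurable_scaleR) auto
  qed
  have EL: "E \<subseteq> L" and cE: "compact E" using assms(4,5) by (auto simp: E_def L_def)
  define Z where "Z = E + (\<Sum>u\<in>U. seg u)"
  have cZ: "compact Z" unfolding Z_def by (intro compact_set_plus cE compact_set_sum) auto
  have Ziff: "x \<in> Z \<longleftrightarrow> (\<exists>e\<in>E. \<exists>c. (\<forall>u\<in>U. 0 \<le> c u \<and> c u \<le> 1) \<and> x = e + (\<Sum>u\<in>U. c u *\<^sub>R u))" for x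
  proof -
    have seg: "y \<in> (\<Sum>u\<in>U. seg u) \<longleftrightarrow>
        (\<exists>c. (\<forall>u\<in>U. 0 \<le> c u \<and> c u \<le> 1) \<and> y = (\<Sum>u\<in>U. c u *\<^sub>R u))" for y
    proof
      assume "y \<in> (\<Sum>u\<in>U. seg u)"
      then obtain s where s: "y = sum s U" "\<forall>u\<in>U. s u \<in> seg u"
        using set_sum_alt[OF U(1), of "\<lambda>u. seg u"] by auto
      then have "\<forall>u\<in>U. \<exists>c. 0 \<le> c \<and> c \<le> 1 \<and> s u = c *\<^sub>R u" by (auto simp: in_segment)
      then obtain c where "\<forall>u\<in>U. 0 \<le> c u \<and> c u \<le> 1 \<and> s u = c u *\<^sub>R u" by metis
      then show "\<exists>c. (\<forall>u\<in>U. 0 \<le> c u \<and> c u \<le> 1) \<and> y = (\<Sum>u\<in>U. c u *\<^sub>R u)"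
        using s(1) by (intro exI[of _ c]) auto
    next
      assume "\<exists>c. (\<forall>u\<in>U. 0 \<le> c u \<and> c u \<le> 1) \<and> y = (\<Sum>u\<in>U. c u *\<^sub>R u)"
      then obtain c where "\<forall>u\<in>U. 0 \<le> c u \<and> c u \<le> 1" "y = (\<Sum>u\<in>U. c u *\<^sub>R u)" by blast
      then show "y \<in> (\<Sum>u\<in>U. seg u)"
        unfolding set_sum_alt[OF U(1)]
        by (auto simp: in_segment intro!: exI[of _ "\<lambda>u. c u *\<^sub>R u"])
    qed
    show ?thesis
    proof
      assume "x \<in> Z"
      then obtain e y where ey: "e \<in> E" "y \<in> (\<Sum>u\<in>U. seg u)" "x = e + y"
        unfolding Z_def by (auto elim: set_plus_elim)
      then obtain c where "\<forall>u\<in>U. 0 \<le> c u \<and> c u \<le> 1" "y = (\<Sum>u\<in>U. c u *\<^sub>R u)" using seg by auto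
      with ey show "\<exists>e\<in>E. \<exists>c. (\<forall>u\<in>U. 0 \<le> c u \<and> c u \<le> 1) \<and> x = e + (\<Sum>u\<in>U. c u *\<^sub>R u)"
        by (intro bexI[of _ e] exI[of _ c]) simp_all
    next
      assume "\<exists>e\<in>E. \<exists>c. (\<forall>u\<in>U. 0 \<le> c u \<and> c u \<le> 1) \<and> x = e + (\<Sum>u\<in>U. c u *\<^sub>R u)"
      then obtain e c where ec: "e \<in> E" "\<forall>u\<in>U. 0 \<le> c u \<and> c u \<le> 1" "x = e + (\<Sum>u\<in>U. c u *\<^sub>R u)"
        by auto
      then have "(\<Sum>u\<in>U. c u *\<^sub>R u) \<in> (\<Sum>u\<in>U. seg u)" using seg by auto
      with ec show "x \<in> Z" unfolding Z_def by (simp add: set_plus_intro)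
    qed
  qed
  \<comment> \<open>Inner products with \<open>v\<close> recover the \<open>U\<close>-coordinates,
    so the decomposition used in \<open>key\<close> is unique.\<close>
  have inner_U: "(e + (\<Sum>u\<in>U. c u *\<^sub>R u)) \<bullet> v = c v" if "e \<in> L" "v \<in> U" for e c v
  proof -
    have "e \<bullet> v = 0" using that unfolding L_def in_orthogonal_comp_iff by (metis inner_commute)
    moreover have "(\<Sum>u\<in>U. c u *\<^sub>R u) \<bullet> v = (\<Sum>u\<in>U. if u = v then c u else 0)"
      unfolding inner_sum_left
      by (rule sum.cong) (use U that in \<open>auto simp: pairwise_def orthogonal_def norm_eq_1\<close>)
    ultimately show ?thesis using that U(1) by (simp add: inner_add_left)
  qed
  have key: "\<phi> C (merge B U (f, g)) \<in> Z \<longleftrightarrow> \<phi> B f \<in> E \<and> (\<forall>u\<in>U. 0 \<le> g u \<and> g u \<le> 1)" for f g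
  proof -
    have "(\<Sum>b\<in>B. merge B U (f, g) b *\<^sub>R b) = (\<Sum>b\<in>B. f b *\<^sub>R b)"
      "(\<Sum>u\<in>U. merge B U (f, g) u *\<^sub>R u) = (\<Sum>u\<in>U. g u *\<^sub>R u)"
      using disj by (auto intro!: sum.cong simp: merge_def)
    then have eq: "\<phi> C (merge B U (f, g)) = \<phi> B f + (\<Sum>u\<in>U. g u *\<^sub>R u)"
      unfolding \<phi>_def C_def using disj finB U(1) by (simp add: sum.union_disjoint)
    have fL: "\<phi> B f \<in> L"
      unfolding \<phi>_def B(3)[symmetric] by (intro span_sum span_scale span_base)
    show ?thesis
    proof
      assume "\<phi> C (merge B U (f, g)) \<in> Z"
      then obtain e c where ec: "e \<in> E" "\<forall>u\<in>U. 0 \<le> c u \<and> c u \<le> 1"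
        "\<phi> B f + (\<Sum>u\<in>U. g u *\<^sub>R u) = e + (\<Sum>u\<in>U. c u *\<^sub>R u)"
        unfolding Ziff eq by blast
      have gc: "g v = c v" if "v \<in> U" for v
        using inner_U[OF fL that, of g] inner_U[of e v c] ec EL that by auto
      then have "(\<Sum>u\<in>U. g u *\<^sub>R u) = (\<Sum>u\<in>U. c u *\<^sub>R u)" by simp
      then have "\<phi> B f = e" using ec(3) by simp
      then show "\<phi> B f \<in> E \<and> (\<forall>u\<in>U. 0 \<le> g u \<and> g u \<le> 1)" using ec gc by auto
    next
      assume "\<phi> B f \<in> E \<and> (\<forall>u\<in>U. 0 \<le> g u \<and> g u \<le> 1)"
      then show "\<phi> C (merge B U (f, g)) \<in> Z" unfolding Ziff eq by blast
    qed
  qed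
  have bZ: "Z \<in> sets borel" and bE: "E \<in> sets borel" using cZ cE by (auto intro: borel_compact)
  define X where "X = \<phi> B -` E \<inter> space ?MB"
  have X: "X \<in> sets ?MB" unfolding X_def using m\<phi> bE by (rule measurable_sets)
  have "emeasure lborel Z = emeasure (distr ?MC borel (\<phi> C)) Z"
    using lborel_eq_distr_orthonormal[OF C cardC] by (simp add: \<phi>_def[abs_def])
  also have "\<dots> = emeasure ?MC (\<phi> C -` Z \<inter> space ?MC)"
    by (rule emeasure_distr[OF m\<phi> bZ])
  also have "\<dots> = emeasure (distr (?MB \<Otimes>\<^sub>M ?MU) ?MC (merge B U)) (\<phi> C -` Z \<inter> space ?MC)"
    using distr_merge[OF disj finB U(1)] by (simp add: C_def)
  also have "\<dots> = emeasure (?MB \<Otimes>\<^sub>M ?MU)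
      (merge B U -` (\<phi> C -` Z \<inter> space ?MC) \<inter> space (?MB \<Otimes>\<^sub>M ?MU))"
    using measurable_merge[of B U "\<lambda>_. lborel :: real measure"]
    by (intro emeasure_distr measurable_sets[OF m\<phi> bZ]) (simp add: C_def)
  also have "merge B U -` (\<phi> C -` Z \<inter> space ?MC) \<inter> space (?MB \<Otimes>\<^sub>M ?MU) = X \<times> (\<Pi>\<^sub>E u\<in>U. {0..1})"
  proof -
    have "merge B U (f, g) \<in> space ?MC" for f g by (auto simp: C_def space_PiM merge_def PiE_iff extensional_def)
    then show ?thesis
      by (auto simp: key X_def space_pair_measure space_PiM PiE_iff)
  qed
  also have "emeasure (?MB \<Otimes>\<^sub>M ?MU) (X \<times> (\<Pi>\<^sub>E u\<in>U. {0..1})) =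
      emeasure ?MB X * emeasure ?MU (\<Pi>\<^sub>E u\<in>U. {0..1})"
    using X by (intro MU.emeasure_pair_measure_Times) (auto intro!: sets_PiM_I_finite U(1))
  also have "emeasure ?MU (\<Pi>\<^sub>E u\<in>U. {0..1}) = 1"
    by (subst MU.measure_times) auto
  finally have "emeasure lborel Z = emeasure ?MB X" by simp
  moreover have "lborel_subspace L = distr ?MB borel (\<phi> B)"
    by (simp add: lborel_subspace_def B_def P_def[abs_def] \<phi>_def[abs_def] Let_def)
  then have "emeasure (lborel_subspace L) E = emeasure ?MB X"
    unfolding X_def using emeasure_distr[OF m\<phi> bE] by simp
  ultimately have "emeasure (lborel_subspace L) E = emeasure lborel Z" by simp
  then have "proj_volume L A = measure lborel Z"
    by (simp add: proj_volume_def E_def measure_def)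
  then show ?thesis using bZ by (simp add: Z_def E_def L_def)
qed

section \<open>Projections along coordinate axes\<close>

lemma orth_proj_eqI:
  assumes "subspace L" "y \<in> L" "x - y \<in> orthogonal_comp L"
  shows "orth_proj L x = y"
  unfolding orth_proj_def
proof (rule the_equality)
  fix z assume z: "z \<in> L \<and> x - z \<in> orthogonal_comp L"
  have "z - y \<in> L" using assms z by (simp add: subspace_diff)
  then have "(z - y) \<bullet> (x - y) = 0" "(z - y) \<bullet> (x - z) = 0"
    using assms z by (auto simp: in_orthogonal_comp_iff)
  then have "(z - y) \<bullet> (z - y) = 0" by (simp add: inner_diff_right)
  then show "z = y" by simp
qed (use assms in auto)

lemma orth_proj_axis: "orth_proj (orthogonal_comp {axis k 1 :: real^'n}) = drop_coord k"
proof
  fix x :: "real^'n"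
  show "orth_proj (orthogonal_comp {axis k 1}) x = drop_coord k x"
    by (rule orth_proj_eqI[OF subspace_orthogonal_comp])
      (auto simp: in_orthogonal_comp_iff inner_axis' inner_axis drop_coord_eq inner_diff_right
        inner_axis_axis inner_commute)
qed

lemma orth_proj_axis2:
  fixes i j :: "'n::finite"
  assumes "i \<noteq> j"
  shows "orth_proj (orthogonal_comp {axis i 1, axis j 1 :: real^'n}) = drop_coord i \<circ> drop_coord j"
proof
  fix x :: "real^'n"
  have "x - drop_coord i (drop_coord j x) = x $ i *\<^sub>R axis i 1 + x $ j *\<^sub>R axis j 1"
    using assms by (auto simp: vec_eq_iff axis_def)
  then show "orth_proj (orthogonal_comp {axis i 1, axis j 1}) x = (drop_coord i \<circ> drop_coord j) x"
    by (intro orth_proj_eqI[OF subspace_orthogonal_comp])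
      (auto simp: in_orthogonal_comp_iff inner_axis' inner_axis inner_add_right)
qed

lemma proj_volume_axis:
  fixes A :: "(real^'n) set"
  assumes "compact A"
  shows "proj_volume (orthogonal_comp {axis k 1}) A =
    vol (drop_coord k ` A + seg (axis k 1))"
proof -
  have "drop_coord k ` A \<subseteq> orthogonal_comp {axis k 1}"
    by (auto simp: in_orthogonal_comp_iff inner_axis')
  then show ?thesis
    using proj_volume_eq_measure_cylinder[of "{axis k 1}" A] assms
    by (simp add: orth_proj_axis compact_linear_image linear_drop_coord)
qed

lemma proj_volume_axis2:
  fixes A :: "(real^'n) set"
  assumes "compact A" "i \<noteq> j"
  shows "proj_volume (orthogonal_comp (span {axis i 1, axis j 1})) A =
    vol (drop_coord i ` drop_coord j ` A + seg (axis i 1) + seg (axis j 1))"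
proof -
  let ?U = "{axis i 1, axis j 1} :: (real^'n) set"
  have ne: "axis i (1::real) \<noteq> axis j 1" using assms by (simp add: axis_eq_axis)
  have span: "orthogonal_comp (span ?U) = orthogonal_comp ?U"
  proof
    show "orthogonal_comp (span ?U) \<subseteq> orthogonal_comp ?U"
      by (rule orthogonal_comp_anti_mono[OF span_superset])
    show "orthogonal_comp ?U \<subseteq> orthogonal_comp (span ?U)"
    proof
      fix x assume "x \<in> orthogonal_comp ?U"
      then have "orthogonal x y" if "y \<in> ?U" for y
        using that by (auto simp: in_orthogonal_comp_iff orthogonal_def inner_commute)
      then show "x \<in> orthogonal_comp (span ?U)"
        using orthogonal_to_span[of _ ?U x] by (auto simp: orthogonal_comp_def orthogonal_commute)
    qed
  qed
  have "proj_volume (orthogonal_comp ?U) A =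
    vol (orth_proj (orthogonal_comp ?U) ` A + (\<Sum>u\<in>?U. seg u))"
  proof (rule proj_volume_eq_measure_cylinder)
    show "pairwise orthogonal ?U"
      using assms by (auto simp: pairwise_def orthogonal_def inner_axis_axis)
    show "compact (orth_proj (orthogonal_comp ?U) ` A)"
      using assms unfolding orth_proj_axis2[OF assms(2)] image_comp[symmetric]
      by (intro compact_linear_image linear_drop_coord)
    show "orth_proj (orthogonal_comp ?U) ` A \<subseteq> orthogonal_comp ?U"
      unfolding orth_proj_axis2[OF assms(2)] by (auto simp: in_orthogonal_comp_iff inner_axis')
  qed auto
  then show ?thesis
    using ne by (simp add: span orth_proj_axis2[OF assms(2)] image_image add.assoc)
qed

section \<open>Hausdorff measure\<close>

abbreviation (input) "hmeasure \<equiv> hausdorff_measure"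

definition hweight :: "nat \<Rightarrow> 'a::euclidean_space set \<Rightarrow> ennreal" where
  "hweight k S = ennreal (unit_ball_vol (real k) * (diameter S / 2) ^ k)"

definition hcovers :: "real \<Rightarrow> 'a::euclidean_space set \<Rightarrow> (nat \<Rightarrow> 'a set) set" where
  "hcovers \<delta> S = {C. S \<subseteq> (\<Union>i. C i) \<and> (\<forall>i. bounded (C i) \<and> diameter (C i) \<le> \<delta>)}"

text \<open>The Hausdorff premeasure at scale \<open>\<delta>\<close>. It does not increase with
  \<open>\<delta>\<close>, so the supremum over all scales is the limit for \<open>\<delta>\<close>
  tending to 0.\<close>

definition hpre :: "nat \<Rightarrow> real \<Rightarrow> 'a::euclidean_space set \<Rightarrow> ennreal" where
  "hpre k \<delta> S = (INF C\<in>hcovers \<delta> S. \<Sum>i. hweight k (C i))"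

lemma hmeasure_eq_SUP: "hmeasure k S = (SUP \<delta>\<in>{0<..}. hpre k \<delta> S)"
  by (simp add: hausdorff_measure_def hpre_def hcovers_def hweight_def)

lemma hpre_le_cover:
  "C \<in> hcovers \<delta> S \<Longrightarrow> hpre k \<delta> S \<le> (\<Sum>i. hweight k (C i))"
  unfolding hpre_def by (rule INF_lower)

lemma hpre_greatest:
  "(\<And>C. C \<in> hcovers \<delta> S \<Longrightarrow> x \<le> (\<Sum>i. hweight k (C i))) \<Longrightarrow> x \<le> hpre k \<delta> S"
  unfolding hpre_def by (rule INF_greatest)

lemma hpre_le: "0 < \<delta> \<Longrightarrow> hpre k \<delta> S \<le> hmeasure k S"
  unfolding hmeasure_eq_SUP by (rule SUP_upper) simp

lemma hmeasure_least:
  "(\<And>\<delta>. 0 < \<delta> \<Longrightarrow> hpre k \<delta> S \<le> x) \<Longrightarrow> hmeasure k S \<le> x"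
  unfolding hmeasure_eq_SUP by (rule SUP_least) simp

lemma hpre_mono:
  assumes "S \<subseteq> T" "\<delta> \<le> \<epsilon>" shows "hpre k \<epsilon> S \<le> hpre k \<delta> T"
proof (rule hpre_greatest)
  fix C assume C: "C \<in> hcovers \<delta> T"
  have "diameter (C i) \<le> \<epsilon>" for i
  proof -
    have "diameter (C i) \<le> \<delta>" using C by (simp add: hcovers_def)
    then show ?thesis using assms(2) by simp
  qed
  moreover have "S \<subseteq> (\<Union>i. C i)" "\<And>i. bounded (C i)"
    using C assms(1) by (auto simp: hcovers_def)
  ultimately have "C \<in> hcovers \<epsilon> S"
    by (simp add: hcovers_def)
  then show "hpre k \<epsilon> S \<le> (\<Sum>i. hweight k (C i))"
    by (rule hpre_le_cover)
qed

lemma hmeasure_mono: "S \<subseteq> T \<Longrightarrow> hmeasure k S \<le> hmeasure k T"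
  by (meson hmeasure_least hpre_le hpre_mono order_refl order_trans)

lemma hweight_empty: "0 < k \<Longrightarrow> hweight k {} = 0"
  by (simp add: hweight_def)

lemma hpre_empty:
  assumes "0 < k" "0 < \<delta>"
  shows "hpre k \<delta> {} = 0"
proof -
  have "(\<lambda>_::nat. {}) \<in> hcovers \<delta> {}" using assms by (simp add: hcovers_def)
  from hpre_le_cover[OF this, of k] show ?thesis
    using assms by (simp add: hweight_empty)
qed

lemma hmeasure_empty: "0 < k \<Longrightarrow> hmeasure k {} = 0"
  using hmeasure_least[of k "{}" 0] hpre_empty by (metis le_zero_eq order_refl)

lemma hpre_le_weight:
  assumes "0 < k" "0 < \<delta>" "bounded S" "diameter S \<le> \<delta>"
  shows "hpre k \<delta> S \<le> hweight k S"
proof -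
  define C where "C n = (if n = 0 then S else {})" for n :: nat
  have "C \<in> hcovers \<delta> S"
    using assms by (auto simp: hcovers_def C_def)
  from hpre_le_cover[OF this, of k]
  have "hpre k \<delta> S \<le> (\<Sum>n. hweight k (C n))" .
  also have "\<dots> = (\<Sum>n\<in>{0}. hweight k (C n))"
    using assms(1) by (intro suminf_finite) (auto simp: C_def hweight_empty)
  finally show ?thesis by (simp add: C_def)
qed

text \<open>Lets two countable covers be interleaved into one; partial sums of even length split
  exactly.\<close>

lemma suminf_interleave_le:
  fixes f g :: "nat \<Rightarrow> ennreal"
  shows "(\<Sum>n. if even n then f (n div 2) else g (n div 2)) \<le> (\<Sum>n. f n) + (\<Sum>n. g n)"
proof (rule suminf_le_const)
  let ?h = "\<lambda>n. if even n then f (n div 2) else g (n div 2)"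
  have two: "(\<Sum>n<2*N. ?h n) = (\<Sum>n<N. f n) + (\<Sum>n<N. g n)" for N
    by (induction N) (simp_all add: ac_simps)
  fix N
  have "(\<Sum>n<N. ?h n) \<le> (\<Sum>n<2*N. ?h n)"
    by (rule sum_mono2) auto
  also have "\<dots> \<le> (\<Sum>n. f n) + (\<Sum>n. g n)"
    unfolding two by (intro add_mono sum_le_suminf) auto
  finally show "(\<Sum>n<N. ?h n) \<le> (\<Sum>n. f n) + (\<Sum>n. g n)" .
qed simp

lemma ennreal_add_INF_greatest:
  fixes g :: "'b \<Rightarrow> ennreal"
  assumes "\<And>j. j \<in> J \<Longrightarrow> x \<le> c + g j"
  shows "x \<le> c + (INF j\<in>J. g j)"
proof (cases "c = top")
  case False
  have "x - c \<le> g j" if "j \<in> J" for j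
    using assms[OF that] False by (simp add: ennreal_minus_le_iff)
  then have "x - c \<le> (INF j\<in>J. g j)" by (rule INF_greatest)
  then show ?thesis using False by (simp add: ennreal_minus_le_iff)
qed simp

lemma ennreal_INF_add_INF_greatest:
  fixes f :: "'b \<Rightarrow> ennreal"
  assumes "\<And>i j. i \<in> I \<Longrightarrow> j \<in> J \<Longrightarrow> x \<le> f i + g j"
  shows "x \<le> (INF i\<in>I. f i) + (INF j\<in>J. g j)"
  using assms by (metis (no_types, lifting) add.commute ennreal_add_INF_greatest)

lemma hpre_Un: "hpre k \<delta> (S \<union> T) \<le> hpre k \<delta> S + hpre k \<delta> T"
  unfolding hpre_def[of k \<delta> S] hpre_def[of k \<delta> T]
proof (rule ennreal_INF_add_INF_greatest)
  fix C D assume C: "C \<in> hcovers \<delta> S" and D: "D \<in> hcovers \<delta> T"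
  define E where "E n = (if even n then C (n div 2) else D (n div 2))" for n
  have "C i = E (2 * i)" "D i = E (Suc (2 * i))" for i by (simp_all add: E_def)
  then have "(\<Union>i. C i) \<subseteq> (\<Union>i. E i)" "(\<Union>i. D i) \<subseteq> (\<Union>i. E i)" by (metis UN_least UN_upper UNIV_I)+
  moreover have "S \<subseteq> (\<Union>i. C i)" "T \<subseteq> (\<Union>i. D i)"
    using C D by (auto simp: hcovers_def)
  ultimately have "S \<union> T \<subseteq> (\<Union>i. E i)" by (meson Un_least subset_trans)
  moreover have "bounded (E i) \<and> diameter (E i) \<le> \<delta>" for i
    using C D by (simp add: hcovers_def E_def)
  ultimately have "E \<in> hcovers \<delta> (S \<union> T)"
    by (simp add: hcovers_def)
  then have "hpre k \<delta> (S \<union> T) \<le> (\<Sum>i. hweight k (E i))"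
    by (rule hpre_le_cover)
  also have "(\<lambda>i. hweight k (E i)) =
      (\<lambda>i. if even i then hweight k (C (i div 2)) else hweight k (D (i div 2)))"
    by (auto simp: E_def)
  also have "suminf \<dots> \<le> (\<Sum>i. hweight k (C i)) + (\<Sum>i. hweight k (D i))"
    by (rule suminf_interleave_le)
  finally show "hpre k \<delta> (S \<union> T) \<le> (\<Sum>i. hweight k (C i)) + (\<Sum>i. hweight k (D i))" .
qed

lemma hpre_UN:
  assumes "finite I" "0 < k" "0 < \<delta>"
  shows "hpre k \<delta> (\<Union>i\<in>I. S i) \<le> (\<Sum>i\<in>I. hpre k \<delta> (S i))"
  using assms(1)
proof induction
  case (insert i I)
  have "hpre k \<delta> (\<Union>i\<in>insert i I. S i) \<le> hpre k \<delta> (S i) + hpre k \<delta> (\<Union>i\<in>I. S i)"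
    using hpre_Un[of k \<delta> "S i" "\<Union>i\<in>I. S i"] by simp
  also have "\<dots> \<le> hpre k \<delta> (S i) + (\<Sum>i\<in>I. hpre k \<delta> (S i))"
    using insert.IH by (rule add_left_mono)
  finally show ?case using insert.hyps by simp
qed (simp add: hpre_empty assms)

lemma hmeasure_UN:
  assumes "finite I" "0 < k"
  shows "hmeasure k (\<Union>i\<in>I. S i) \<le> (\<Sum>i\<in>I. hmeasure k (S i))"
proof (rule hmeasure_least)
  fix \<delta> :: real assume "0 < \<delta>"
  then show "hpre k \<delta> (\<Union>i\<in>I. S i) \<le> (\<Sum>i\<in>I. hmeasure k (S i))"
    using hpre_UN[OF assms, of \<delta> S] by (meson hpre_le order_trans sum_mono)
qed

lemma hmeasure_Un: "hmeasure k (S \<union> T) \<le> hmeasure k S + hmeasure k T"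
proof (rule hmeasure_least)
  fix \<delta> :: real assume "0 < \<delta>"
  then show "hpre k \<delta> (S \<union> T) \<le> hmeasure k S + hmeasure k T"
    using hpre_Un[of k \<delta> S T] by (meson hpre_le order_trans add_mono)
qed

text \<open>A set of diameter at most \<open>\<delta>\<close> cannot meet both \<open>S\<close> and
  \<open>T\<close>, so every cover of the union splits into covers of the two parts. Discarded
  members become empty, which has weight 0 because \<open>k\<close> is positive.\<close>

lemma hpre_Un_separated:
  assumes "0 < k" "\<delta> < \<eta>" and sep: "\<And>x y. x \<in> S \<Longrightarrow> y \<in> T \<Longrightarrow> \<eta> \<le> dist x y"
  shows "hpre k \<delta> S + hpre k \<delta> T \<le> hpre k \<delta> (S \<union> T)"
proof (rule hpre_greatest)
  fix C assume C: "C \<in> hcovers \<delta> (S \<union> T)"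
  define D where "D i = (if C i \<inter> S = {} then {} else C i)" for i
  define E where "E i = (if C i \<inter> S = {} then C i else {})" for i
  have C': "S \<union> T \<subseteq> (\<Union>i. C i)" "\<And>i. bounded (C i)" "\<And>i. diameter (C i) \<le> \<delta>"
    using C by (auto simp: hcovers_def)
  have \<delta>: "0 \<le> \<delta>" using C'(3)[of 0] diameter_ge_0[OF C'(2)[of 0]] by simp
  have D: "D \<in> hcovers \<delta> S"
    using C' \<delta> unfolding hcovers_def D_def by fastforce
  have "T \<subseteq> (\<Union>i. E i)"
  proof
    fix t assume t: "t \<in> T"
    then obtain i where i: "t \<in> C i" using C'(1) by auto
    have "C i \<inter> S = {}"
    proof (rule ccontr)
      assume "C i \<inter> S \<noteq> {}"
      then obtain s where s: "s \<in> C i" "s \<in> S" by auto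
      then have "dist s t \<le> diameter (C i)"
        using diameter_bounded_bound[OF C'(2)] i by auto
      then show False using sep[OF s(2) t] C'(3)[of i] assms(2) by simp
    qed
    then show "t \<in> (\<Union>i. E i)" using i by (auto simp: E_def intro!: exI[of _ i])
  qed
  then have E: "E \<in> hcovers \<delta> T"
    using C' \<delta> unfolding hcovers_def E_def by auto
  have "hpre k \<delta> S + hpre k \<delta> T \<le>
      (\<Sum>i. hweight k (D i)) + (\<Sum>i. hweight k (E i))"
    by (intro add_mono hpre_le_cover D E)
  also have "\<dots> = (\<Sum>i. hweight k (D i) + hweight k (E i))"
    by (rule suminf_add) auto
  also have "\<dots> = (\<Sum>i. hweight k (C i))"
    by (rule suminf_cong) (simp add: D_def E_def hweight_empty assms(1))
  finally show "hpre k \<delta> S + hpre k \<delta> T \<le> (\<Sum>i. hweight k (C i))" .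
qed

text \<open>Only scales below the gap \<open>\<eta>\<close> matter in the supremum, and there covers
  split. This is the additivity of a metric outer measure on sets at positive distance.\<close>

lemma hmeasure_Un_separated:
  assumes "0 < k" "0 < \<eta>" and sep: "\<And>x y. x \<in> S \<Longrightarrow> y \<in> T \<Longrightarrow> \<eta> \<le> dist x y"
  shows "hmeasure k S + hmeasure k T \<le> hmeasure k (S \<union> T)"
proof -
  have "hmeasure k S + hmeasure k T =
      (SUP \<delta>\<in>{0<..}. hpre k \<delta> S + hpre k \<delta> T)"
    unfolding hmeasure_eq_SUP
  proof (rule SUP_add_directed_ennreal[symmetric])
    fix i j :: real assume "i \<in> {0<..}" "j \<in> {0<..}"
    then show "\<exists>l\<in>{0<..}. hpre k i S + hpre k j T \<le> hpre k l S + hpre k l T"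
      by (intro bexI[of _ "min i j"] add_mono hpre_mono) auto
  qed
  also have "\<dots> \<le> hmeasure k (S \<union> T)"
  proof (rule SUP_least)
    fix \<delta> :: real assume \<delta>: "\<delta> \<in> {0<..}"
    let ?m = "min \<delta> (\<eta> / 2)"
    have "hpre k \<delta> S + hpre k \<delta> T \<le> hpre k ?m S + hpre k ?m T"
      by (intro add_mono hpre_mono) auto
    also have "\<dots> \<le> hpre k ?m (S \<union> T)"
      by (rule hpre_Un_separated[OF assms(1) _ sep]) (use assms(2) in auto)
    also have "\<dots> \<le> hmeasure k (S \<union> T)"
      using \<delta> assms(2) by (intro hpre_le) auto
    finally show "hpre k \<delta> S + hpre k \<delta> T \<le> hmeasure k (S \<union> T)" .
  qed
  finally show ?thesis .
qed

lemma hmeasure_UN_separated: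
  assumes "finite I" "0 < k" "0 < \<eta>"
    and sep: "\<And>i j x y. i \<in> I \<Longrightarrow> j \<in> I \<Longrightarrow> i \<noteq> j \<Longrightarrow> x \<in> S i \<Longrightarrow> y \<in> S j \<Longrightarrow> \<eta> \<le> dist x y"
  shows "(\<Sum>i\<in>I. hmeasure k (S i)) \<le> hmeasure k (\<Union>i\<in>I. S i)"
  using assms(1) sep
proof (induction I)
  case (insert i I)
  have "(\<Sum>i\<in>I. hmeasure k (S i)) \<le> hmeasure k (\<Union>i\<in>I. S i)"
    by (rule insert.IH) (use insert.prems in blast)
  then have "(\<Sum>i\<in>insert i I. hmeasure k (S i)) \<le> hmeasure k (S i) + hmeasure k (\<Union>i\<in>I. S i)"
    using insert.hyps by (simp add: add_left_mono del: ennreal_add_left_cancel_le)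
  also have "\<dots> \<le> hmeasure k (S i \<union> (\<Union>i\<in>I. S i))"
    by (rule hmeasure_Un_separated[OF assms(2,3)]) (use insert in auto)
  finally show ?case by simp
qed (simp add: hmeasure_empty assms)

lemma hmeasure_lipschitz_image:
  fixes f :: "'a::euclidean_space \<Rightarrow> 'b::euclidean_space"
  assumes M: "0 < M" and lip: "\<And>x y. x \<in> S \<Longrightarrow> y \<in> S \<Longrightarrow> dist (f x) (f y) \<le> M * dist x y"
  shows "hmeasure k (f ` S) \<le> ennreal (M ^ k) * hmeasure k S"
proof (rule hmeasure_least)
  fix \<delta> :: real assume \<delta>: "0 < \<delta>"
  define \<epsilon> where "\<epsilon> = \<delta> / M"
  have \<epsilon>: "0 < \<epsilon>" "M * \<epsilon> = \<delta>" using M \<delta> by (auto simp: \<epsilon>_def)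
  have M0: "ennreal (M ^ k) \<noteq> 0" "ennreal (M ^ k) \<noteq> top" using M by (auto simp: ennreal_eq_0_iff not_le)
  \<comment> \<open>With the factor divided off, the infimum over the covers of \<open>S\<close> can
    be bounded cover by cover.\<close>
  have "hpre k \<delta> (f ` S) / ennreal (M ^ k) \<le> hpre k \<epsilon> S"
  proof (rule hpre_greatest)
    fix C assume C: "C \<in> hcovers \<epsilon> S"
    then have C': "S \<subseteq> (\<Union>i. C i)" "\<And>i. bounded (C i)" "\<And>i. diameter (C i) \<le> \<epsilon>"
      by (auto simp: hcovers_def)
    \<comment> \<open>The map \<open>f\<close> is controlled only on \<open>S\<close>, so members
      are cut down to \<open>S\<close> before being mapped.\<close>
    define D where "D i = f ` (C i \<inter> S)" for i
    have dist_D: "dist x y \<le> M * diameter (C i)" if "x \<in> D i" "y \<in> D i" for x y i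
    proof -
      obtain a where a: "a \<in> C i" "a \<in> S" "x = f a" using \<open>x \<in> D i\<close> by (auto simp: D_def)
      obtain b where b: "b \<in> C i" "b \<in> S" "y = f b" using \<open>y \<in> D i\<close> by (auto simp: D_def)
      note ab = a b
      have "dist x y \<le> M * dist a b" using ab lip by simp
      also have "\<dots> \<le> M * diameter (C i)"
        using M ab diameter_bounded_bound[OF C'(2)] by (intro mult_left_mono) auto
      finally show ?thesis .
    qed
    have nn: "0 \<le> M * diameter (C i)" for i
      using M diameter_ge_0[OF C'(2)] by simp
    have diam: "diameter (D i) \<le> M * diameter (C i)" for i
      by (rule diameter_le) (use nn dist_D in \<open>auto simp: dist_norm\<close>)
    have bdd: "bounded (D i)" for i
      unfolding bounded_def
    proof (cases "D i = {}")
      case False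
      then obtain x where "x \<in> D i" by auto
      then show "\<exists>x e. \<forall>y\<in>D i. dist x y \<le> e" using dist_D by blast
    qed auto
    have "D \<in> hcovers \<delta> (f ` S)"
    proof -
      have "diameter (D i) \<le> \<delta>" for i
        using diam[of i] mult_left_mono[OF C'(3)[of i], of M] M \<epsilon>(2) by simp
      moreover have "f ` S \<subseteq> (\<Union>i. D i)" using C'(1) by (force simp: D_def)
      ultimately show ?thesis using bdd by (simp add: hcovers_def)
    qed
    then have "hpre k \<delta> (f ` S) \<le> (\<Sum>i. hweight k (D i))"
      by (rule hpre_le_cover)
    also have "\<dots> \<le> (\<Sum>i. ennreal (M ^ k) * hweight k (C i))"
    proof (intro suminf_le)
      fix i
      have "(diameter (D i) / 2) ^ k \<le> (M * (diameter (C i) / 2)) ^ k"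
        using diam[of i] diameter_ge_0[OF bdd] by (intro power_mono) auto
      then have "unit_ball_vol (real k) * (diameter (D i) / 2) ^ k \<le>
          M ^ k * (unit_ball_vol (real k) * (diameter (C i) / 2) ^ k)"
        using mult_left_mono[of "(diameter (D i) / 2) ^ k" "M ^ k * (diameter (C i) / 2) ^ k" "unit_ball_vol (real k)"]
        by (simp only: power_mult_distrib) (simp add: mult_ac)
      then have "hweight k (D i) \<le> ennreal (M ^ k * (unit_ball_vol (real k) * (diameter (C i) / 2) ^ k))"
        unfolding hweight_def by (rule ennreal_leI)
      then show "hweight k (D i) \<le> ennreal (M ^ k) * hweight k (C i)"
        using M diameter_ge_0[OF C'(2), of i] by (simp add: hweight_def ennreal_mult)
    qed auto
    also have "\<dots> = ennreal (M ^ k) * (\<Sum>i. hweight k (C i))" by simp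
    finally show "hpre k \<delta> (f ` S) / ennreal (M ^ k) \<le> (\<Sum>i. hweight k (C i))"
      using M0 by (intro divide_le_posI_ennreal) (auto simp: mult.commute zero_less_iff_neq_zero)
  qed
  also have "\<dots> \<le> hmeasure k S" using \<epsilon>(1) by (rule hpre_le)
  finally have "ennreal (M ^ k) * (hpre k \<delta> (f ` S) / ennreal (M ^ k)) \<le>
      ennreal (M ^ k) * hmeasure k S"
    by (rule mult_left_mono) simp
  then show "hpre k \<delta> (f ` S) \<le> ennreal (M ^ k) * hmeasure k S"
    using M0 ennreal_mult_divide_eq[of "ennreal (M ^ k)" "hpre k \<delta> (f ` S)"]
    by (simp only: ennreal_times_divide mult.commute[of "ennreal (M ^ k)" "hpre k \<delta> (f ` S)"]) auto
qed

lemma hmeasure_contraction: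
  fixes f :: "'a::euclidean_space \<Rightarrow> 'b::euclidean_space"
  assumes "\<And>x y. x \<in> S \<Longrightarrow> y \<in> S \<Longrightarrow> dist (f x) (f y) \<le> dist x y"
  shows "hmeasure k (f ` S) \<le> hmeasure k S"
  using hmeasure_lipschitz_image[of 1 S f k] assms by simp

lemma hmeasure_translation:
  "hmeasure k ((+) a ` S) = hmeasure k (S :: 'a::euclidean_space set)"
proof (rule antisym)
  show "hmeasure k ((+) a ` S) \<le> hmeasure k S"
    by (rule hmeasure_contraction) simp
  have "hmeasure k ((+) (- a) ` (+) a ` S) \<le> hmeasure k ((+) a ` S)"
    by (rule hmeasure_contraction) (simp add: dist_norm)
  then show "hmeasure k S \<le> hmeasure k ((+) a ` S)"
    by (simp add: image_image)
qed

lemma hmeasure_scaleR: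
  assumes "0 < t"
  shows "hmeasure k ((*\<^sub>R) t ` S) = ennreal (t ^ k) * hmeasure k (S :: 'a::euclidean_space set)"
proof (rule antisym)
  show "hmeasure k ((*\<^sub>R) t ` S) \<le> ennreal (t ^ k) * hmeasure k S"
    using assms
    by (intro hmeasure_lipschitz_image) (auto simp: dist_norm simp flip: scaleR_diff_right)
  have "hmeasure k ((*\<^sub>R) (1 / t) ` (*\<^sub>R) t ` S) \<le> ennreal ((1 / t) ^ k) * hmeasure k ((*\<^sub>R) t ` S)"
    using assms
    by (intro hmeasure_lipschitz_image) (auto simp: dist_norm simp flip: scaleR_diff_right)
  then have "hmeasure k S \<le> ennreal ((1 / t) ^ k) * hmeasure k ((*\<^sub>R) t ` S)"
    using assms by (simp add: image_image)
  then have "ennreal (t ^ k) * hmeasure k S \<le>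
      ennreal (t ^ k) * (ennreal ((1 / t) ^ k) * hmeasure k ((*\<^sub>R) t ` S))"
    by (rule mult_left_mono) simp
  also have "\<dots> = ennreal (t ^ k * (1 / t) ^ k) * hmeasure k ((*\<^sub>R) t ` S)"
    using assms by (simp add: ennreal_mult mult.assoc)
  also have "t ^ k * (1 / t) ^ k = 1" using assms by (simp add: power_one_over)
  finally show "ennreal (t ^ k) * hmeasure k S \<le> hmeasure k ((*\<^sub>R) t ` S)" by simp
qed

section \<open>Cubes in a coordinate hyperplane\<close>

definition flat_cube :: "'n \<Rightarrow> real^'n \<Rightarrow> real \<Rightarrow> (real^'n) set" where
  "flat_cube k z s = {x. x $ k = 0 \<and> (\<forall>i. i \<noteq> k \<longrightarrow> z $ i \<le> x $ i \<and> x $ i \<le> z $ i + s)}"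

lemma dist_flat_cube_le:
  fixes x y :: "real^'n" and s :: real
  assumes "x \<in> flat_cube k z s" "y \<in> flat_cube k z s" "0 \<le> s"
  shows "dist x y \<le> real CARD('n) * s"
proof -
  have "\<bar>(x - y) $ i\<bar> \<le> s" for i
  proof (cases "i = k")
    case False
    then have "z $ i \<le> x $ i" "x $ i \<le> z $ i + s" "z $ i \<le> y $ i" "y $ i \<le> z $ i + s"
      using assms(1,2) by (auto simp: flat_cube_def)
    then show ?thesis by simp
  qed (use assms in \<open>simp add: flat_cube_def\<close>)
  then have "(\<Sum>i\<in>UNIV. \<bar>(x - y) $ i\<bar>) \<le> (\<Sum>i\<in>(UNIV::'n set). s)" by (intro sum_mono)
  then show ?thesis using norm_le_l1_cart[of "x - y"] by (simp add: dist_norm)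
qed

lemma bounded_flat_cube:
  assumes "0 \<le> s" shows "bounded (flat_cube k z s)"
proof (cases "flat_cube k z s = {}")
  case False
  then obtain x where "x \<in> flat_cube k z s" by auto
  then show ?thesis using dist_flat_cube_le[OF _ _ assms] unfolding bounded_def by blast
qed auto

lemma flat_cube_eq_image:
  assumes "z $ k = 0" "0 < s"
  shows "flat_cube k z s = (+) z ` (*\<^sub>R) s ` flat_cube k 0 1"
proof
  show "(+) z ` (*\<^sub>R) s ` flat_cube k 0 1 \<subseteq> flat_cube k z s"
  proof
    fix x assume "x \<in> (+) z ` (*\<^sub>R) s ` flat_cube k 0 1"
    then obtain y where y: "y \<in> flat_cube k 0 1" "x = z + s *\<^sub>R y" by blast
    have "z $ i \<le> x $ i \<and> x $ i \<le> z $ i + s" if "i \<noteq> k" for i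
    proof -
      have "0 \<le> y $ i" "y $ i \<le> 1" using y(1) that by (auto simp: flat_cube_def)
      then show ?thesis using assms(2) by (simp add: y(2) mult_left_le)
    qed
    moreover have "x $ k = 0" using y assms(1) by (simp add: flat_cube_def)
    ultimately show "x \<in> flat_cube k z s" by (simp add: flat_cube_def)
  qed
  show "flat_cube k z s \<subseteq> (+) z ` (*\<^sub>R) s ` flat_cube k 0 1"
  proof
    fix x assume x: "x \<in> flat_cube k z s"
    have "0 \<le> (1 / s) * (x $ i - z $ i) \<and> (1 / s) * (x $ i - z $ i) \<le> 1" if "i \<noteq> k" for i
    proof -
      have "z $ i \<le> x $ i" "x $ i \<le> z $ i + s" using x that by (auto simp: flat_cube_def)
      then show ?thesis using assms(2) by (simp add: field_simps)
    qed
    then have "(1 / s) *\<^sub>R (x - z) \<in> flat_cube k 0 1"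
      using x assms(1) by (simp add: flat_cube_def)
    moreover have "x = z + s *\<^sub>R ((1 / s) *\<^sub>R (x - z))" using assms by simp
    ultimately show "x \<in> (+) z ` (*\<^sub>R) s ` flat_cube k 0 1" by blast
  qed
qed

text \<open>Dividing every edge into \<open>N\<close> parts gives N^(d-1) cubes of diameter at most
  d/N, whose total weight is at most the same \<open>W\<close> for every \<open>N\<close>.\<close>

lemma hmeasure_unit_flat_cube_finite:
  fixes k :: "'n::finite"
  assumes n: "CARD('n) \<ge> 2"
  shows "hmeasure (CARD('n) - 1) (flat_cube k 0 1) < top"
proof -
  define m where "m = CARD('n) - 1"
  define W where "W = unit_ball_vol (real m) * (real CARD('n) / 2) ^ m"
  have m: "0 < m" using n by (simp add: m_def)
  have "hmeasure m (flat_cube k 0 1) \<le> ennreal W"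
  proof (rule hmeasure_least)
    fix \<delta> :: real assume \<delta>: "0 < \<delta>"
    define N where "N = nat \<lceil>real CARD('n) / \<delta>\<rceil>"
    have N: "N > 0" using \<delta> by (simp add: N_def)
    have "real CARD('n) / \<delta> \<le> real N" unfolding N_def by linarith
    then have N\<delta>: "real CARD('n) * (1 / real N) \<le> \<delta>" using \<delta> N by (simp add: field_simps)
    define F where "F = PiE (UNIV :: 'n set) (\<lambda>i. if i = k then {0} else {..<N})"
    define pt :: "('n \<Rightarrow> nat) \<Rightarrow> real^'n" where "pt f = (\<chi> i. real (f i) / real N)" for f
    have finF: "finite F" unfolding F_def by (rule finite_PiE) auto
    have "card F = (\<Prod>i\<in>UNIV. card (if i = k then {0} else {..<N}))"
      unfolding F_def by (rule card_PiE) simp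
    also have "\<dots> = (\<Prod>i\<in>UNIV - {k}. N)"
      by (subst prod.remove[of UNIV k]) (auto intro!: prod.cong)
    finally have cF: "card F = N ^ m" by (simp add: m_def card_Diff_subset)
    have "flat_cube k 0 1 \<subseteq> (\<Union>f\<in>F. flat_cube k (pt f) (1 / real N))"
    proof
      fix x :: "real^'n" assume x: "x \<in> flat_cube k 0 1"
      \<comment> \<open>The floor selects the cell; \<open>min (N - 1)\<close> moves the end point
        \<open>x $ i = 1\<close> into the last one.\<close>
      define f where "f i = (if i = k then 0 else min (N - 1) (nat \<lfloor>real N * x $ i\<rfloor>))" for i
      have "f \<in> F" using N by (auto simp: F_def f_def min_def)
      moreover have "real (f i) / real N \<le> x $ i \<and> x $ i \<le> real (f i) / real N + 1 / real N" if "i \<noteq> k" for i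
      proof -
        have x01: "0 \<le> x $ i" "x $ i \<le> 1" using x that by (auto simp: flat_cube_def)
        have fl: "real (nat \<lfloor>real N * x $ i\<rfloor>) \<le> real N * x $ i" "real N * x $ i \<le> real (nat \<lfloor>real N * x $ i\<rfloor>) + 1"
          using x01 N by (simp_all add: mult_nonneg_nonneg le_floor_iff)
        have "real (f i) \<le> real N * x $ i"
          using fl(1) that by (simp add: f_def min_def split: if_splits)
        moreover have "real N * x $ i \<le> real (f i) + 1"
        proof (cases "N - 1 \<le> nat \<lfloor>real N * x $ i\<rfloor>")
          case True
          then have "real (f i) = real N - 1" using that N by (simp add: f_def min_def of_nat_diff)
          moreover have "real N * x $ i \<le> real N" using x01 by (simp add: mult_left_le)
          ultimately show ?thesis by simp
        next
          case False
          then show ?thesis using fl(2) that by (simp add: f_def min_def)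
        qed
        ultimately show ?thesis using N by (simp add: field_simps)
      qed
      ultimately show "x \<in> (\<Union>f\<in>F. flat_cube k (pt f) (1 / real N))"
        using x by (auto simp: flat_cube_def pt_def intro!: bexI[of _ f])
    qed
    then have "hpre m \<delta> (flat_cube k 0 1) \<le> hpre m \<delta> (\<Union>f\<in>F. flat_cube k (pt f) (1 / real N))"
      by (rule hpre_mono) simp
    also have "\<dots> \<le> (\<Sum>f\<in>F. hpre m \<delta> (flat_cube k (pt f) (1 / real N)))"
      by (rule hpre_UN[OF finF m \<delta>])
    also have "\<dots> \<le> (\<Sum>f\<in>F. ennreal (unit_ball_vol (real m) * (real CARD('n) * (1 / real N) / 2) ^ m))"
    proof (rule sum_mono)
      fix f
      let ?Q = "flat_cube k (pt f) (1 / real N)"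
      have d: "diameter ?Q \<le> real CARD('n) * (1 / real N)"
        by (rule diameter_le) (use dist_flat_cube_le[of _ k "pt f" "1 / real N"] N in \<open>auto simp: dist_norm\<close>)
      have "hpre m \<delta> ?Q \<le> hweight m ?Q"
        using d N\<delta> by (intro hpre_le_weight m \<delta> bounded_flat_cube) simp_all
      also have "\<dots> \<le> ennreal (unit_ball_vol (real m) * (real CARD('n) * (1 / real N) / 2) ^ m)"
        unfolding hweight_def
        using d diameter_ge_0[OF bounded_flat_cube, of "1 / real N" k "pt f"]
        by (intro ennreal_leI mult_left_mono power_mono) auto
      finally show "hpre m \<delta> ?Q \<le> ennreal (unit_ball_vol (real m) * (real CARD('n) * (1 / real N) / 2) ^ m)" .
    qed
    also have "\<dots> = ennreal (real (N ^ m)) * ennreal (unit_ball_vol (real m) * (real CARD('n) * (1 / real N) / 2) ^ m)"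
      by (simp only: sum_constant cF ennreal_of_nat_eq_real_of_nat)
    also have "\<dots> = ennreal (real (N ^ m) * (unit_ball_vol (real m) * (real CARD('n) * (1 / real N) / 2) ^ m))"
      by (rule ennreal_mult[symmetric]) auto
    also have "real (N ^ m) * (unit_ball_vol (real m) * (real CARD('n) * (1 / real N) / 2) ^ m) = W"
      using N by (simp add: W_def power_divide power_mult_distrib field_simps)
    finally show "hpre m \<delta> (flat_cube k 0 1) \<le> ennreal W" .
  qed
  then show ?thesis by (simp add: m_def le_less_trans)
qed

lemma prod_if_eq_power: "(\<Prod>i\<in>UNIV. if i = (k::'n::finite) then 1 else a) = (a::real) ^ (CARD('n) - 1)"
proof -
  have "(\<Prod>i\<in>UNIV. if i = k then 1 else a) = (\<Prod>i\<in>UNIV - {k}. a)"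
    by (subst prod.remove[of UNIV k]) (auto intro!: prod.cong)
  then show ?thesis by (simp add: card_Diff_subset)
qed

lemma content_slab_cbox:
  fixes l u :: "real^'n"
  assumes "\<And>i. u $ i - l $ i = (if i = k then 1 else a)" "0 \<le> a"
  shows "vol (cbox l u) = a ^ (CARD('n) - 1)"
proof -
  have le: "l $ i \<le> u $ i" for i using assms(1)[of i] assms(2) by (auto split: if_splits)
  then have "cbox l u \<noteq> {}" by (simp add: interval_ne_empty_cart)
  then show ?thesis by (simp add: content_cbox_cart assms(1) prod_if_eq_power)
qed

text \<open>The part of a covering set of diameter D inside the hyperplane lies over a cube of edge
  2D centred at one of its points. Erected to unit height, these cubes cover the unit cube, so the
  sum of all (2D)^m is at least 1.\<close>

lemma hmeasure_unit_flat_cube_pos: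
  fixes k :: "'n::finite"
  shows "0 < hmeasure (CARD('n) - 1) (flat_cube k 0 1)"
proof -
  define m where "m = CARD('n) - 1"
  \<comment> \<open>Weights contain (D/2)^m in place of (2D)^m, whence the factor
    \<open>4 ^ m\<close>.\<close>
  define W where "W = unit_ball_vol (real m) / 4 ^ m"
  have W: "0 < W" unfolding W_def by (intro divide_pos_pos unit_ball_vol_pos) auto
  have "ennreal W \<le> hpre m 1 (flat_cube k 0 1)"
  proof (rule hpre_greatest)
    fix C assume "C \<in> hcovers 1 (flat_cube k 0 1)"
    then have C: "flat_cube k 0 1 \<subseteq> (\<Union>i. C i)" "\<And>i. bounded (C i)"
      by (auto simp: hcovers_def)
    define D where "D i = diameter (C i)" for i
    have D: "0 \<le> D i" for i unfolding D_def by (rule diameter_ge_0[OF C(2)])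
    \<comment> \<open>For an empty member this is an arbitrary point, which does no harm since
      nothing has to be covered.\<close>
    define y where "y i = (SOME y. y \<in> C i)" for i
    define l where "l i = (\<chi> j. if j = k then 0 else y i $ j - D i)" for i
    define u where "u i = (\<chi> j. if j = k then 1 else y i $ j + D i)" for i
    have "cbox 0 (\<chi> j. 1) \<subseteq> (\<Union>i. cbox (l i) (u i))"
    proof
      fix x :: "real^'n" assume x: "x \<in> cbox 0 (\<chi> j. 1)"
      then have x01: "0 \<le> x $ j" "x $ j \<le> 1" for j by (simp_all add: mem_box_cart)
      then have "drop_coord k x \<in> flat_cube k 0 1" by (auto simp: flat_cube_def)
      then obtain i where i: "drop_coord k x \<in> C i" using C(1) by auto
      then have "y i \<in> C i" unfolding y_def by (rule someI)
      then have "dist (drop_coord k x) (y i) \<le> D i"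
        unfolding D_def using i diameter_bounded_bound[OF C(2)] by simp
      then have c: "\<bar>(drop_coord k x - y i) $ j\<bar> \<le> D i" for j
        using component_le_norm_cart[of "drop_coord k x - y i" j] by (simp add: dist_norm)
      have "l i $ j \<le> x $ j \<and> x $ j \<le> u i $ j" for j
        using c[of j] x01[of j] by (auto simp: l_def u_def abs_le_iff)
      then show "x \<in> (\<Union>i. cbox (l i) (u i))" by (auto simp: mem_box_cart)
    qed
    then have "emeasure lborel (cbox 0 (\<chi> j. 1) :: (real^'n) set) \<le> emeasure lborel (\<Union>i. cbox (l i) (u i))"
      by (rule emeasure_mono) simp
    also have "\<dots> \<le> (\<Sum>i. emeasure lborel (cbox (l i) (u i)))"
      by (rule emeasure_subadditive_countably) auto
    also have "\<dots> = (\<Sum>i. ennreal ((2 * D i) ^ m))"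
    proof (rule suminf_cong)
      fix i
      have "vol (cbox (l i) (u i)) = (2 * D i) ^ m"
        unfolding m_def by (rule content_slab_cbox[where k=k]) (use D in \<open>auto simp: l_def u_def\<close>)
      then show "emeasure lborel (cbox (l i) (u i)) = ennreal ((2 * D i) ^ m)"
        using emeasure_lborel_cbox_finite[of "l i" "u i"] by (simp add: emeasure_eq_ennreal_measure)
    qed
    finally have "1 \<le> (\<Sum>i. ennreal ((2 * D i) ^ m))"
      using content_slab_cbox[of "\<chi> j. 1" "0 :: real^'n" k 1] emeasure_lborel_cbox_finite[of "0 :: real^'n" "\<chi> j. 1"]
      by (simp add: emeasure_eq_ennreal_measure)
    then have "ennreal W * 1 \<le> ennreal W * (\<Sum>i. ennreal ((2 * D i) ^ m))"
      by (rule mult_left_mono) simp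
    also have "\<dots> = (\<Sum>i. ennreal W * ennreal ((2 * D i) ^ m))" by simp
    also have "\<dots> = (\<Sum>i. hweight m (C i))"
    proof (rule suminf_cong)
      fix i
      have "ennreal W * ennreal ((2 * D i) ^ m) = ennreal (W * (2 * D i) ^ m)"
        using W D[of i] by (simp add: ennreal_mult)
      also have "W * (2 * D i) ^ m = unit_ball_vol (real m) * (D i / 2) ^ m"
      proof -
        have "(4::real) ^ m = 2 ^ m * 2 ^ m" by (simp flip: power_mult_distrib)
        then show ?thesis by (simp add: W_def power_mult_distrib power_divide)
      qed
      finally show "ennreal W * ennreal ((2 * D i) ^ m) = hweight m (C i)"
        by (simp add: hweight_def D_def)
    qed
    finally show "ennreal W \<le> (\<Sum>i. hweight m (C i))" by simp
  qed
  also have "\<dots> \<le> hmeasure m (flat_cube k 0 1)" by (rule hpre_le) simp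
  finally show ?thesis using W unfolding m_def by (metis ennreal_eq_0_iff le_zero_eq not_le zero_less_iff_neq_zero)
qed

text \<open>Attached to a direction \<open>k\<close>; a comparison of two surface areas below uses
  the same \<open>k\<close> for both bodies, so the constant cancels.\<close>

definition flat_cube_const :: "'n::finite \<Rightarrow> real" where
  "flat_cube_const k = enn2real (hmeasure (CARD('n) - 1) (flat_cube k 0 1))"

lemma flat_cube_const_pos:
  fixes k :: "'n::finite"
  assumes "CARD('n) \<ge> 2" shows "0 < flat_cube_const k"
  unfolding flat_cube_const_def
  using hmeasure_unit_flat_cube_pos[of k] hmeasure_unit_flat_cube_finite[OF assms, of k]
  by (simp add: enn2real_positive_iff)

lemma hmeasure_flat_cube:
  fixes k :: "'n::finite"
  assumes "CARD('n) \<ge> 2" "z $ k = 0" "0 < s"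
  shows "hmeasure (CARD('n) - 1) (flat_cube k z s) = ennreal (s ^ (CARD('n) - 1) * flat_cube_const k)"
  using hmeasure_unit_flat_cube_finite[OF assms(1), of k] assms(3)
  by (simp add: flat_cube_eq_image[OF assms(2,3)] hmeasure_translation hmeasure_scaleR
      flat_cube_const_def ennreal_mult)

section \<open>Hausdorff measure of flat convex bodies\<close>

text \<open>For sets inside the hyperplane \<open>x $ k = 0\<close> this is Lebesgue volume of one
  dimension less.\<close>

definition cylinder_vol :: "'n \<Rightarrow> (real^'n) set \<Rightarrow> real" where
  "cylinder_vol k P = vol (P + seg (axis k 1))"

lemma cylinder_vol_scaleR:
  fixes P :: "(real^'n) set"
  assumes "compact P" "\<And>x. x \<in> P \<Longrightarrow> x $ k = 0" "0 \<le> a"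
  shows "cylinder_vol k ((*\<^sub>R) a ` P) = a ^ (CARD('n) - 1) * cylinder_vol k P"
proof -
  have "vol ((*\<^sub>R) a ` P + (\<Sum>l\<in>{k}. seg (axis l 1))) =
      a ^ (CARD('n) - card {k}) * vol (P + (\<Sum>l\<in>{k}. seg (axis l 1)))"
    by (rule measure_scaled_base) (use assms in auto)
  then show ?thesis by (simp add: cylinder_vol_def)
qed

lemma cylinder_iff:
  assumes "\<And>x. x \<in> P \<Longrightarrow> x $ k = 0"
  shows "x \<in> P + seg (axis k 1) \<longleftrightarrow> drop_coord k x \<in> P \<and> 0 \<le> x $ k \<and> x $ k \<le> 1"
proof -
  have "x \<in> P + seg (axis k 1) \<longleftrightarrow> (\<exists>r. 0 \<le> r \<and> r \<le> 1 \<and> x - r *\<^sub>R axis k 1 \<in> P)"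
    using set_plus_segment_iff[of 1 x P "axis k 1"] by simp
  also have "\<dots> \<longleftrightarrow> drop_coord k x \<in> P \<and> 0 \<le> x $ k \<and> x $ k \<le> 1"
  proof
    assume "\<exists>r. 0 \<le> r \<and> r \<le> 1 \<and> x - r *\<^sub>R axis k 1 \<in> P"
    then obtain r where r: "0 \<le> r" "r \<le> 1" "x - r *\<^sub>R axis k 1 \<in> P" by auto
    then have "x $ k = r" using assms[OF r(3)] by simp
    with r show "drop_coord k x \<in> P \<and> 0 \<le> x $ k \<and> x $ k \<le> 1" by (simp add: drop_coord_eq)
  next
    assume "drop_coord k x \<in> P \<and> 0 \<le> x $ k \<and> x $ k \<le> 1"
    then show "\<exists>r. 0 \<le> r \<and> r \<le> 1 \<and> x - r *\<^sub>R axis k 1 \<in> P"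
      by (intro exI[of _ "x $ k"]) (simp add: drop_coord_eq)
  qed
  finally show ?thesis .
qed

lemma drop_coord_in_flat_cube_floor:
  assumes "0 < s" "x $ k = 0"
  shows "x \<in> flat_cube k (\<chi> i. s * (if i = k then 0 else of_int \<lfloor>x $ i / s\<rfloor>)) s"
proof -
  have "s * of_int \<lfloor>x $ i / s\<rfloor> \<le> x $ i \<and> x $ i \<le> s * of_int \<lfloor>x $ i / s\<rfloor> + s" for i
  proof -
    have "of_int \<lfloor>x $ i / s\<rfloor> \<le> x $ i / s" "x $ i / s \<le> of_int \<lfloor>x $ i / s\<rfloor> + 1" by linarith+
    then have "s * of_int \<lfloor>x $ i / s\<rfloor> \<le> s * (x $ i / s)" "s * (x $ i / s) \<le> s * (of_int \<lfloor>x $ i / s\<rfloor> + 1)"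
      using assms(1) by (simp_all only: mult_le_cancel_left_pos)
    then show ?thesis using assms(1) by (simp add: distrib_left)
  qed
  then show ?thesis using assms(2) by (simp add: flat_cube_def)
qed

text \<open>
  Both set functions are compared with the number of cubes of a fine grid that meet, or are
  contained in, the flat body \<open>P\<close>. For the lower bound the cubes are shrunk so as to be
  separated from each other.
\<close>

lemma hmeasure_flat_body_bounds:
  fixes P :: "(real^'n) set"
  assumes n: "CARD('n) \<ge> 2" and P: "compact P" "convex P" "\<And>x. x \<in> P \<Longrightarrow> x $ k = 0"
    and r: "0 < r" "\<And>x. x $ k = 0 \<Longrightarrow> norm x < r \<Longrightarrow> x \<in> P" and \<tau>: "0 < \<tau>" "\<tau> < 1"
  defines "m \<equiv> CARD('n) - 1" and "c \<equiv> flat_cube_const k"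
  shows "hmeasure m P \<le> ennreal ((1 + \<tau>) ^ m * (c * cylinder_vol k P))"
    and "ennreal (((1 - \<tau>) * (1 - \<tau>)) ^ m * (c * cylinder_vol k P)) \<le> hmeasure m P"
proof -
  have m: "0 < m" using n by (simp add: m_def)
  have c: "0 < c" unfolding c_def by (rule flat_cube_const_pos[OF n])
  \<comment> \<open>Chosen so that the bound \<open>real CARD('n) * s\<close> on distances inside a
    grid cube equals \<open>\<tau> * r / 2\<close>.\<close>
  define s where "s = \<tau> * r / (2 * real CARD('n))"
  have s: "0 < s" using \<tau> r by (simp add: s_def)
  have ds: "real CARD('n) * s < \<tau> * r" using \<tau> r by (simp add: s_def)
  define pt :: "('n \<Rightarrow> int) \<Rightarrow> real^'n" where "pt z = (\<chi> i. s * (if i = k then 0 else of_int (z i)))" for z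
  define Q where "Q z = flat_cube k (pt z) s" for z
  define Z :: "('n \<Rightarrow> int) set" where "Z = {z. z k = 0}"
  define Zout where "Zout = {z \<in> Z. Q z \<inter> P \<noteq> {}}"
  define Zin where "Zin = {z \<in> Z. Q z \<subseteq> P}"
  have Qk: "x $ k = 0" if "x \<in> Q z" for x z using that by (simp add: Q_def flat_cube_def)
  have Qdist: "dist x y < \<tau> * r" if "x \<in> Q z" "y \<in> Q z" for x y z
    using dist_flat_cube_le[of x k "pt z" s y] that s ds unfolding Q_def by simp
  have ptQ: "pt z \<in> Q z" for z using s by (simp add: Q_def flat_cube_def pt_def)
  have cover: "\<exists>z\<in>Z. x \<in> Q z" if "x $ k = 0" for x
  proof -
    define z where "z i = (if i = k then 0 else \<lfloor>x $ i / s\<rfloor>)" for i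
    have "(\<chi> i. s * (if i = k then 0 else of_int \<lfloor>x $ i / s\<rfloor>)) = pt z"
      by (auto simp: pt_def z_def vec_eq_iff)
    then have "x \<in> Q z" using drop_coord_in_flat_cube_floor[OF s that] by (simp add: Q_def)
    moreover have "z \<in> Z" by (simp add: Z_def z_def)
    ultimately show ?thesis by blast
  qed
  \<comment> \<open>\<open>P\<close> contains the \<open>r\<close>-ball of the hyperplane, so
    differences inside one grid cube lie in \<open>\<tau>\<close> times \<open>P\<close>. By
    convexity, cubes meeting \<open>P\<close> stay inside \<open>1 + \<tau>\<close> times
    \<open>P\<close>, and cubes meeting \<open>1 - \<tau>\<close> times \<open>P\<close> stay inside
    \<open>P\<close>.\<close>
  have near: "x - y \<in> (*\<^sub>R) \<tau> ` P" if "x \<in> Q z" "y \<in> Q z" for x y z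
  proof -
    have "norm ((1 / \<tau>) *\<^sub>R (x - y)) < r"
      using Qdist[OF that] \<tau> by (simp only: norm_scaleR dist_norm) (simp add: field_simps)
    moreover have "((1 / \<tau>) *\<^sub>R (x - y)) $ k = 0" using Qk[OF that(1)] Qk[OF that(2)] by simp
    ultimately have "(1 / \<tau>) *\<^sub>R (x - y) \<in> P" using r(2) by blast
    moreover have "x - y = \<tau> *\<^sub>R ((1 / \<tau>) *\<^sub>R (x - y))" using \<tau> by simp
    ultimately show ?thesis by blast
  qed
  have InOut: "Zin \<subseteq> Zout" using ptQ by (auto simp: Zin_def Zout_def)
  have finout: "finite Zout"
  proof -
    obtain R where R: "\<And>x. x \<in> P \<Longrightarrow> norm x \<le> R" using compact_imp_bounded[OF P(1)] bounded_iff by blast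
    \<comment> \<open>The extra 1 accounts for cubes whose corner lies below \<open>- R\<close> by
      up to one edge length.\<close>
    define N where "N = \<lceil>R / s\<rceil> + 1"
    have "Zout \<subseteq> PiE UNIV (\<lambda>_. {-N..N})"
    proof
      fix z assume "z \<in> Zout"
      then obtain x where x: "x \<in> Q z" "x \<in> P" and zk: "z k = 0" by (auto simp: Zout_def Z_def)
      have "0 \<le> R" using R[OF x(2)] norm_ge_zero[of x] by linarith
      then have "0 \<le> R / s" using s by simp
      then have N: "R / s \<le> of_int N - 1" "0 \<le> N" unfolding N_def by linarith+
      have "z i \<in> {-N..N}" for i
      proof (cases "i = k")
        case False
        have "s * of_int (z i) \<le> x $ i" "x $ i \<le> s * of_int (z i) + s"
          using x(1) False by (auto simp: Q_def flat_cube_def pt_def)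
        moreover have "\<bar>x $ i\<bar> \<le> R" using component_le_norm_cart[of x i] R[OF x(2)] by linarith
        ultimately have "s * of_int (z i) \<le> R" "- R \<le> s * of_int (z i) + s" by linarith+
        then have "of_int (z i) \<le> R / s" "- (R / s) \<le> of_int (z i) + 1"
          using s by (simp_all add: field_simps)
        then have "real_of_int (z i) \<le> of_int N" "real_of_int (- N) \<le> of_int (z i)" using N(1) by simp_all
        then show ?thesis by simp
      qed (use zk N in simp)
      then show "z \<in> PiE UNIV (\<lambda>_. {-N..N})" by (auto simp: PiE_iff)
    qed
    then show ?thesis by (rule finite_subset) (intro finite_PiE; simp)
  qed
  have finin: "finite Zin" using InOut finout by (rule finite_subset)
  define v where "v = cylinder_vol k P"
  have sc: "compact ((*\<^sub>R) a ` P)" "\<And>x. x \<in> (*\<^sub>R) a ` P \<Longrightarrow> x $ k = 0" for a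
    using P by (auto intro: compact_scaling)
  have slab: "vol (cbox (pt z) (pt z + (\<chi> i. if i = k then 1 else s))) = s ^ m" for z
    unfolding m_def by (rule content_slab_cbox[where k=k]) (use s in auto)
  have Qcyl: "x \<in> Q z + seg (axis k 1) \<longleftrightarrow> x \<in> cbox (pt z) (pt z + (\<chi> i. if i = k then 1 else s))" for x z
  proof -
    have pk: "pt z $ k = 0" by (simp add: pt_def)
    have "x \<in> cbox (pt z) (pt z + (\<chi> i. if i = k then 1 else s)) \<longleftrightarrow>
        (\<forall>i. i \<noteq> k \<longrightarrow> pt z $ i \<le> x $ i \<and> x $ i \<le> pt z $ i + s) \<and> 0 \<le> x $ k \<and> x $ k \<le> 1"
      using pk by (auto simp: mem_box_cart split: if_splits)
    then show ?thesis by (subst cylinder_iff[OF Qk]) (auto simp: Q_def flat_cube_def)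
  qed
  have out: "real (card Zout) * s ^ m \<le> (1 + \<tau>) ^ m * v"
  proof -
    \<comment> \<open>Open boxes of distinct grid points are disjoint, so their volumes add
      up.\<close>
    define B where "B z = box (pt z) (pt z + (\<chi> i. if i = k then 1 else s))" for z
    have mB: "vol (B z) = s ^ m" for z
      using slab[of z] by (simp add: B_def measure_lborel_box_eq measure_lborel_cbox_eq)
    have disj: "disjoint_family_on B Zout"
      unfolding disjoint_family_on_def
    proof (intro ballI impI)
      fix z z' assume z: "z \<in> Zout" "z' \<in> Zout" "z \<noteq> z'"
      then obtain i where i: "z i \<noteq> z' i" by blast
      have ik: "i \<noteq> k" using i z by (auto simp: Zout_def Z_def)
      have fl: "\<lfloor>x $ i / s\<rfloor> = w i" if "x \<in> B w" for x w
      proof -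
        have "s * of_int (w i) < x $ i" "x $ i < s * of_int (w i) + s"
          using that[unfolded B_def mem_box_cart, rule_format, of i] ik by (auto simp: pt_def)
        then show ?thesis using s by (intro floor_unique) (simp_all add: field_simps)
      qed
      have "x \<notin> B z'" if "x \<in> B z" for x
        using fl[OF that] fl[of x z'] i by auto
      then show "B z \<inter> B z' = {}" by auto
    qed
    have sub: "(\<Union>z\<in>Zout. B z) \<subseteq> (*\<^sub>R) (1 + \<tau>) ` P + seg (axis k 1)"
    proof
      fix x assume "x \<in> (\<Union>z\<in>Zout. B z)"
      then obtain z where z: "z \<in> Zout" "x \<in> B z" by auto
      then obtain p where p: "p \<in> Q z" "p \<in> P" by (auto simp: Zout_def)
      have "x \<in> Q z + seg (axis k 1)"
        unfolding Qcyl using z(2) box_subset_cbox unfolding B_def by blast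
      then have x: "drop_coord k x \<in> Q z" "0 \<le> x $ k" "x $ k \<le> 1" by (auto simp: cylinder_iff[OF Qk])
      have "drop_coord k x = p + (drop_coord k x - p)" by simp
      also have "\<dots> \<in> (*\<^sub>R) 1 ` P + (*\<^sub>R) \<tau> ` P"
        using p(2) by (intro set_plus_intro near[OF x(1) p(1)]) simp
      also have "\<dots> = (*\<^sub>R) (1 + \<tau>) ` P" using \<tau> by (intro scaleR_image_add P) auto
      finally show "x \<in> (*\<^sub>R) (1 + \<tau>) ` P + seg (axis k 1)"
        using x by (simp add: cylinder_iff[OF sc(2)])
    qed
    have "real (card Zout) * s ^ m = (\<Sum>z\<in>Zout. vol (B z))" by (simp add: mB)
    also have "\<dots> = vol (\<Union>z\<in>Zout. B z)"
    proof (rule measure_finite_Union[symmetric, OF finout _ disj])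
      show "B ` Zout \<subseteq> sets lebesgue" by (auto simp: B_def)
      show "emeasure lebesgue (B z) \<noteq> \<infinity>" for z
        by (simp add: B_def emeasure_lborel_box_eq)
    qed
    also have "\<dots> \<le> cylinder_vol k ((*\<^sub>R) (1 + \<tau>) ` P)"
      unfolding cylinder_vol_def using sub finout
      by (intro measure_mono_fmeasurable lmeasurable_compact compact_set_plus sc(1) compact_segment)
        (auto simp: B_def)
    also have "\<dots> = (1 + \<tau>) ^ m * v"
      unfolding m_def v_def using \<tau> by (intro cylinder_vol_scaleR P) auto
    finally show ?thesis .
  qed
  have inn: "(1 - \<tau>) ^ m * v \<le> real (card Zin) * s ^ m"
  proof -
    have "(1 - \<tau>) ^ m * v = cylinder_vol k ((*\<^sub>R) (1 - \<tau>) ` P)"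
      unfolding m_def v_def using \<tau> by (intro cylinder_vol_scaleR[symmetric] P) auto
    also have "\<dots> \<le> vol (\<Union>z\<in>Zin. cbox (pt z) (pt z + (\<chi> i. if i = k then 1 else s)))"
      unfolding cylinder_vol_def
    proof (rule measure_mono_fmeasurable)
      show "(*\<^sub>R) (1 - \<tau>) ` P + seg (axis k 1) \<subseteq>
          (\<Union>z\<in>Zin. cbox (pt z) (pt z + (\<chi> i. if i = k then 1 else s)))"
      proof
        fix x assume "x \<in> (*\<^sub>R) (1 - \<tau>) ` P + seg (axis k 1)"
        then have x: "drop_coord k x \<in> (*\<^sub>R) (1 - \<tau>) ` P" "0 \<le> x $ k" "x $ k \<le> 1"
          by (simp_all add: cylinder_iff[OF sc(2)])
        obtain z where z: "z \<in> Z" "drop_coord k x \<in> Q z" using cover[of "drop_coord k x"] by auto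
        have "Q z \<subseteq> P"
        proof
          fix y assume y: "y \<in> Q z"
          have "y = drop_coord k x + (y - drop_coord k x)" by simp
          also have "\<dots> \<in> (*\<^sub>R) (1 - \<tau>) ` P + (*\<^sub>R) \<tau> ` P"
            by (rule set_plus_intro[OF x(1) near[OF y z(2)]])
          also have "\<dots> = (*\<^sub>R) (1 - \<tau> + \<tau>) ` P" using \<tau> by (intro scaleR_image_add P) auto
          finally show "y \<in> P" by simp
        qed
        then have "z \<in> Zin" using z by (simp add: Zin_def)
        moreover have "x \<in> cbox (pt z) (pt z + (\<chi> i. if i = k then 1 else s))"
          unfolding Qcyl[symmetric] using x z(2) by (simp add: cylinder_iff[OF Qk])
        ultimately show "x \<in> (\<Union>z\<in>Zin. cbox (pt z) (pt z + (\<chi> i. if i = k then 1 else s)))" by blast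
      qed
    qed (use finin sc in \<open>auto intro!: fmeasurableD lmeasurable_compact compact_set_plus fmeasurable.finite_UN\<close>)
    also have "\<dots> \<le> (\<Sum>z\<in>Zin. vol (cbox (pt z) (pt z + (\<chi> i. if i = k then 1 else s))))"
      by (intro measure_UNION_le finin) auto
    also have "\<dots> = real (card Zin) * s ^ m" by (simp only: slab sum_constant)
    finally show ?thesis .
  qed
  have ptk: "pt z $ k = 0" for z by (simp add: pt_def)
  have "P \<subseteq> (\<Union>z\<in>Zout. Q z)" using cover P(3) by (fastforce simp: Zout_def)
  then have "hmeasure m P \<le> hmeasure m (\<Union>z\<in>Zout. Q z)"
    by (rule hmeasure_mono)
  also have "\<dots> \<le> (\<Sum>z\<in>Zout. hmeasure m (Q z))" by (rule hmeasure_UN[OF finout m])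
  also have "\<dots> = (\<Sum>z\<in>Zout. ennreal (s ^ m * c))"
    unfolding Q_def m_def c_def using hmeasure_flat_cube[OF n ptk s] by simp
  also have "\<dots> = ennreal (\<Sum>z\<in>Zout. s ^ m * c)" using s c by (intro sum_ennreal) auto
  also have "\<dots> \<le> ennreal ((1 + \<tau>) ^ m * (c * cylinder_vol k P))"
    using mult_right_mono[OF out, of c] c by (intro ennreal_leI) (simp add: v_def mult_ac)
  finally show "hmeasure m P \<le> ennreal ((1 + \<tau>) ^ m * (c * cylinder_vol k P))" .
  \<comment> \<open>A margin of \<open>s * \<tau> / 2\<close> on each side separates the cubes by at
    least \<open>s * \<tau>\<close>; the shrinking costs the second factor
    \<open>1 - \<tau>\<close>.\<close>
  define S where "S z = flat_cube k (pt z + (\<chi> i. if i = k then 0 else s * \<tau> / 2)) (s * (1 - \<tau>))" for z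
  have SQ: "S z \<subseteq> Q z" for z
  proof
    fix x assume x: "x \<in> S z"
    have "pt z $ i \<le> x $ i \<and> x $ i \<le> pt z $ i + s" if "i \<noteq> k" for i
    proof -
      have a: "pt z $ i + s * \<tau> / 2 \<le> x $ i" "x $ i \<le> pt z $ i + s * \<tau> / 2 + s * (1 - \<tau>)"
        using x that by (auto simp: S_def flat_cube_def)
      have "0 \<le> s * \<tau>" using s \<tau> by simp
      then show ?thesis using a by (simp add: algebra_simps)
    qed
    then show "x \<in> Q z" using x by (simp add: S_def Q_def flat_cube_def)
  qed
  have sep: "s * \<tau> \<le> dist x y" if z: "z \<in> Zin" "z' \<in> Zin" "z \<noteq> z'" "x \<in> S z" "y \<in> S z'" for x y z z'
  proof -
    obtain i where i: "z i \<noteq> z' i" using z(3) by blast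
    have ik: "i \<noteq> k" using i z by (auto simp: Zin_def Z_def)
    have b: "s * of_int (z i) + s * \<tau> / 2 \<le> x $ i" "x $ i \<le> s * of_int (z i) + s - s * \<tau> / 2"
      "s * of_int (z' i) + s * \<tau> / 2 \<le> y $ i" "y $ i \<le> s * of_int (z' i) + s - s * \<tau> / 2"
      using z ik by (auto simp: S_def flat_cube_def pt_def algebra_simps)
    have "s * \<tau> \<le> \<bar>(x - y) $ i\<bar>"
    proof (cases "z i < z' i")
      case True
      then have "s * (real_of_int (z i) + 1) \<le> s * of_int (z' i)" using s by (intro mult_left_mono) linarith+
      then show ?thesis using b by (simp add: algebra_simps)
    next
      case False
      then have "s * (real_of_int (z' i) + 1) \<le> s * of_int (z i)" using s i by (intro mult_left_mono) linarith+
      then show ?thesis using b by (simp add: algebra_simps)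
    qed
    also have "\<dots> \<le> dist x y" using component_le_norm_cart[of "x - y" i] by (simp add: dist_norm)
    finally show ?thesis .
  qed
  have "((1 - \<tau>) * (1 - \<tau>)) ^ m * (c * cylinder_vol k P) = (1 - \<tau>) ^ m * c * ((1 - \<tau>) ^ m * v)"
    by (simp add: v_def power_mult_distrib mult_ac)
  also have "\<dots> \<le> (1 - \<tau>) ^ m * c * (real (card Zin) * s ^ m)"
    using inn c \<tau> by (intro mult_left_mono) auto
  also have "\<dots> = (\<Sum>z\<in>Zin. (s * (1 - \<tau>)) ^ m * c)" by (simp add: power_mult_distrib mult_ac)
  finally have "ennreal (((1 - \<tau>) * (1 - \<tau>)) ^ m * (c * cylinder_vol k P)) \<le>
      ennreal (\<Sum>z\<in>Zin. (s * (1 - \<tau>)) ^ m * c)" by (rule ennreal_leI)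
  also have "\<dots> = (\<Sum>z\<in>Zin. ennreal ((s * (1 - \<tau>)) ^ m * c))"
    using s c \<tau> by (intro sum_ennreal[symmetric]) auto
  also have "\<dots> = (\<Sum>z\<in>Zin. hmeasure m (S z))"
  proof (rule sum.cong[OF refl])
    fix z
    show "ennreal ((s * (1 - \<tau>)) ^ m * c) = hmeasure m (S z)"
      unfolding S_def m_def c_def using s \<tau> ptk by (intro hmeasure_flat_cube[OF n, symmetric]) auto
  qed
  also have "\<dots> \<le> hmeasure m (\<Union>z\<in>Zin. S z)"
    by (rule hmeasure_UN_separated[OF finin m _ sep]) (use s \<tau> in auto)
  also have "\<dots> \<le> hmeasure m P"
    using SQ by (intro hmeasure_mono) (auto simp: Zin_def)
  finally show "ennreal (((1 - \<tau>) * (1 - \<tau>)) ^ m * (c * cylinder_vol k P)) \<le> hmeasure m P" .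
qed

text \<open>Both bounds tend to the same value as \<open>\<tau>\<close> goes to 0. The upper one
  gives finiteness, which moves the limit argument into the reals.\<close>

lemma hmeasure_flat_body_centered:
  fixes P :: "(real^'n) set"
  assumes n: "CARD('n) \<ge> 2" and P: "compact P" "convex P" "\<And>x. x \<in> P \<Longrightarrow> x $ k = 0"
    and r: "0 < r" "\<And>x. x $ k = 0 \<Longrightarrow> norm x < r \<Longrightarrow> x \<in> P"
  shows "hmeasure (CARD('n) - 1) P = ennreal (flat_cube_const k * cylinder_vol k P)"
proof -
  let ?H = "hmeasure (CARD('n) - 1) P" and ?m = "CARD('n) - 1"
    and ?v = "flat_cube_const k * cylinder_vol k P"
  \<comment> \<open>The shift by 2 keeps all terms strictly below 1.\<close>
  define t where "t n = 1 / real (n + 2)" for n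
  have t: "0 < t n" "t n < 1" for n by (simp_all add: t_def)
  have t0: "t \<longlonglongrightarrow> 0" unfolding t_def
    using LIMSEQ_ignore_initial_segment[OF lim_1_over_n, of 2] by simp
  have b: "?H \<le> ennreal ((1 + t n) ^ ?m * ?v)" "ennreal (((1 - t n) * (1 - t n)) ^ ?m * ?v) \<le> ?H" for n
    using hmeasure_flat_body_bounds[OF n P(1,2) _ r(1) _ t] P(3) r(2) by blast+
  have v: "0 \<le> ?v" using flat_cube_const_pos[OF n, of k] by (simp add: cylinder_vol_def)
  have "?H \<noteq> top" using b(1)[of 0] by (metis ennreal_less_top leD top.not_eq_extremum)
  then obtain x where x: "?H = ennreal x" "0 \<le> x" by (cases ?H) auto
  have "x \<le> (1 + t n) ^ ?m * ?v" for n
    using b(1)[of n] v t[of n] unfolding x(1) by (subst (asm) ennreal_le_iff) auto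
  moreover have "(\<lambda>n. (1 + t n) ^ ?m * ?v) \<longlonglongrightarrow> (1 + 0) ^ ?m * ?v"
    by (intro tendsto_intros t0)
  ultimately have 1: "x \<le> (1 + 0) ^ ?m * ?v" by (intro LIMSEQ_le_const) auto
  have "((1 - t n) * (1 - t n)) ^ ?m * ?v \<le> x" for n
    using b(2)[of n] x(2) unfolding x(1) by (subst (asm) ennreal_le_iff) auto
  moreover have "(\<lambda>n. ((1 - t n) * (1 - t n)) ^ ?m * ?v) \<longlonglongrightarrow> ((1 - 0) * (1 - 0)) ^ ?m * ?v"
    by (intro tendsto_intros t0)
  ultimately have "((1 - 0) * (1 - 0)) ^ ?m * ?v \<le> x" by (intro LIMSEQ_le_const2) auto
  with 1 have "x = ?v" by simp
  then show ?thesis using x(1) by simp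
qed

section \<open>Boundaries of convex bodies\<close>

lemma drop_coord_ball:
  assumes "ball 0 r \<subseteq> K" "x $ k = 0" "norm x < r"
  shows "x \<in> drop_coord k ` K"
proof -
  have "drop_coord k x = x" using assms(2) by (auto simp: vec_eq_iff)
  moreover have "x \<in> K" using assms by auto
  ultimately show ?thesis by (metis imageI)
qed

lemma norm_drop_coord_le: "norm (drop_coord k x) \<le> norm (x::real^'n)"
  by (rule norm_le_componentwise_cart) auto

lemma linear_image_translation: "linear f \<Longrightarrow> f ` (+) z ` S = (+) (f z) ` f ` S"
  by (auto simp: image_image linear_add)

lemma ball_translation_subset:
  fixes z :: "'a::real_normed_vector"
  assumes "ball z r \<subseteq> K" shows "ball 0 r \<subseteq> (+) (- z) ` K"
proof
  fix x :: 'a assume "x \<in> ball 0 r"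
  then have "z + x \<in> K" using assms by (auto simp: dist_norm)
  moreover have "x = - z + (z + x)" by simp
  ultimately show "x \<in> (+) (- z) ` K" by blast
qed

lemma cylinder_vol_translation: "cylinder_vol k ((+) a ` P) = cylinder_vol k P"
proof -
  have "(+) a ` P + seg (axis k 1) = (+) a ` (P + seg (axis k 1))"
    by (force simp: set_plus_def image_iff add.assoc)
  then show ?thesis by (simp only: cylinder_vol_def measure_translation)
qed

text \<open>Moving the centre of the ball to the origin supplies the disc that the shadow has to
  contain.\<close>

lemma hmeasure_shadow:
  fixes K :: "(real^'n) set"
  assumes n: "CARD('n) \<ge> 2" and K: "compact K" "convex K" and r: "0 < r" "ball z r \<subseteq> K"
  shows "hmeasure (CARD('n) - 1) (drop_coord k ` K) =
    ennreal (flat_cube_const k * cylinder_vol k (drop_coord k ` K))"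
proof -
  let ?K = "(+) (- z) ` K"
  note lin = linear_drop_coord[of k]
  have "hmeasure (CARD('n) - 1) (drop_coord k ` ?K) =
      ennreal (flat_cube_const k * cylinder_vol k (drop_coord k ` ?K))"
  proof (rule hmeasure_flat_body_centered[OF n _ _ _ r(1)])
    show "compact (drop_coord k ` ?K)" using K lin by (intro compact_linear_image compact_translation)
    show "convex (drop_coord k ` ?K)" using K lin by (intro convex_linear_image convex_translation)
    show "x $ k = 0" if "x \<in> drop_coord k ` ?K" for x using that by auto
    show "x \<in> drop_coord k ` ?K" if "x $ k = 0" "norm x < r" for x
      using drop_coord_ball[OF ball_translation_subset[OF r(2)] that] .
  qed
  then show ?thesis
    by (simp only: linear_image_translation[OF lin] hmeasure_translation cylinder_vol_translation)
qed

text \<open>The parameters at which the line stays in \<open>K\<close> form a compact set; the point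
  at its maximum cannot be interior.\<close>

lemma top_point_exists:
  fixes K :: "(real^'n) set"
  assumes K: "compact K" and p: "p \<in> K" and e: "e \<noteq> 0"
  obtains t where "p + t *\<^sub>R e \<in> frontier K" "\<And>s. t < s \<Longrightarrow> p + s *\<^sub>R e \<notin> K"
proof -
  let ?T = "{t. p + t *\<^sub>R e \<in> K}"
  have "closed ?T"
  proof -
    have "?T = (\<lambda>t. p + t *\<^sub>R e) -` K" by auto
    moreover have "closed ((\<lambda>t. p + t *\<^sub>R e) -` K)"
      using K by (intro closed_vimage compact_imp_closed continuous_intros)
    ultimately show ?thesis by simp
  qed
  moreover have "bounded ?T"
  proof -
    obtain R where R: "\<And>x. x \<in> K \<Longrightarrow> norm x \<le> R" using compact_imp_bounded[OF K] bounded_iff by blast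
    have "\<bar>t\<bar> \<le> (R + norm p) / norm e" if "t \<in> ?T" for t
    proof -
      have "norm (t *\<^sub>R e) \<le> norm (p + t *\<^sub>R e) + norm p"
        using norm_triangle_ineq4[of "p + t *\<^sub>R e" p] by simp
      then have "\<bar>t\<bar> * norm e \<le> R + norm p" using R[of "p + t *\<^sub>R e"] that by simp
      then show ?thesis using e by (simp add: field_simps)
    qed
    then show ?thesis by (auto simp: bounded_iff)
  qed
  moreover have "0 \<in> ?T" using p by simp
  ultimately obtain t where t: "t \<in> ?T" "\<And>s. s \<in> ?T \<Longrightarrow> s \<le> t"
    using compact_attains_sup[of ?T] compact_eq_bounded_closed by blast
  have "p + t *\<^sub>R e \<notin> interior K"
  proof
    assume "p + t *\<^sub>R e \<in> interior K"
    then obtain d where d: "0 < d" "ball (p + t *\<^sub>R e) d \<subseteq> K" by (auto simp: mem_interior)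
    have "p + (t + d / (2 * norm e)) *\<^sub>R e \<in> ball (p + t *\<^sub>R e) d"
      using d e by (simp add: dist_norm scaleR_add_left)
    then have "t + d / (2 * norm e) \<in> ?T" using d(2) by auto
    then have "t + d / (2 * norm e) \<le> t" by (rule t(2))
    moreover have "0 < d / (2 * norm e)" using d(1) e by simp
    ultimately show False by simp
  qed
  then have "p + t *\<^sub>R e \<in> frontier K"
    using t(1) closure_subset by (auto simp: frontier_def)
  moreover have "p + s *\<^sub>R e \<notin> K" if "t < s" for s using t(2)[of s] that by auto
  ultimately show thesis using that by blast
qed

text \<open>
  Over the shadow shrunk by a factor \<open>\<tau> < 1\<close>, the upper and the lower boundary of the body are
  separated from each other, and each of them projects onto the shrunk shadow.
\<close>

lemma hmeasure_frontier_ge_centered: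
  fixes K :: "(real^'n) set"
  assumes m: "0 < m" and K: "compact K" "convex K" and r: "0 < r" "ball 0 r \<subseteq> K" and \<tau>: "0 < \<tau>" "\<tau> < 1"
  shows "2 * (ennreal (\<tau> ^ m) * hmeasure m (drop_coord k ` K)) \<le> hmeasure m (frontier K)"
proof -
  define e :: "real^'n" where "e = axis k 1"
  have e [simp]: "e $ k = 1" "drop_coord k e = 0" "norm e = 1" "e \<noteq> 0"
    by (simp_all add: e_def norm_axis_1 axis_eq_0_iff drop_coord_eq)
  have de: "drop_coord k x = x - x $ k *\<^sub>R e" for x by (simp add: drop_coord_eq e_def)
  define P where "P = (*\<^sub>R) \<tau> ` drop_coord k ` K"
  \<comment> \<open>The last points of \<open>K\<close> in direction
    \<open>\<sigma> *\<^sub>R e\<close> over the shrunk shadow: the upper boundary for 1, the lower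
    one for -1.\<close>
  define side where "side \<sigma> = {p \<in> frontier K. drop_coord k p \<in> P \<and> (\<forall>t>0. p + (t * \<sigma>) *\<^sub>R e \<notin> K)}" for \<sigma> :: real
  define \<rho> where "\<rho> = (1 - \<tau>) * r"
  have \<rho>: "0 < \<rho>" using \<tau> r by (simp add: \<rho>_def)
  \<comment> \<open>A convex combination of \<open>a\<close> with points of the
    \<open>r\<close>-ball around the origin: shrinking by \<open>\<tau>\<close> gains room
    \<open>\<rho>\<close> around every point.\<close>
  have inK: "\<tau> *\<^sub>R a + b \<in> K" if "a \<in> K" "norm b < \<rho>" for a b
  proof -
    have "norm ((1 / (1 - \<tau>)) *\<^sub>R b) < r" using that(2) \<tau> by (simp add: \<rho>_def field_simps)
    then have "(1 / (1 - \<tau>)) *\<^sub>R b \<in> K" using r(2) by auto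
    then have "(1 - \<tau>) *\<^sub>R ((1 / (1 - \<tau>)) *\<^sub>R b) + \<tau> *\<^sub>R a \<in> K"
      using convexD_alt[OF K(2) _ that(1), of "(1 / (1 - \<tau>)) *\<^sub>R b" \<tau>] \<tau> by simp
    then show ?thesis using \<tau> by (simp add: add.commute)
  qed
  have proj: "P \<subseteq> drop_coord k ` side \<sigma>" if "\<sigma> = 1 \<or> \<sigma> = -1" for \<sigma>
  proof
    fix x assume x: "x \<in> P"
    then obtain a where a: "a \<in> K" "x = \<tau> *\<^sub>R drop_coord k a" by (auto simp: P_def)
    have xa: "x = drop_coord k (\<tau> *\<^sub>R a)" using a by (simp add: linear_scale[OF linear_drop_coord])
    have "\<tau> *\<^sub>R a \<in> K" using inK[OF a(1), of 0] \<rho> by simp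
    moreover have "\<sigma> *\<^sub>R e \<noteq> 0" using that by auto
    ultimately obtain t where t: "\<tau> *\<^sub>R a + t *\<^sub>R \<sigma> *\<^sub>R e \<in> frontier K"
      "\<And>s. t < s \<Longrightarrow> \<tau> *\<^sub>R a + s *\<^sub>R \<sigma> *\<^sub>R e \<notin> K"
      using top_point_exists[OF K(1), of "\<tau> *\<^sub>R a" "\<sigma> *\<^sub>R e"] by blast
    define p where "p = \<tau> *\<^sub>R a + (t * \<sigma>) *\<^sub>R e"
    have dp: "drop_coord k p = x"
      unfolding p_def xa using e(2) by (simp add: linear_add[OF linear_drop_coord] linear_scale[OF linear_drop_coord])
    have "p + (u * \<sigma>) *\<^sub>R e \<notin> K" if "u > 0" for u
      using t(2)[of "t + u"] that by (simp add: p_def algebra_simps)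
    then have "p \<in> side \<sigma>" using t(1) dp x by (simp add: side_def p_def)
    then show "x \<in> drop_coord k ` side \<sigma>" using dp by blast
  qed
  \<comment> \<open>The point \<open>\<tau> *\<^sub>R a\<close> lies over the projection of
    \<open>p\<close> at height \<open>h\<close>. The room above it forces the upper point
    \<open>p\<close> to height at least \<open>h + t\<close>. Moving it sideways by less than
    \<open>t\<close> gives a point of \<open>K\<close> at height \<open>h\<close> on the vertical
    line through \<open>q\<close>, so the lower point \<open>q\<close> has height at most
    \<open>h\<close>.\<close>
  have sep: "\<rho> \<le> dist p q" if pq: "p \<in> side 1" "q \<in> side (-1)" for p q
  proof (rule ccontr)
    assume "\<not> \<rho> \<le> dist p q"
    then obtain t where t: "dist p q < t" "t < \<rho>" using dense[of "dist p q" \<rho>] by auto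
    have t0: "0 < t" using t(1) zero_le_dist[of p q] by linarith
    obtain a where a: "a \<in> K" "drop_coord k p = \<tau> *\<^sub>R drop_coord k a"
      using pq(1) by (auto simp: side_def P_def)
    define h where "h = \<tau> * a $ k"
    have pa: "\<tau> *\<^sub>R a = p + (h - p $ k) *\<^sub>R e"
    proof -
      have "\<tau> *\<^sub>R a = drop_coord k (\<tau> *\<^sub>R a) + h *\<^sub>R e" by (simp add: de h_def)
      also have "drop_coord k (\<tau> *\<^sub>R a) = p - p $ k *\<^sub>R e"
        using a(2) by (simp only: linear_scale[OF linear_drop_coord] flip: de)
      finally show ?thesis by (simp add: algebra_simps)
    qed
    have "\<tau> *\<^sub>R a + t *\<^sub>R e \<in> K" using t t0 by (intro inK a) simp
    then have "p + (h + t - p $ k) *\<^sub>R e \<in> K" by (simp add: pa algebra_simps)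
    moreover have "p + s *\<^sub>R e \<notin> K" if "0 < s" for s
      using pq(1) that by (simp add: side_def)
    ultimately have up: "h + t \<le> p $ k" by (metis diff_gt_0_iff_gt not_less)
    have "\<tau> *\<^sub>R a + drop_coord k (q - p) \<in> K"
      using t norm_drop_coord_le[of k "q - p"] by (intro inK a) (simp add: dist_norm norm_minus_commute)
    moreover have "\<tau> *\<^sub>R a + drop_coord k (q - p) = q + (h - q $ k) *\<^sub>R e"
      by (simp add: pa de algebra_simps)
    ultimately have "q + ((q $ k - h) * -1) *\<^sub>R e \<in> K" by simp
    moreover have "q + (s * -1) *\<^sub>R e \<notin> K" if "0 < s" for s
      using pq(2) that by (simp add: side_def)
    ultimately have low: "q $ k \<le> h" by (metis diff_gt_0_iff_gt not_less)
    have "t \<le> \<bar>(p - q) $ k\<bar>" using up low by simp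
    also have "\<dots> \<le> dist p q" using component_le_norm_cart[of "p - q" k] by (simp add: dist_norm)
    finally show False using t(1) by simp
  qed
  have HP: "ennreal (\<tau> ^ m) * hmeasure m (drop_coord k ` K) = hmeasure m P"
    unfolding P_def using \<tau> by (simp add: hmeasure_scaleR)
  have "hmeasure m P \<le> hmeasure m (side \<sigma>)" if "\<sigma> = 1 \<or> \<sigma> = -1" for \<sigma>
  proof -
    have "hmeasure m P \<le> hmeasure m (drop_coord k ` side \<sigma>)"
      by (rule hmeasure_mono[OF proj[OF that]])
    also have "\<dots> \<le> hmeasure m (side \<sigma>)"
      by (rule hmeasure_contraction)
        (simp add: dist_norm norm_drop_coord_le flip: linear_diff[OF linear_drop_coord])
    finally show ?thesis .
  qed
  then have "hmeasure m P + hmeasure m P \<le> hmeasure m (side 1) + hmeasure m (side (-1))"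
    by (intro add_mono) auto
  also have "\<dots> \<le> hmeasure m (side 1 \<union> side (-1))"
    by (rule hmeasure_Un_separated[OF m \<rho> sep])
  also have "\<dots> \<le> hmeasure m (frontier K)"
    by (rule hmeasure_mono) (auto simp: side_def)
  finally show ?thesis unfolding HP by (simp add: mult_2)
qed

text \<open>The centered estimate after translation, with \<open>\<tau>\<close> tending to 1; a
  boundary of infinite measure is trivial.\<close>

lemma hmeasure_frontier_ge:
  fixes K :: "(real^'n) set"
  assumes n: "CARD('n) \<ge> 2" and K: "compact K" "convex K" and r: "0 < r" "ball z r \<subseteq> K"
  shows "ennreal (2 * (flat_cube_const k * cylinder_vol k (drop_coord k ` K))) \<le>
    hmeasure (CARD('n) - 1) (frontier K)"
proof -
  let ?m = "CARD('n) - 1" and ?v = "flat_cube_const k * cylinder_vol k (drop_coord k ` K)"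
    and ?K = "(+) (- z) ` K"
  have v: "0 \<le> ?v" using flat_cube_const_pos[OF n, of k] by (simp add: cylinder_vol_def)
  have H: "hmeasure ?m (drop_coord k ` ?K) = ennreal ?v"
    using hmeasure_shadow[OF n K r, of k]
    by (simp only: linear_image_translation[OF linear_drop_coord] hmeasure_translation)
  have F: "hmeasure ?m (frontier ?K) = hmeasure ?m (frontier K)"
    by (simp only: frontier_translation hmeasure_translation)
  have b: "ennreal (2 * (\<tau> ^ ?m * ?v)) \<le> hmeasure ?m (frontier K)" if \<tau>: "0 < \<tau>" "\<tau> < 1" for \<tau>
  proof -
    have "2 * (ennreal (\<tau> ^ ?m) * ennreal ?v) \<le> hmeasure ?m (frontier K)"
      unfolding H[symmetric] F[symmetric]
      using n K by (intro hmeasure_frontier_ge_centered[OF _ _ _ r(1) ball_translation_subset[OF r(2)] \<tau>]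
        compact_translation convex_translation) auto
    then show ?thesis using \<tau> v by (simp add: ennreal_mult)
  qed
  show ?thesis
  proof (cases "hmeasure ?m (frontier K) = top")
    case False
    then obtain x where x: "hmeasure ?m (frontier K) = ennreal x" "0 \<le> x"
      by (cases "hmeasure ?m (frontier K)") auto
    define t where "t n = 1 / real (n + 2)" for n
    have t: "0 < t n" "t n < 1" for n by (simp_all add: t_def)
    have t0: "t \<longlonglongrightarrow> 0" unfolding t_def
      using LIMSEQ_ignore_initial_segment[OF lim_1_over_n, of 2] by simp
    have bnd: "2 * ((1 - t n) ^ ?m * ?v) \<le> x" for n
    proof -
      have "ennreal (2 * ((1 - t n) ^ ?m * ?v)) \<le> ennreal x"
        using b[of "1 - t n"] t[of n] unfolding x(1) by simp
      then show ?thesis using x(2) by simp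
    qed
    have "(\<lambda>n. 2 * ((1 - t n) ^ ?m * ?v)) \<longlonglongrightarrow> 2 * ((1 - 0) ^ ?m * ?v)"
      by (intro tendsto_intros t0)
    then have "2 * ((1 - 0) ^ ?m * ?v) \<le> x"
      by (rule LIMSEQ_le_const2) (intro exI[of _ 0] allI impI bnd)
    then show ?thesis unfolding x(1) by (intro ennreal_leI) simp
  qed simp
qed

text \<open>\<open>- a\<close> is an outer normal of \<open>A\<close> at \<open>p\<close>, and
  expanding the square shows that moving out along a normal does not change the nearest
  point.\<close>

lemma closest_point_outward:
  fixes A :: "'a::euclidean_space set"
  assumes A: "convex A" "closed A" "p \<in> A" and a: "\<And>y. y \<in> A \<Longrightarrow> a \<bullet> p \<le> a \<bullet> y" and t: "0 \<le> t"
  shows "closest_point A (p - t *\<^sub>R a) = p"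
proof (rule closest_point_unique[symmetric, OF A])
  show "\<forall>y\<in>A. dist (p - t *\<^sub>R a) p \<le> dist (p - t *\<^sub>R a) y"
  proof
    fix y assume y: "y \<in> A"
    have "(norm (t *\<^sub>R a))\<^sup>2 \<le> (norm ((y - p) + t *\<^sub>R a))\<^sup>2"
    proof -
      have "(norm ((y - p) + t *\<^sub>R a))\<^sup>2 =
          (norm (y - p))\<^sup>2 + (norm (t *\<^sub>R a))\<^sup>2 + 2 * (t * ((a \<bullet> y) - (a \<bullet> p)))"
        by (simp only: power2_norm_eq_inner)
          (simp add: inner_add_left inner_add_right inner_diff_left inner_diff_right inner_commute algebra_simps)
      moreover have "0 \<le> t * ((a \<bullet> y) - (a \<bullet> p))" using t a[OF y] by simp
      ultimately show ?thesis by simp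
    qed
    then have "norm (t *\<^sub>R a) \<le> norm ((y - p) + t *\<^sub>R a)" by (rule power2_le_imp_le) simp
    also have "norm ((y - p) + t *\<^sub>R a) = norm (p - t *\<^sub>R a - y)"
      by (metis (no_types, lifting) add_diff_eq diff_diff_eq2 minus_diff_eq norm_minus_cancel add.commute)
    finally show "dist (p - t *\<^sub>R a) p \<le> dist (p - t *\<^sub>R a) y" by (simp add: dist_norm)
  qed
qed

text \<open>
  The nearest-point map of a convex body does not increase distances, and it maps the boundary of
  every bounded superset onto the boundary of the body.
\<close>

lemma hmeasure_frontier_mono:
  fixes A L :: "'a::euclidean_space set"
  assumes A: "compact A" "convex A" "interior A \<noteq> {}" and L: "A \<subseteq> L" "bounded L"
  shows "hmeasure m (frontier A) \<le> hmeasure m (frontier L)"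
proof -
  have cl: "closed A" and ne: "A \<noteq> {}" using A interior_subset by (auto simp: compact_imp_closed)
  have "frontier A \<subseteq> closest_point A ` frontier L"
  proof
    fix p assume p: "p \<in> frontier A"
    then have pA: "p \<in> A" using cl by (auto simp: frontier_def)
    have "p \<notin> rel_interior A"
      using p A(3) by (simp add: frontier_def rel_interior_nonempty_interior)
    then obtain a where a: "a \<noteq> 0" "\<And>y. y \<in> A \<Longrightarrow> a \<bullet> p \<le> a \<bullet> y"
      using supporting_hyperplane_rel_boundary[OF A(2) pA] by metis
    obtain R where R: "\<And>x. x \<in> L \<Longrightarrow> norm x \<le> R" using L(2) bounded_iff by blast
    \<comment> \<open>Far enough that \<open>p - T *\<^sub>R a\<close> has norm above
      \<open>R\<close> and leaves \<open>L\<close>; the segment to it crosses the boundary of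
      \<open>L\<close> at a point whose nearest point in \<open>A\<close> is
      \<open>p\<close>.\<close>
    define T where "T = (R + norm p + 1) / norm a"
    have "norm p \<le> R" using R L(1) pA by auto
    then have RT: "0 \<le> R" using norm_ge_zero[of p] by linarith
    have T: "0 \<le> T" unfolding T_def using RT by (intro divide_nonneg_nonneg) auto
    have "p - T *\<^sub>R a \<notin> L"
    proof
      assume "p - T *\<^sub>R a \<in> L"
      then have "norm (p - T *\<^sub>R a) \<le> R" by (rule R)
      moreover have "norm (T *\<^sub>R a) \<le> norm (p - T *\<^sub>R a) + norm p"
        using norm_triangle_ineq4[of p "p - T *\<^sub>R a"] by (simp add: add.commute)
      moreover have "norm (T *\<^sub>R a) = R + norm p + 1"
        using a(1) T RT by (simp add: T_def)
      ultimately show False by simp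
    qed
    moreover have "p \<in> L" using pA L(1) by blast
    ultimately have "closed_segment p (p - T *\<^sub>R a) \<inter> frontier L \<noteq> {}"
      by (intro connected_Int_frontier) (auto intro: convex_connected)
    then obtain q where q: "q \<in> closed_segment p (p - T *\<^sub>R a)" "q \<in> frontier L" by auto
    then obtain u where u: "0 \<le> u" "u \<le> 1" "q = (1 - u) *\<^sub>R p + u *\<^sub>R (p - T *\<^sub>R a)"
      by (auto simp: in_segment)
    then have "q = p - (u * T) *\<^sub>R a" by (simp add: algebra_simps)
    then have "closest_point A q = p"
      using closest_point_outward[OF A(2) cl pA a(2)] u T by simp
    then show "p \<in> closest_point A ` frontier L" using q(2) by force
  qed
  then have "hmeasure m (frontier A) \<le> hmeasure m (closest_point A ` frontier L)"
    by (rule hmeasure_mono)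
  also have "\<dots> \<le> hmeasure m (frontier L)"
    by (intro hmeasure_contraction closest_point_lipschitz A cl ne)
  finally show ?thesis .
qed

text \<open>Undoing the flattening stretches norms by at most \<open>1 / \<delta>\<close>, because
  this factor is at least 1.\<close>

lemma scale_coord_ball:
  fixes K :: "(real^'n) set"
  assumes "ball 0 r \<subseteq> K" "0 < \<delta>" "\<delta> \<le> 1"
  shows "ball 0 (\<delta> * r) \<subseteq> scale_coord k \<delta> ` K"
proof
  fix x :: "real^'n" assume x: "x \<in> ball 0 (\<delta> * r)"
  define y where "y = scale_coord k (1 / \<delta>) x"
  have xy: "x = scale_coord k \<delta> y" using assms by (simp add: y_def vec_eq_iff)
  have "norm y \<le> norm ((1 / \<delta>) *\<^sub>R x)"
  proof (rule norm_le_componentwise_cart)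
    fix i
    have "1 \<le> 1 / \<delta>" using assms by simp
    then have "1 * \<bar>x $ i\<bar> \<le> (1 / \<delta>) * \<bar>x $ i\<bar>" by (rule mult_right_mono) simp
    then show "norm (y $ i) \<le> norm (((1 / \<delta>) *\<^sub>R x) $ i)"
      using assms by (auto simp: y_def abs_mult)
  qed
  also have "\<dots> < r" using x assms by (simp add: field_simps)
  finally have "y \<in> K" using assms(1) by auto
  then show "x \<in> scale_coord k \<delta> ` K" using xy by blast
qed

lemma drop_scale_coord: "drop_coord k (scale_coord k \<delta> x) = drop_coord k x"
  by (simp add: vec_eq_iff)

text \<open>
  A body flattened along a coordinate axis lies below the tent \<open>\<eta> \<psi>\<close> over a slightly enlarged
  shadow \<open>Q\<close>, where \<open>\<psi>\<close> is the distance to the complement of \<open>Q\<close>; the tent is the image of two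
  copies of \<open>Q\<close> under maps with Lipschitz constant \<open>1 + \<eta>\<close>.
\<close>

lemma hmeasure_frontier_flattened_le_centered:
  fixes K :: "(real^'n) set"
  assumes n: "CARD('n) \<ge> 2" and K: "compact K" "convex K" and r: "0 < r" "ball 0 r \<subseteq> K" and \<eta>: "0 < \<eta>"
  obtains \<delta> where "0 < \<delta>" "\<delta> \<le> 1"
    "hmeasure m (frontier (scale_coord k \<delta> ` K)) \<le>
      2 * (ennreal (((1 + \<eta>) * (1 + \<eta>)) ^ m) * hmeasure m (drop_coord k ` K))"
proof -
  define e :: "real^'n" where "e = axis k 1"
  have e [simp]: "e $ k = 1" "drop_coord k e = 0" "norm e = 1"
    by (simp_all add: e_def norm_axis_1 drop_coord_eq)
  have de: "x = drop_coord k x + x $ k *\<^sub>R e" for x by (simp add: drop_coord_eq e_def)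
  note lin = linear_drop_coord[of k]
  define P where "P = drop_coord k ` K"
  define Q where "Q = (*\<^sub>R) (1 + \<eta>) ` P"
  \<comment> \<open>The complement is taken inside the hyperplane; in the whole space it would be
    dense and the distance to it would vanish.\<close>
  define W where "W = {x :: real^'n. x $ k = 0} - Q"
  define \<psi> where "\<psi> x = infdist (drop_coord k x) W" for x
  define L where "L = {x. drop_coord k x \<in> Q \<and> \<bar>x $ k\<bar> \<le> \<eta> * \<psi> x}"
  have P: "compact P" "convex P" unfolding P_def using K lin
    by (auto intro: compact_linear_image convex_linear_image)
  have P0: "x $ k = 0" if "x \<in> P" for x using that by (auto simp: P_def)
  have Q: "compact Q" unfolding Q_def using P(1) by (rule compact_scaling)
  have Q0: "x $ k = 0" if "x \<in> Q" for x using that P0 by (auto simp: Q_def)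
  obtain RQ where RQ: "\<And>x. x \<in> Q \<Longrightarrow> norm x \<le> RQ" using compact_imp_bounded[OF Q] bounded_iff by blast
  obtain R where R: "0 < R" "\<And>x. x \<in> K \<Longrightarrow> norm x \<le> R" using compact_imp_bounded[OF K(1)] bounded_pos by blast
  \<comment> \<open>A second coordinate yields a point of the hyperplane outside the bounded set
    \<open>Q\<close>, so \<open>W\<close> is nonempty; \<open>infdist\<close> to the empty set would
    be 0 by convention.\<close>
  have "\<exists>j. j \<noteq> k"
  proof (rule ccontr)
    assume "\<nexists>j. j \<noteq> k"
    then have "UNIV = {k}" by auto
    then have "CARD('n) = card {k}" by metis
    then show False using n by simp
  qed
  then obtain j where j: "j \<noteq> k" by blast
  define y0 :: "real^'n" where "y0 = (\<bar>RQ\<bar> + 1) *\<^sub>R axis j 1"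
  have y0: "y0 \<in> W"
  proof -
    have "norm y0 = \<bar>RQ\<bar> + 1" by (simp add: y0_def norm_axis_1)
    then have "y0 \<notin> Q" using RQ[of y0] by linarith
    moreover have "y0 $ k = 0" using j by (simp add: y0_def axis_def)
    ultimately show ?thesis by (simp add: W_def)
  qed
  then have Wne: "W \<noteq> {}" by auto
  have \<psi>lip: "\<bar>\<psi> x - \<psi> y\<bar> \<le> dist x y" for x y
  proof -
    have "\<bar>\<psi> x - \<psi> y\<bar> \<le> dist (drop_coord k x) (drop_coord k y)"
      unfolding \<psi>_def by (rule infdist_triangle_abs)
    also have "\<dots> \<le> dist x y"
      by (simp add: dist_norm norm_drop_coord_le flip: linear_diff[OF lin])
    finally show ?thesis .
  qed
  have cont_d: "continuous_on UNIV (drop_coord k :: real^'n \<Rightarrow> _)"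
    using lin linear_continuous_on linear_conv_bounded_linear by blast
  have cont_\<psi>: "continuous_on UNIV \<psi>"
    unfolding \<psi>_def by (intro continuous_on_infdist cont_d)
  have QW: "\<psi> x = 0" if "drop_coord k x \<notin> Q" for x
  proof -
    have "drop_coord k x \<in> W" using that by (simp add: W_def)
    then show ?thesis by (simp add: \<psi>_def)
  qed
  \<comment> \<open>A point of \<open>W\<close> closer than \<open>\<eta> * r\<close> to a point of
    \<open>P\<close> would differ from it by an element of \<open>\<eta>\<close> times
    \<open>P\<close>, hence lie in \<open>Q\<close>.\<close>
  have \<psi>big: "\<eta> * r \<le> \<psi> x" if "drop_coord k x \<in> P" for x
    unfolding \<psi>_def infdist_notempty[OF Wne]
  proof (rule cINF_greatest[OF Wne])
    fix y assume y: "y \<in> W"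
    show "\<eta> * r \<le> dist (drop_coord k x) y"
    proof (rule ccontr)
      assume "\<not> \<eta> * r \<le> dist (drop_coord k x) y"
      then have d: "norm (y - drop_coord k x) < \<eta> * r" by (simp add: dist_norm norm_minus_commute)
      have "norm ((1 / \<eta>) *\<^sub>R (y - drop_coord k x)) < r"
        unfolding norm_scaleR using d \<eta> by (simp add: field_simps)
      moreover have "((1 / \<eta>) *\<^sub>R (y - drop_coord k x)) $ k = 0" using y by (simp add: W_def)
      ultimately have v: "(1 / \<eta>) *\<^sub>R (y - drop_coord k x) \<in> P"
        unfolding P_def by (intro drop_coord_ball[OF r(2)])
      have "y = 1 *\<^sub>R drop_coord k x + \<eta> *\<^sub>R ((1 / \<eta>) *\<^sub>R (y - drop_coord k x))" using \<eta> by simp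
      also have "\<dots> \<in> (*\<^sub>R) 1 ` P + (*\<^sub>R) \<eta> ` P" using that v by (intro set_plus_intro imageI)
      also have "\<dots> = Q" unfolding Q_def using \<eta> by (intro scaleR_image_add P) auto
      finally show False using y by (simp add: W_def)
    qed
  qed
  have PQ: "P \<subseteq> Q"
  proof
    fix x assume x: "x \<in> P"
    then have "drop_coord k x = x" using P0[OF x] by (auto simp: vec_eq_iff)
    then have "0 < \<psi> x" using \<psi>big[of x] x \<eta> r(1) by (metis less_le_trans mult_pos_pos)
    then show "x \<in> Q" using QW[of x] \<open>drop_coord k x = x\<close> by auto
  qed
  \<comment> \<open>Flattened heights are at most \<open>\<delta> * R\<close>, while the tent over
    \<open>P\<close> has height at least \<open>\<eta> * (\<eta> * r)\<close>.\<close>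
  define \<delta> where "\<delta> = min 1 (\<eta> * \<eta> * r / R)"
  have \<delta>: "0 < \<delta>" "\<delta> \<le> 1" "\<delta> * R \<le> \<eta> * (\<eta> * r)"
    using \<eta> r(1) R(1) by (auto simp: \<delta>_def min_def field_simps)
  define A where "A = scale_coord k \<delta> ` K"
  have A: "compact A" "convex A" unfolding A_def using K linear_scale_coord[of k \<delta>]
    by (auto intro: compact_linear_image convex_linear_image)
  have "ball 0 (\<delta> * r) \<subseteq> A" unfolding A_def by (rule scale_coord_ball[OF r(2) \<delta>(1,2)])
  then have Ai: "interior A \<noteq> {}" using \<delta>(1) r(1) by (metis ball_eq_empty interior_maximal mult_pos_pos not_le open_ball subset_empty)
  have AL: "A \<subseteq> L"
  proof
    fix x assume "x \<in> A"
    then obtain y where y: "y \<in> K" "x = scale_coord k \<delta> y" by (auto simp: A_def)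
    have dP: "drop_coord k x \<in> P" using y by (simp add: drop_scale_coord P_def)
    have "\<bar>x $ k\<bar> = \<delta> * \<bar>y $ k\<bar>" using y \<delta>(1) by (simp add: abs_mult)
    also have "\<dots> \<le> \<delta> * R"
      using component_le_norm_cart[of y k] R(2)[OF y(1)] \<delta>(1) by (intro mult_left_mono) auto
    also have "\<dots> \<le> \<eta> * (\<eta> * r)" by (rule \<delta>(3))
    also have "\<dots> \<le> \<eta> * \<psi> x" using \<psi>big[OF dP] \<eta> by (intro mult_left_mono) auto
    finally show "x \<in> L" using dP PQ by (auto simp: L_def)
  qed
  have "closed L"
  proof -
    have "L = (drop_coord k -` Q) \<inter> {x. \<bar>x $ k\<bar> \<le> \<eta> * \<psi> x}" by (auto simp: L_def)
    moreover have "closed (drop_coord k -` Q)"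
      using Q cont_d by (intro closed_vimage) (auto simp: compact_imp_closed)
    moreover have "closed {x. \<bar>x $ k\<bar> \<le> \<eta> * \<psi> x}"
      by (intro closed_Collect_le continuous_intros cont_\<psi>)
    ultimately show ?thesis by auto
  qed
  have Lb: "bounded L"
  proof -
    have "norm x \<le> RQ + \<eta> * (RQ + norm y0)" if "x \<in> L" for x
    proof -
      have a: "drop_coord k x \<in> Q" "\<bar>x $ k\<bar> \<le> \<eta> * \<psi> x" using that by (auto simp: L_def)
      have "\<psi> x \<le> dist (drop_coord k x) y0" unfolding \<psi>_def by (rule infdist_le[OF y0])
      also have "\<dots> \<le> RQ + norm y0"
        using RQ[OF a(1)] norm_triangle_ineq4[of "drop_coord k x" y0] by (simp add: dist_norm)
      finally have "\<eta> * \<psi> x \<le> \<eta> * (RQ + norm y0)" using \<eta> by (intro mult_left_mono) auto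
      moreover have "norm x \<le> norm (drop_coord k x) + \<bar>x $ k\<bar>"
        using norm_triangle_ineq[of "drop_coord k x" "x $ k *\<^sub>R e"] de[of x] by simp
      ultimately show ?thesis using RQ[OF a(1)] a(2) by linarith
    qed
    then show ?thesis by (auto simp: bounded_iff)
  qed
  define tent where "tent \<sigma> x = x + (\<sigma> * \<eta> * \<psi> x) *\<^sub>R e" for \<sigma> x
  have "frontier L \<subseteq> tent 1 ` Q \<union> tent (-1) ` Q"
  proof
    fix q assume q: "q \<in> frontier L"
    then have qL: "q \<in> L" using \<open>closed L\<close> by (auto simp: frontier_def)
    \<comment> \<open>Strict inequality is an open condition and, since \<open>\<psi>\<close>
      vanishes outside \<open>Q\<close>, already implies membership in \<open>L\<close>; it would
      make \<open>q\<close> interior.\<close>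
    have "\<bar>q $ k\<bar> = \<eta> * \<psi> q"
    proof (rule ccontr)
      assume "\<bar>q $ k\<bar> \<noteq> \<eta> * \<psi> q"
      then have "\<bar>q $ k\<bar> < \<eta> * \<psi> q" using qL by (simp add: L_def)
      moreover have "open {x. \<bar>x $ k\<bar> < \<eta> * \<psi> x}"
        by (intro open_Collect_less continuous_intros cont_\<psi>)
      moreover have "{x. \<bar>x $ k\<bar> < \<eta> * \<psi> x} \<subseteq> L"
      proof
        fix x assume "x \<in> {x. \<bar>x $ k\<bar> < \<eta> * \<psi> x}"
        then have x: "\<bar>x $ k\<bar> < \<eta> * \<psi> x" by simp
        then have "\<psi> x \<noteq> 0" by auto
        then show "x \<in> L" using QW[of x] x by (auto simp: L_def)
      qed
      ultimately have "q \<in> interior L" using interior_maximal by blast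
      then show False using q by (simp add: frontier_def)
    qed
    then have "q $ k = \<eta> * \<psi> q \<or> q $ k = -1 * \<eta> * \<psi> q" by auto
    moreover have "\<psi> (drop_coord k q) = \<psi> q" by (simp add: \<psi>_def)
    ultimately have "q = tent 1 (drop_coord k q) \<or> q = tent (-1) (drop_coord k q)"
      using de[of q] unfolding tent_def by (metis mult_1)
    moreover have "drop_coord k q \<in> Q" using qL by (simp add: L_def)
    ultimately show "q \<in> tent 1 ` Q \<union> tent (-1) ` Q" by blast
  qed
  then have "hmeasure m (frontier L) \<le> hmeasure m (tent 1 ` Q) + hmeasure m (tent (-1) ` Q)"
    by (meson hmeasure_Un hmeasure_mono order_trans)
  also have "\<dots> \<le> ennreal ((1 + \<eta>) ^ m) * hmeasure m Q + ennreal ((1 + \<eta>) ^ m) * hmeasure m Q"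
  proof -
    have "hmeasure m (tent \<sigma> ` Q) \<le> ennreal ((1 + \<eta>) ^ m) * hmeasure m Q" if "\<bar>\<sigma>\<bar> = 1" for \<sigma>
    proof (rule hmeasure_lipschitz_image)
      fix x y
      have "tent \<sigma> x - tent \<sigma> y = (x - y) + (\<sigma> * \<eta> * (\<psi> x - \<psi> y)) *\<^sub>R e"
        by (simp add: tent_def algebra_simps)
      then have "dist (tent \<sigma> x) (tent \<sigma> y) \<le> dist x y + \<bar>\<sigma> * \<eta> * (\<psi> x - \<psi> y)\<bar>"
        using norm_triangle_ineq[of "x - y" "(\<sigma> * \<eta> * (\<psi> x - \<psi> y)) *\<^sub>R e"] by (simp add: dist_norm)
      also have "\<bar>\<sigma> * \<eta> * (\<psi> x - \<psi> y)\<bar> = \<eta> * \<bar>\<psi> x - \<psi> y\<bar>" using that \<eta> by (simp add: abs_mult)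
      also have "dist x y + \<eta> * \<bar>\<psi> x - \<psi> y\<bar> \<le> (1 + \<eta>) * dist x y"
        using mult_left_mono[OF \<psi>lip[of x y], of \<eta>] \<eta> by (simp add: algebra_simps)
      finally show "dist (tent \<sigma> x) (tent \<sigma> y) \<le> (1 + \<eta>) * dist x y" by simp
    qed (use \<eta> in simp)
    then show ?thesis by (intro add_mono) auto
  qed
  also have "\<dots> = 2 * (ennreal ((1 + \<eta>) ^ m) * hmeasure m Q)" by (simp add: mult_2)
  also have "hmeasure m Q = ennreal ((1 + \<eta>) ^ m) * hmeasure m P"
    unfolding Q_def using \<eta> by (simp add: hmeasure_scaleR)
  also have "ennreal ((1 + \<eta>) ^ m) * (ennreal ((1 + \<eta>) ^ m) * hmeasure m P) =
      ennreal (((1 + \<eta>) * (1 + \<eta>)) ^ m) * hmeasure m P"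
    using \<eta> by (simp add: power_mult_distrib ennreal_mult mult.assoc)
  finally have "hmeasure m (frontier L) \<le>
      2 * (ennreal (((1 + \<eta>) * (1 + \<eta>)) ^ m) * hmeasure m P)" .
  with hmeasure_frontier_mono[OF A Ai AL Lb, of m]
  show thesis using that[OF \<delta>(1,2)] unfolding A_def P_def by (meson order_trans)
qed

section \<open>The counterexample\<close>

lemma hmeasure_frontier_flattened_le:
  fixes K :: "(real^'n) set"
  assumes n: "CARD('n) \<ge> 2" and K: "compact K" "convex K" and r: "0 < r" "ball z r \<subseteq> K" and \<eta>: "0 < \<eta>"
  obtains \<delta> where "0 < \<delta>" "\<delta> \<le> 1"
    "hmeasure (CARD('n) - 1) (frontier (scale_coord k \<delta> ` K)) \<le>
      ennreal (2 * ((1 + \<eta>) * (1 + \<eta>)) ^ (CARD('n) - 1) * (flat_cube_const k * cylinder_vol k (drop_coord k ` K)))"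
proof -
  let ?K = "(+) (- z) ` K" and ?m = "CARD('n) - 1" and ?v = "flat_cube_const k * cylinder_vol k (drop_coord k ` K)"
  have v: "0 \<le> ?v" using flat_cube_const_pos[OF n, of k] by (simp add: cylinder_vol_def)
  have cK: "compact ?K" "convex ?K" using K by (intro compact_translation convex_translation; simp)+
  obtain \<delta> where \<delta>: "0 < \<delta>" "\<delta> \<le> 1"
    "hmeasure ?m (frontier (scale_coord k \<delta> ` ?K)) \<le>
      2 * (ennreal (((1 + \<eta>) * (1 + \<eta>)) ^ ?m) * hmeasure ?m (drop_coord k ` ?K))"
    using hmeasure_frontier_flattened_le_centered[OF n cK r(1) ball_translation_subset[OF r(2)] \<eta>] by metis
  have "hmeasure ?m (drop_coord k ` ?K) = ennreal ?v"
    using hmeasure_shadow[OF n K r, of k]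
    by (simp only: linear_image_translation[OF linear_drop_coord] hmeasure_translation)
  moreover have "hmeasure ?m (frontier (scale_coord k \<delta> ` ?K)) = hmeasure ?m (frontier (scale_coord k \<delta> ` K))"
    by (simp only: linear_image_translation[OF linear_scale_coord] frontier_translation hmeasure_translation)
  moreover have "2 * (ennreal (((1 + \<eta>) * (1 + \<eta>)) ^ ?m) * ennreal ?v) =
      ennreal (2 * ((1 + \<eta>) * (1 + \<eta>)) ^ ?m * ?v)"
    using \<eta> v by (simp add: ennreal_mult mult.assoc)
  ultimately show thesis using that[OF \<delta>(1,2)] \<delta>(3) by metis
qed

lemma compact_convex_scale_coord:
  fixes K :: "(real^'n) set"
  assumes "compact K" "convex K"
  shows "compact (scale_coord k \<delta> ` K)" "convex (scale_coord k \<delta> ` K)"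
  using assms linear_scale_coord[of k \<delta>] by (auto intro: compact_linear_image convex_linear_image)

lemma ball_subset_scale_coord:
  fixes K :: "(real^'n) set"
  assumes "ball z r \<subseteq> K" "0 < \<delta>" "\<delta> \<le> 1"
  shows "ball (scale_coord k \<delta> z) (\<delta> * r) \<subseteq> scale_coord k \<delta> ` K"
proof
  fix x assume "x \<in> ball (scale_coord k \<delta> z) (\<delta> * r)"
  then have "x - scale_coord k \<delta> z \<in> ball 0 (\<delta> * r)" by (simp add: dist_norm norm_minus_commute)
  then have "x - scale_coord k \<delta> z \<in> scale_coord k \<delta> ` (+) (- z) ` K"
    using scale_coord_ball[OF ball_translation_subset[OF assms(1)] assms(2,3)] by blast
  then obtain y where y: "y \<in> K" "x - scale_coord k \<delta> z = scale_coord k \<delta> (y - z)" by auto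
  then have "x = scale_coord k \<delta> y" by (simp add: linear_diff[OF linear_scale_coord])
  then show "x \<in> scale_coord k \<delta> ` K" using y(1) by blast
qed

text \<open>Flattening multiplies both volumes by \<open>\<delta>\<close> and leaves the shadows
  along axis \<open>k\<close> unchanged. The lower bound for the boundary of \<open>M\<close> holds
  for every \<open>\<delta>\<close>, so \<open>\<delta>\<close> can be chosen for \<open>K\<close>
  alone.\<close>

lemma volume_surface_ratio_flattened_less:
  fixes K M :: "(real^'n) set"
  assumes n: "CARD('n) \<ge> 2"
    and K: "compact K" "convex K" "0 < r" "ball z r \<subseteq> K"
    and M: "compact M" "convex M" "0 < r'" "ball z' r' \<subseteq> M"
    and pos: "0 < vol K" "0 < cylinder_vol k (drop_coord k ` K)" "0 < cylinder_vol k (drop_coord k ` M)"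
    and less: "vol M * cylinder_vol k (drop_coord k ` K) <
      vol K * cylinder_vol k (drop_coord k ` M)"
  obtains \<delta> where "0 < \<delta>" "\<delta> \<le> 1"
    "vol (scale_coord k \<delta> ` M) / surface_area (scale_coord k \<delta> ` M) <
     vol (scale_coord k \<delta> ` K) / surface_area (scale_coord k \<delta> ` K)"
proof -
  let ?m = "CARD('n) - 1" and ?K = "vol K" and ?M = "vol M"
  define c where "c = flat_cube_const k"
  define p where "p = cylinder_vol k (drop_coord k ` K)"
  define q where "q = cylinder_vol k (drop_coord k ` M)"
  have c: "0 < c" unfolding c_def by (rule flat_cube_const_pos[OF n])
  have p: "0 < p" and q: "0 < q" using pos by (simp_all add: p_def q_def)
  have M0: "0 \<le> ?M" by simp
  \<comment> \<open>The strict inequality \<open>less\<close> leaves room for the factor lost in the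
    upper bound for the boundary of \<open>K\<close>.\<close>
  obtain \<eta> where \<eta>: "0 < \<eta>" "?M * (((1 + \<eta>) * (1 + \<eta>)) ^ ?m * p) < ?K * q"
  proof -
    define t where "t n = 1 / real (n + 2)" for n
    have "t \<longlonglongrightarrow> 0" unfolding t_def
      using LIMSEQ_ignore_initial_segment[OF lim_1_over_n, of 2] by simp
    then have "(\<lambda>n. ?M * (((1 + t n) * (1 + t n)) ^ ?m * p)) \<longlonglongrightarrow> ?M * (((1 + 0) * (1 + 0)) ^ ?m * p)"
      by (intro tendsto_intros)
    moreover have "?M * (((1 + 0) * (1 + 0)) ^ ?m * p) < ?K * q" using less by (simp add: p_def q_def)
    ultimately have "\<forall>\<^sub>F n in sequentially. ?M * (((1 + t n) * (1 + t n)) ^ ?m * p) < ?K * q"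
      by (rule order_tendstoD(2))
    then obtain N where "?M * (((1 + t N) * (1 + t N)) ^ ?m * p) < ?K * q"
      by (auto simp: eventually_sequentially)
    moreover have "0 < t N" by (simp add: t_def)
    ultimately show thesis using that by blast
  qed
  define g where "g = ((1 + \<eta>) * (1 + \<eta>)) ^ ?m"
  have g: "0 < g" using \<eta>(1) by (simp add: g_def)
  obtain \<delta> where \<delta>: "0 < \<delta>" "\<delta> \<le> 1" "hmeasure ?m (frontier (scale_coord k \<delta> ` K)) \<le> ennreal (2 * g * (c * p))"
    using hmeasure_frontier_flattened_le[OF n K \<eta>(1), of k] unfolding g_def c_def p_def by metis
  have shadow: "drop_coord k ` scale_coord k \<delta> ` S = drop_coord k ` S" for S
    by (simp add: image_image drop_scale_coord)
  have lower: "ennreal (2 * (c * cylinder_vol k (drop_coord k ` S))) \<le> hmeasure ?m (frontier (scale_coord k \<delta> ` S))"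
    if "compact S" "convex S" "0 < s" "ball y s \<subseteq> S" for S s y
    using hmeasure_frontier_ge[OF n compact_convex_scale_coord[OF that(1,2), of k \<delta>] _
        ball_subset_scale_coord[OF that(4) \<delta>(1,2), of k], of k]
      \<delta>(1) that(3) by (simp add: shadow c_def)
  have sa: "surface_area S = enn2real (hmeasure ?m (frontier S))" for S :: "(real^'n) set"
    by (simp add: surface_area_def)
  let ?SK = "surface_area (scale_coord k \<delta> ` K)" and ?SM = "surface_area (scale_coord k \<delta> ` M)"
  have SK: "2 * (c * p) \<le> ?SK" "?SK \<le> 2 * g * (c * p)"
  proof -
    have fin: "hmeasure ?m (frontier (scale_coord k \<delta> ` K)) < top"
      using \<delta>(3) by (rule le_less_trans) simp
    show "?SK \<le> 2 * g * (c * p)" unfolding sa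
      using enn2real_mono[OF \<delta>(3)] g c p by simp
    show "2 * (c * p) \<le> ?SK" unfolding sa
      using enn2real_mono[OF lower[OF K] fin] c p by (simp add: p_def)
  qed
  have SK0: "0 < ?SK" using SK(1) c p by (metis less_le_trans mult_pos_pos zero_less_numeral)
  have mS: "vol (scale_coord k \<delta> ` S) = \<delta> * vol S" if "compact S" for S
    using measure_scale_coord[of S k \<delta>] that \<delta>(1) by (simp add: lmeasurable_compact)
  have "\<delta> * ?M / ?SM < \<delta> * ?K / ?SK"
  proof (cases "hmeasure ?m (frontier (scale_coord k \<delta> ` M)) = top")
    \<comment> \<open>\<open>enn2real\<close> sends infinity to 0 and division by 0 gives 0, so the
      left-hand side is 0 while the right-hand side is positive.\<close>
    case True
    then have "?SM = 0" by (simp add: sa)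
    then show ?thesis using \<delta>(1) pos(1) SK0 by simp
  next
    case False
    then have "2 * (c * q) \<le> ?SM" unfolding sa
      using enn2real_mono[OF lower[OF M]] c q by (simp add: q_def less_top)
    moreover from this have "0 < ?SM" using c q by (metis less_le_trans mult_pos_pos zero_less_numeral)
    ultimately have "\<delta> * ?M / ?SM \<le> \<delta> * ?M / (2 * (c * q))"
      using \<delta>(1) c q by (intro divide_left_mono mult_pos_pos mult_nonneg_nonneg) auto
    also have "\<dots> < \<delta> * ?K / (2 * g * (c * p))"
      using \<eta>(2)[folded g_def] \<delta>(1) c p q g by (simp add: field_simps)
    also have "\<dots> \<le> \<delta> * ?K / ?SK"
      using SK SK0 \<delta>(1) pos(1) g c p by (intro divide_left_mono) auto
    finally show ?thesis .
  qed
  then show thesis using that[OF \<delta>(1,2)] by (simp add: mS K M)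
qed

lemma ball_subset_cube_zonotope:
  fixes ws :: "(real^'n) list"
  shows "ball (\<chi> i. 1 / 2) (1 / 2) \<subseteq> cube_zonotope ws"
proof
  fix x :: "real^'n" assume x: "x \<in> ball (\<chi> i. 1 / 2) (1 / 2)"
  have "0 \<le> x $ i \<and> x $ i \<le> 1" for i
  proof -
    have "\<bar>((\<chi> i. 1 / 2) - x) $ i\<bar> \<le> dist (\<chi> i. 1 / 2) x"
      unfolding dist_norm by (rule component_le_norm_cart)
    then have "\<bar>1 / 2 - x $ i\<bar> < 1 / 2" using x by simp
    then show ?thesis by linarith
  qed
  then have "x + 0 \<in> cube_zonotope ws"
    unfolding cube_zonotope_def
    by (intro set_plus_intro zero_in_sum_list_segments) (simp add: sum_axis_segments_eq_cbox)
  then show "x \<in> cube_zonotope ws" by simp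
qed

lemma axis_in_cube_zonotope: "axis i 1 \<in> cube_zonotope ws"
proof -
  have "0 \<le> axis i (1::real) $ m \<and> axis i (1::real) $ m \<le> 1" for m by (simp add: axis_def)
  then have "axis i 1 + 0 \<in> cube_zonotope ws"
    unfolding cube_zonotope_def
    by (intro set_plus_intro zero_in_sum_list_segments) (simp add: sum_axis_segments_eq_cbox)
  then show ?thesis by simp
qed

lemma aff_dim_eq_card_of_ball:
  fixes A :: "(real^'n) set"
  assumes "0 < r" "ball z r \<subseteq> A"
  shows "aff_dim A = int CARD('n)"
proof -
  have "interior A \<noteq> {}"
    using assms interior_maximal[OF assms(2) open_ball] by (metis centre_in_ball empty_iff subsetD)
  then show ?thesis by (simp add: aff_dim_nonempty_interior)
qed

theorem corollary3p2:
  assumes "CARD('n::finite) \<ge> 4"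
  shows
    "\<not> (\<forall>A B C :: (real ^ 'n) set. zonoid A \<and> zonoid B \<and> zonoid C \<longrightarrow>
        measure lebesgue A * mixed_volume (replicate (CARD('n) - 2) A @ [B, C])
        \<le> real CARD('n) / (real CARD('n) - 1)
          * mixed_volume (replicate (CARD('n) - 1) A @ [B])
          * mixed_volume (replicate (CARD('n) - 1) A @ [C]))
     \<and>
     \<not> (\<forall>(A :: (real ^ 'n) set) u v.
        zonoid A \<and> u \<in> sphere 0 1 \<and> v \<in> sphere 0 1 \<and> u \<noteq> v \<and> independent {u, v} \<longrightarrow>
        measure lebesgue A * proj_volume (orthogonal_comp (span {u, v})) A
          * sqrt (1 - (u \<bullet> v)\<^sup>2)
        \<le> proj_volume (orthogonal_comp {u}) A * proj_volume (orthogonal_comp {v}) A)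
     \<and>
     \<not> (\<forall>(A :: (real ^ 'n) set) B u.
        zonoid A \<and> zonoid B \<and> aff_dim A = int CARD('n) \<and> u \<in> sphere 0 1 \<longrightarrow>
        measure lebesgue (A + B) / proj_volume (orthogonal_comp {u}) (A + B)
        \<ge> measure lebesgue A / proj_volume (orthogonal_comp {u}) A)
     \<and>
     \<not> (\<forall>(A :: (real ^ 'n) set) B.
        zonoid A \<and> zonoid B \<and> aff_dim A = int CARD('n) \<longrightarrow>
        measure lebesgue (A + B) / surface_area (A + B)
        \<ge> measure lebesgue A / surface_area A)"
proof -
  obtain S :: "'n set" where S: "card S = 4" "finite S"
    using obtain_subset_with_card_n[of 4 "UNIV :: 'n set"] assms by auto
  obtain xs where xs: "set xs = S" "distinct xs" using finite_distinct_list[OF S(2)] by blast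
  then have "length xs = Suc (Suc (Suc (Suc 0)))" using S(1) distinct_card by fastforce
  then obtain i j k l where "xs = [i, j, k, l]" by (auto simp: length_Suc_conv)
  then have dist: "distinct [i, j, k, l]" using xs(2) by simp
  then have ij: "i \<noteq> j" by simp
  define ws where "ws = bad_generators i j k l"
  define A where "A = cube_zonotope ws"
  define ei :: "real^'n" where "ei = axis i 1"
  define ej :: "real^'n" where "ej = axis j 1"
  define Si where "Si = seg ei"
  define Sj where "Sj = seg ej"
  note Z = zvol_bad_generators[OF dist, folded ws_def]
  note AC = compact_cube_zonotope[of ws, folded A_def] convex_cube_zonotope[of ws, folded A_def]
  have An: "A \<noteq> {}" using axis_in_cube_zonotope[of i ws] A_def by auto
  have zA: "zonoid A" and zSi: "zonoid Si" and zSj: "zonoid Sj"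
    unfolding A_def Si_def Sj_def
    by (intro zonotope_imp_zonoid zonotope_cube_zonotope zonotope_segment)+
  have vA: "vol A = 85" using Z(1) by (simp add: zvol_def A_def)
  have Ai: "drop_coord i ` A + Si = cube_zonotope (map (drop_coord i) ws)"
    unfolding A_def Si_def ei_def by (rule drop_coord_cube_zonotope)
  have Aj: "drop_coord j ` A + Sj = cube_zonotope (map (drop_coord j) ws)"
    unfolding A_def Sj_def ej_def by (rule drop_coord_cube_zonotope)
  have vAi: "vol (drop_coord i ` A + Si) = 27"
    and vAj: "vol (drop_coord j ` A + Sj) = 53"
    unfolding Ai Aj using Z(2,3) by (simp_all add: zvol_def)
  have dropS: "drop_coord i ` (T + Sj) = drop_coord i ` T + Sj" for T
    using drop_coord_image_plus_segment[of j i T 1] ij by (simp add: Sj_def ej_def)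
  have "drop_coord i ` drop_coord j ` A + Si + Sj = drop_coord i ` (drop_coord j ` A + Sj) + Si"
    unfolding dropS by (simp add: ac_simps)
  also have "\<dots> = cube_zonotope (map (drop_coord i) (map (drop_coord j) ws))"
    unfolding Aj unfolding Si_def ei_def by (rule drop_coord_cube_zonotope)
  finally have vAij: "vol (drop_coord i ` drop_coord j ` A + Si + Sj) = 17"
    using Z(4) by (simp add: zvol_def)
  define M where "M = A + Sj"
  have M: "compact M" "convex M" unfolding M_def Sj_def using AC
    by (auto intro: compact_set_plus convex_set_plus)
  \<comment> \<open>The segment formula along axis \<open>j\<close> gives 85 + 53; in the same way
    the shadow of \<open>M\<close> below has volume 27 + 17.\<close>
  have vM: "vol M = 138"
    using measure_plus_axis_segment[OF AC, of j] vA vAj by (simp add: M_def Sj_def ej_def)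
  have vMi: "vol (drop_coord i ` M + Si) = 44"
  proof -
    have cc: "compact (drop_coord i ` A + Si)" "convex (drop_coord i ` A + Si)"
      unfolding Ai by (rule compact_cube_zonotope convex_cube_zonotope)+
    have "drop_coord i ` M + Si = (drop_coord i ` A + Si) + Sj"
      unfolding M_def dropS by (simp add: ac_simps)
    then have "vol (drop_coord i ` M + Si) =
        27 + vol (drop_coord j ` (drop_coord i ` A + Si) + Sj)"
      using measure_plus_axis_segment[OF cc, of j] vAi by (simp add: Sj_def ej_def)
    also have "drop_coord j ` (drop_coord i ` A + Si) + Sj = cube_zonotope (map (drop_coord j) (map (drop_coord i) ws))"
      unfolding Ai Sj_def ej_def by (rule drop_coord_cube_zonotope)
    also have "map (drop_coord j) (map (drop_coord i) ws) = map (drop_coord i) (map (drop_coord j) ws)"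
      by (simp add: vec_eq_iff)
    finally show ?thesis using Z(4) by (simp add: zvol_def)
  qed
  have ball: "ball (\<chi> i. 1 / 2) (1 / 2) \<subseteq> A" unfolding A_def by (rule ball_subset_cube_zonotope)
  have AM: "A \<subseteq> M"
  proof
    fix x assume "x \<in> A"
    then have "x + 0 \<in> M" unfolding M_def Sj_def by (intro set_plus_intro) auto
    then show "x \<in> M" by simp
  qed
  have d: "real CARD('n) \<ge> 4" using assms by simp
  \<comment> \<open>\<open>A\<close> contains both unit vectors, each axis segment only its
    own.\<close>
  have ne: "A \<noteq> Si" "A \<noteq> Sj"
    using axis_in_cube_zonotope[of j ws] axis_in_cube_zonotope[of i ws]
      axis_not_in_axis_segment[OF ij] axis_not_in_axis_segment[OF ij[symmetric]]
    unfolding A_def Si_def Sj_def ei_def ej_def by metis+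
  have d2: "CARD('n) \<ge> 2" using assms by simp
  note mv = mixed_volume_segments[OF AC An ij d2 ne[unfolded Si_def Sj_def ei_def ej_def],
      folded ei_def ej_def, folded Si_def Sj_def, unfolded vAi vAj vAij]
  have 1: "\<not> vol A * mixed_volume (replicate (CARD('n) - 2) A @ [Si, Sj])
        \<le> real CARD('n) / (real CARD('n) - 1)
          * mixed_volume (replicate (CARD('n) - 1) A @ [Si])
          * mixed_volume (replicate (CARD('n) - 1) A @ [Sj])"
  proof -
    \<comment> \<open>27 * 53 = 1431 against 85 * 17 = 1445, over a common denominator.\<close>
    have "real CARD('n) / (real CARD('n) - 1) * (27 / real CARD('n)) * (53 / real CARD('n)) =
        1431 / (real CARD('n) * (real CARD('n) - 1))"
      using d by (simp add: field_simps)
    also have "\<dots> < 1445 / (real CARD('n) * (real CARD('n) - 1))"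
      using d by (intro divide_strict_right_mono mult_pos_pos) auto
    finally have "real CARD('n) / (real CARD('n) - 1) * (27 / real CARD('n)) * (53 / real CARD('n)) <
        85 * (17 / (real CARD('n) * (real CARD('n) - 1)))" by simp
    then show ?thesis unfolding mv vA not_le .
  qed
  have nrm: "ei \<in> sphere 0 1" "ej \<in> sphere 0 1" by (simp_all add: ei_def ej_def norm_axis_1)
  have eij: "ei \<noteq> ej" "ei \<bullet> ej = 0" using ij by (simp_all add: ei_def ej_def axis_eq_axis inner_axis_axis)
  have ind: "independent {ei, ej}"
    using eij nrm by (intro pairwise_orthogonal_independent)
      (auto simp: pairwise_def orthogonal_def inner_commute)
  have pvi: "proj_volume (orthogonal_comp {ei}) T = vol (drop_coord i ` T + Si)" if "compact T" for T
    using proj_volume_axis[OF that, of i] by (simp add: ei_def Si_def)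
  have pvj: "proj_volume (orthogonal_comp {ej}) A = 53"
    using proj_volume_axis[OF AC(1), of j] vAj by (simp add: ej_def Sj_def)
  have pvij: "proj_volume (orthogonal_comp (span {ei, ej})) A = 17"
    using proj_volume_axis2[OF AC(1) ij] vAij by (simp add: ei_def ej_def Si_def Sj_def)
  have 2: "\<not> vol A * proj_volume (orthogonal_comp (span {ei, ej})) A * sqrt (1 - (ei \<bullet> ej)\<^sup>2)
        \<le> proj_volume (orthogonal_comp {ei}) A * proj_volume (orthogonal_comp {ej}) A"
    by (simp add: eij pvij pvj pvi[OF AC(1)] vA vAi)
  \<comment> \<open>138 / 44 < 85 / 27, because 138 * 27 = 3726 and 85 * 44 = 3740. The same
    inequality of products feeds the surface area case.\<close>
  have 3: "\<not> vol (A + Sj) / proj_volume (orthogonal_comp {ei}) (A + Sj)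
        \<ge> vol A / proj_volume (orthogonal_comp {ei}) A"
    by (simp add: pvi[OF AC(1)] pvi[OF M(1)] vA vAi vM vMi flip: M_def)
  have aff: "aff_dim A = int CARD('n)" by (rule aff_dim_eq_card_of_ball[OF _ ball]) simp
  obtain \<delta> where \<delta>: "0 < \<delta>" "\<delta> \<le> 1"
    "vol (scale_coord i \<delta> ` M) / surface_area (scale_coord i \<delta> ` M) <
     vol (scale_coord i \<delta> ` A) / surface_area (scale_coord i \<delta> ` A)"
  proof (rule volume_surface_ratio_flattened_less[OF d2 AC _ ball M _ order_trans[OF ball AM], of i])
    show "0 < cylinder_vol i (drop_coord i ` A)" "0 < cylinder_vol i (drop_coord i ` M)"
      "vol M * cylinder_vol i (drop_coord i ` A) < vol A * cylinder_vol i (drop_coord i ` M)"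
      using vAi vMi by (simp_all add: cylinder_vol_def Si_def ei_def vA vM)
  qed (simp_all add: vA)
  \<comment> \<open>Flattening acts on axis \<open>i\<close> only, so the segment on axis
    \<open>j\<close> survives and the flattened sum is the flattened \<open>A\<close> plus the same
    segment.\<close>
  have "scale_coord i \<delta> ` Sj = Sj"
  proof -
    have "scale_coord i \<delta> ej = ej" using ij by (auto simp: ej_def vec_eq_iff axis_def)
    then show ?thesis by (simp add: Sj_def linear_image_segment linear_scale_coord)
  qed
  then have AB: "scale_coord i \<delta> ` M = scale_coord i \<delta> ` A + Sj"
    by (simp add: M_def linear_image_set_plus[OF linear_scale_coord])
  have zA': "zonoid (scale_coord i \<delta> ` A)"
    unfolding A_def by (intro zonotope_imp_zonoid zonotope_linear_image zonotope_cube_zonotope linear_scale_coord)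
  have aff': "aff_dim (scale_coord i \<delta> ` A) = int CARD('n)"
    using \<delta>(1) by (intro aff_dim_eq_card_of_ball[OF _ ball_subset_scale_coord[OF ball \<delta>(1,2)]]) simp
  have 4: "\<not> vol (scale_coord i \<delta> ` A + Sj) / surface_area (scale_coord i \<delta> ` A + Sj)
        \<ge> vol (scale_coord i \<delta> ` A) / surface_area (scale_coord i \<delta> ` A)"
    using \<delta>(3) by (simp add: AB)
  from 1 2 3 4 zA zSi zSj zA' nrm eij(1) ind aff aff' show ?thesis by blast
qed

end
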